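(* Let $0\le s\in\mathbb{R}$. Let the orthonormal wavelet family $\{\psi_\lambda\}_{\lambda\in\Lambda}$ correspond to an $r$-regular multiresolution analysis of $L_2(\mathbb{R}^N)$ with $s<r$ and with scaling function $\phi$. Let $H^s(\mathbb{R}^N)$ be equipped with the norm $$\|u\|_{H^s(\mathbb{R}^N)}=\Big(\sum_{j<0}\sum_{\lambda\in\Lambda_j}|\langle u,\psi_\lambda\rangle_{L_2(\mathbb{R}^N)}|^2+\sum_{j\ge0}\sum_{\lambda\in\Lambda_j}2^{2js}|\langle u,\psi_\lambda\rangle_{L_2(\mathbb{R}^N)}|^2\Big)^{1/2}$$ and its corresponding inner product $$\langle u,v\rangle_{H^s(\mathbb{R}^N)}=\sum_{j<0}\sum_{\lambda\in\Lambda_j}\langle u,\psi_\lambda\rangle_{L_2(\mathbb{R}^N)}\overline{\langle v,\psi_\lambda\rangle_{L_2(\mathbb{R}^N)}}+\sum_{j\ge0}\sum_{\lambda\in\Lambda_j}2^{2js}\langle u,\psi_\lambda\rangle_{L_2(\mathbb{R}^N)}\overline{\langle v,\psi_\lambda\rangle_{L_2(\mathbb{R}^N)}}.$$ Then for each $u\in L_2(\mathbb{R}^N)$ the element $E_s^*u$ is given by $$E_s^*u=\sum_{j<0}\sum_{\lambda\in\Lambda_j}\langle u,\psi_\lambda\rangle_{L_2(\mathbb{R}^N)}\psi_\lambda+\sum_{j\ge0}\sum_{\lambda\in\Lambda_j}2^{-2js}\langle u,\psi_\lambda\rangle_{L_2(\mathbb{R}^N)}\psi_\lambda.$$ Moreover,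 if instead $H^s(\mathbb{R}^N)$ is equipped with the norm expressed as $$\|u\|_{H^s(\mathbb{R}^N)}=\Big(\sum_{\lambda\in\Gamma_0}|\langle u,\phi_\lambda\rangle_{L_2(\mathbb{R}^N)}|^2+\sum_{j\ge0}\sum_{\lambda\in\Lambda_j}2^{2js}|\langle u,\psi_\lambda\rangle_{L_2(\mathbb{R}^N)}|^2\Big)^{1/2}$$ and its corresponding inner product $$\langle u,v\rangle_{H^s(\mathbb{R}^N)}=\sum_{\lambda\in\Gamma_0}\langle u,\phi_\lambda\rangle_{L_2(\mathbb{R}^N)}\overline{\langle v,\phi_\lambda\rangle_{L_2(\mathbb{R}^N)}}+\sum_{j\ge0}\sum_{\lambda\in\Lambda_j}2^{2js}\langle u,\psi_\lambda\rangle_{L_2(\mathbb{R}^N)}\overline{\langle v,\psi_\lambda\rangle_{L_2(\mathbb{R}^N)}},$$ then $$E_s^*u=\sum_{\lambda\in\Gamma_0}\langle u,\phi_\lambda\rangle_{L_2(\mathbb{R}^N)}\phi_\lambda+\sum_{j\ge0}\sum_{\lambda\in\Lambda_j}2^{-2js}\langle u,\psi_\lambda\rangle_{L_2(\mathbb{R}^N)}\psi_\lambda.$$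
   Context: $N\in\mathbb{N}$; $L_2(\mathbb{R}^N)$ is the complex Lebesgue space with $\langle u,v\rangle=\int u\overline v\,dx$. $H^s(\mathbb{R}^N)$ is the set of $u\in L_2(\mathbb{R}^N)$ with $(1+4\pi^2|\cdot|^2)^{s/2}\mathcal{F}u\in L_2(\mathbb{R}^N)$, where $(\mathcal{F}u)(\xi)=\int e^{-2\pi i\xi\cdot x}u(x)\,dx$; its standard norm is $\|(1+4\pi^2|\cdot|^2)^{s/2}\mathcal{F}u\|_{L_2(\mathbb{R}^N)}$, and it is a known fact that under the stated assumptions on the wavelets the two norm expressions in the claim are equal and equivalent to this standard norm. $E_s:H^s(\mathbb{R}^N)\to L_2(\mathbb{R}^N)$, $E_su:=u$, is the embedding; its adjoint is defined by $\langle E_s^*u,v\rangle_{H^s(\mathbb{R}^N)}=\langle u,v\rangle_{L_2(\mathbb{R}^N)}$ for all $u\in L_2(\mathbb{R}^N)$, $v\in H^s(\mathbb{R}^N)$ (with the respective inner product). Index sets: for $j\in\mathbb{Z}$, $\Gamma_j:=2^{-j}\mathbb{Z}^N$, $\Lambda_j:=\Gamma_{j+1}\setminus\Gamma_j$, and $\Lambda:=\big(\bigcup_{j\in\mathbb{Z}}\Gamma_j\big)\setminus\{(0,\dots,0)\}$. $\mathcal{M}:=\{0,1\}^N\setminus\{(0,\dots,0)\}$. Wavelets: for each $\varepsilon\in\mathcal{M}$ let $\psi^\varepsilon$ be a basic wavelet on $\mathbb{R}^N$, i.e. for some class $m\in\mathbb{N}_0$: $D^\alpha\psi^\varepsilon\in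 L_\infty$ and $D^\alpha\psi^\varepsilon$ decreases rapidly at infinity for $0\le|\alpha|\le m$, and $\int x^\alpha\psi^\varepsilon(x)\,dx=0$ for $0\le|\alpha|\le m$. For $\lambda\in\Lambda$ put $\psi_\lambda(x):=2^{Nj/2}\psi^\varepsilon(2^jx-k)$, where $j\in\mathbb{Z}$, $k\in\mathbb{Z}^N$, $\varepsilon\in\mathcal{M}$ are uniquely defined via $\lambda=2^{-j}k+2^{-j-1}\varepsilon$. Multiresolution analysis: a family $\{V_j\}_{j\in\mathbb{Z}}$ of closed linear subspaces of $L_2(\mathbb{R}^N)$ with (1) $V_j\subset V_{j+1}$ for all $j$, $\bigcap_jV_j=\{0\}$, $\overline{\bigcup_jV_j}=L_2(\mathbb{R}^N)$; (2) for all $u\in L_2(\mathbb{R}^N)$, $j\in\mathbb{Z}$, $k\in\mathbb{Z}^N$: $u(x)\in V_j\Leftrightarrow u(2x)\in V_{j+1}$ and $u(x)\in V_0\Leftrightarrow u(x-k)\in V_0$; (3) there is $\phi\in V_0$ (the scaling function) such that $\{\phi(x-k)\}_{k\in\mathbb{Z}^N}$ is an orthonormal basis of $V_0$. It is $r$-regular if for each $m\in\mathbb{N}$ there is $C_m>0$ such that $|D^\alpha\phi(x)|\le C_m(1+|x|)^{-m}$ for all $x\in\mathbb{R}^N$ and all $0\le|\alpha|\le r$. Correspondence: let $W_j$ be the orthogonal complement of $V_j$ in $V_{j+1}$, and for $\lambda=2^{-j}k\in\Gamma_j$ (with $j$ fixed) let $\phi_\lambda(x):=2^{Nj/2}\phi(2^jx-k)$.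 The family $\{\psi_\lambda\}_{\lambda\in\Lambda}$ corresponds to the $r$-regular multiresolution analysis $\{V_j\}$ if for every $j\in\mathbb{Z}$, $\{\psi_\lambda\}_{\lambda\in\Lambda_j}$ is an orthonormal basis of $W_j$ and $\{\phi_\lambda\}_{\lambda\in\Gamma_j}$ is an orthonormal basis of $V_j$. In particular $\{\psi_\lambda\}_{\lambda\in\Lambda}$ and $\{\phi_\lambda\}_{\lambda\in\Gamma_0}\cup\{\psi_\lambda\}_{j\ge0,\lambda\in\Lambda_j}$ are orthonormal bases of $L_2(\mathbb{R}^N)$. *)

theory Defs
  imports "HOL-Analysis.Analysis"
begin

section \<open>The space \<open>L\<^sub>2\<close>\<close>

text \<open>
  Elements of \<open>L\<^sub>2\<close> are represented by Borel functions; two functions that agree almost everywhere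
  represent the same element. Accordingly the zero subspace is the set of functions vanishing
  almost everywhere, and all closed subspaces are closed under almost-everywhere equality.
\<close>

definition L2 :: "(real^'n \<Rightarrow> complex) set" where
  "L2 = {u. u \<in> borel_measurable lborel \<and> integrable lborel (\<lambda>x. (cmod (u x))\<^sup>2)}"

definition l2_inner :: "(real^'n \<Rightarrow> complex) \<Rightarrow> (real^'n \<Rightarrow> complex) \<Rightarrow> complex" where
  "l2_inner u v = (\<integral>x. u x * cnj (v x) \<partial>lborel)"

definition l2_norm :: "(real^'n \<Rightarrow> complex) \<Rightarrow> real" where
  "l2_norm u = sqrt (\<integral>x. (cmod (u x))\<^sup>2 \<partial>lborel)"

definition l2_tendsto :: "('i \<Rightarrow> real^'n \<Rightarrow> complex) \<Rightarrow> (real^'n \<Rightarrow> complex) \<Rightarrow> 'i filter \<Rightarrow> bool" where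
  "l2_tendsto X u F \<longleftrightarrow> u \<in> L2 \<and> (\<forall>\<^sub>F i in F. X i \<in> L2) \<and>
     ((\<lambda>i. l2_norm (\<lambda>x. X i x - u x)) \<longlongrightarrow> 0) F"

text \<open>Unconditional convergence in \<open>L\<^sub>2\<close>, the analogue of \<^const>\<open>has_sum\<close>.\<close>

definition l2_has_sum ::
    "('i \<Rightarrow> real^'n \<Rightarrow> complex) \<Rightarrow> 'i set \<Rightarrow> (real^'n \<Rightarrow> complex) \<Rightarrow> bool" where
  "l2_has_sum f I u \<longleftrightarrow> l2_tendsto (\<lambda>F x. \<Sum>i\<in>F. f i x) u (finite_subsets_at_top I)"

definition closed_subspace :: "(real^'n \<Rightarrow> complex) set \<Rightarrow> bool" where
  "closed_subspace S \<longleftrightarrow> S \<subseteq> L2 \<and> (\<lambda>x. 0) \<in> S \<and>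
     (\<forall>u\<in>S. \<forall>v\<in>S. (\<lambda>x. u x + v x) \<in> S) \<and>
     (\<forall>c. \<forall>u\<in>S. (\<lambda>x. c * u x) \<in> S) \<and>
     (\<forall>X u. (\<forall>n. X n \<in> S) \<longrightarrow> l2_tendsto X u sequentially \<longrightarrow> u \<in> S)"

text \<open>An orthonormal family indexed by \<open>I\<close> whose closed linear span is \<open>S\<close>.\<close>

definition orthonormal_basis ::
    "('i \<Rightarrow> real^'n \<Rightarrow> complex) \<Rightarrow> 'i set \<Rightarrow> (real^'n \<Rightarrow> complex) set \<Rightarrow> bool" where
  "orthonormal_basis f I S \<longleftrightarrow> (\<forall>i\<in>I. f i \<in> S) \<and>
     (\<forall>i\<in>I. \<forall>k\<in>I. l2_inner (f i) (f k) = (if i = k then 1 else 0)) \<and>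
     (\<forall>u\<in>S. \<forall>e>0. \<exists>F c. finite F \<and> F \<subseteq> I \<and> l2_norm (\<lambda>x. u x - (\<Sum>i\<in>F. c i * f i x)) < e)"


section \<open>Sobolev spaces\<close>

definition fourier_L1 :: "(real^'n \<Rightarrow> complex) \<Rightarrow> real^'n \<Rightarrow> complex" where
  "fourier_L1 u \<xi> = (\<integral>x. exp (- 2 * of_real pi * \<i> * of_real (\<xi> \<bullet> x)) * u x \<partial>lborel)"

text \<open>
  The Fourier transform on \<open>L\<^sub>2\<close> is the continuous extension of the transform on \<open>L\<^sub>1 \<inter> L\<^sub>2\<close>. By
  Plancherel's theorem the function selected here exists and is unique up to null sets.
\<close>

definition fourier_L2 :: "(real^'n \<Rightarrow> complex) \<Rightarrow> real^'n \<Rightarrow> complex" where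
  "fourier_L2 u = (SOME v. \<exists>X. (\<forall>n. X n \<in> L2 \<and> integrable lborel (X n)) \<and>
     l2_tendsto X u sequentially \<and> l2_tendsto (\<lambda>n. fourier_L1 (X n)) v sequentially)"

definition sobolev :: "real \<Rightarrow> (real^'n \<Rightarrow> complex) set" where
  "sobolev s = {u \<in> L2.
     (\<lambda>\<xi>. of_real ((1 + 4 * pi\<^sup>2 * (norm \<xi>)\<^sup>2) powr (s / 2)) * fourier_L2 u \<xi>) \<in> L2}"

text \<open>
  \<open>w\<close> represents the value at \<open>u\<close> of the adjoint of the embedding of \<open>H\<^sup>s\<close>, equipped with the inner
  product \<open>ip\<close>, into \<open>L\<^sub>2\<close>.
\<close>

definition is_embedding_adjoint :: "real \<Rightarrow>
    ((real^'n \<Rightarrow> complex) \<Rightarrow> (real^'n \<Rightarrow> complex) \<Rightarrow> complex) \<Rightarrow>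
    (real^'n \<Rightarrow> complex) \<Rightarrow> (real^'n \<Rightarrow> complex) \<Rightarrow> bool" where
  "is_embedding_adjoint s ip u w \<longleftrightarrow> w \<in> sobolev s \<and> (\<forall>v\<in>sobolev s. ip w v = l2_inner u v)"


section \<open>Weak derivatives\<close>

text \<open>Partial derivatives at points where the function is not differentiable are unspecified.\<close>

definition partial :: "'n::finite \<Rightarrow> (real^'n \<Rightarrow> complex) \<Rightarrow> real^'n \<Rightarrow> complex" where
  "partial i f x = frechet_derivative f (at x) (axis i 1)"

definition smooth :: "(real^'n \<Rightarrow> complex) \<Rightarrow> bool" where
  "smooth f \<longleftrightarrow> (\<forall>is x. foldr partial is f differentiable (at x))"

definition test_function :: "(real^'n \<Rightarrow> complex) \<Rightarrow> bool" where
  "test_function \<eta> \<longleftrightarrow> smooth \<eta> \<and> compact (closure {x. \<eta> x \<noteq> 0})"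

definition mi_order :: "('n::finite \<Rightarrow> nat) \<Rightarrow> nat" where
  "mi_order \<alpha> = (\<Sum>i\<in>UNIV. \<alpha> i)"

text \<open>
  \<open>D\<^sup>\<alpha>\<close> for smooth functions: the partial derivatives are taken in some arbitrary order, which is
  irrelevant by the symmetry of mixed derivatives.
\<close>

definition mi_deriv :: "('n::finite \<Rightarrow> nat) \<Rightarrow> (real^'n \<Rightarrow> complex) \<Rightarrow> real^'n \<Rightarrow> complex" where
  "mi_deriv \<alpha> f = foldr partial (SOME is. \<forall>i. count_list is i = \<alpha> i) f"

definition locally_integrable :: "(real^'n \<Rightarrow> complex) \<Rightarrow> bool" where
  "locally_integrable f \<longleftrightarrow> f \<in> borel_measurable lborel \<and> (\<forall>K. compact K \<longrightarrow> set_integrable lborel K f)"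

text \<open>\<open>g\<close> represents the distributional derivative \<open>D\<^sup>\<alpha>f\<close>.\<close>

definition weak_deriv ::
    "('n::finite \<Rightarrow> nat) \<Rightarrow> (real^'n \<Rightarrow> complex) \<Rightarrow> (real^'n \<Rightarrow> complex) \<Rightarrow> bool" where
  "weak_deriv \<alpha> f g \<longleftrightarrow> locally_integrable f \<and> locally_integrable g \<and>
     (\<forall>\<eta>. test_function \<eta> \<longrightarrow>
        (\<integral>x. f x * mi_deriv \<alpha> \<eta> x \<partial>lborel) = (- 1) ^ mi_order \<alpha> * (\<integral>x. g x * \<eta> x \<partial>lborel))"


section \<open>Index sets and wavelets\<close>

definition int_vectors :: "(real^'n) set" where
  "int_vectors = {k. \<forall>i. k $ i \<in> \<int>}"

definition Gamma :: "int \<Rightarrow> (real^'n) set" where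
  "Gamma j = (\<lambda>k. 2 powi (- j) *\<^sub>R k) ` int_vectors"

definition Lambda :: "int \<Rightarrow> (real^'n) set" where
  "Lambda j = Gamma (j + 1) - Gamma j"

definition wavelet_types :: "(real^'n) set" where
  "wavelet_types = {\<epsilon>. \<forall>i. \<epsilon> $ i \<in> {0, 1}} - {0}"

definition basic_wavelet :: "nat \<Rightarrow> (real^'n \<Rightarrow> complex) \<Rightarrow> bool" where
  "basic_wavelet m \<psi> \<longleftrightarrow>
     (\<forall>\<alpha>. mi_order \<alpha> \<le> m \<longrightarrow>
        (\<exists>g. weak_deriv \<alpha> \<psi> g \<and> (\<exists>C. AE x in lborel. cmod (g x) \<le> C) \<and>
           (\<forall>p::nat. ((\<lambda>x. norm x ^ p * cmod (g x)) \<longlongrightarrow> 0) at_infinity))) \<and>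
     (\<forall>\<alpha>. mi_order \<alpha> \<le> m \<longrightarrow> (\<integral>x. of_real (\<Prod>i\<in>UNIV. (x $ i) ^ \<alpha> i) * \<psi> x \<partial>lborel) = 0)"

definition wavelet_index :: "real^'n \<Rightarrow> int \<times> (real^'n) \<times> (real^'n)" where
  "wavelet_index \<mu> = (THE (j, k, \<epsilon>). k \<in> int_vectors \<and> \<epsilon> \<in> wavelet_types \<and>
     \<mu> = 2 powi (- j) *\<^sub>R k + 2 powi (- j - 1) *\<^sub>R \<epsilon>)"

text \<open>The family \<open>(\<psi>\<^sub>\<mu>)\<close>, meaningful for nonzero dyadic \<open>\<mu>\<close>, where the index is unique.\<close>

definition wavelet ::
    "(real^'n \<Rightarrow> real^'n \<Rightarrow> complex) \<Rightarrow> real^'n \<Rightarrow> real^'n \<Rightarrow> complex" where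
  "wavelet \<psi> \<mu> x = (case wavelet_index \<mu> of (j, k, \<epsilon>) \<Rightarrow>
     of_real (2 powr (real CARD('n) * of_int j / 2)) * \<psi> \<epsilon> (2 powi j *\<^sub>R x - k))"

text \<open>\<open>\<phi>\<^sub>\<mu>\<close> for \<open>\<mu>\<close> regarded as a point \<open>2\<^sup>-\<^sup>jk\<close> of \<^term>\<open>Gamma j\<close>, so that \<open>k = 2\<^sup>j\<mu>\<close>.\<close>

definition scaling :: "(real^'n \<Rightarrow> complex) \<Rightarrow> int \<Rightarrow> real^'n \<Rightarrow> real^'n \<Rightarrow> complex" where
  "scaling \<phi> j \<mu> x =
     of_real (2 powr (real CARD('n) * of_int j / 2)) * \<phi> (2 powi j *\<^sub>R x - 2 powi j *\<^sub>R \<mu>)"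


section \<open>Multiresolution analyses\<close>

definition mra :: "(int \<Rightarrow> (real^'n \<Rightarrow> complex) set) \<Rightarrow> (real^'n \<Rightarrow> complex) \<Rightarrow> bool" where
  "mra V \<phi> \<longleftrightarrow> (\<forall>j. closed_subspace (V j)) \<and>
     (\<forall>j. V j \<subseteq> V (j + 1)) \<and>
     (\<Inter>j. V j) = {u \<in> L2. AE x in lborel. u x = 0} \<and>
     (\<forall>u\<in>L2. \<forall>e>0. \<exists>v\<in>(\<Union>j. V j). l2_norm (\<lambda>x. u x - v x) < e) \<and>
     (\<forall>u\<in>L2. \<forall>j. u \<in> V j \<longleftrightarrow> (\<lambda>x. u (2 *\<^sub>R x)) \<in> V (j + 1)) \<and>
     (\<forall>u\<in>L2. \<forall>k\<in>int_vectors. u \<in> V 0 \<longleftrightarrow> (\<lambda>x. u (x - k)) \<in> V 0) \<and>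
     \<phi> \<in> V 0 \<and> orthonormal_basis (\<lambda>k x. \<phi> (x - k)) int_vectors (V 0)"

text \<open>
  The derivatives are distributional and the pointwise bounds are required of suitable representatives.
\<close>

definition regular :: "nat \<Rightarrow> (real^'n \<Rightarrow> complex) \<Rightarrow> bool" where
  "regular r \<phi> \<longleftrightarrow> (\<forall>m::nat. \<exists>C>0. \<forall>\<alpha>. mi_order \<alpha> \<le> r \<longrightarrow>
     (\<exists>g. weak_deriv \<alpha> \<phi> g \<and> (\<forall>x. cmod (g x) \<le> C * (1 + norm x) powr (- real m))))"

definition detail_space :: "(int \<Rightarrow> (real^'n \<Rightarrow> complex) set) \<Rightarrow> int \<Rightarrow> (real^'n \<Rightarrow> complex) set" where
  "detail_space V j = {w \<in> V (j + 1). \<forall>v\<in>V j. l2_inner w v = 0}"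

definition corresponds :: "(real^'n \<Rightarrow> real^'n \<Rightarrow> complex) \<Rightarrow>
    (int \<Rightarrow> (real^'n \<Rightarrow> complex) set) \<Rightarrow> (real^'n \<Rightarrow> complex) \<Rightarrow> bool" where
  "corresponds \<psi> V \<phi> \<longleftrightarrow> (\<forall>j.
     orthonormal_basis (wavelet \<psi>) (Lambda j) (detail_space V j) \<and>
     orthonormal_basis (scaling \<phi> j) (Gamma j) (V j))"


section \<open>Wavelet norms and inner products\<close>

text \<open>
  The iterated sums over \<open>j\<close> and \<open>\<mu> \<in> \<Lambda>\<^sub>j\<close> are unconditional sums over pairs. On \<open>H\<^sup>s\<close> they converge
  absolutely when \<open>0 \<le> s < r\<close> and the wavelets correspond to an \<open>r\<close>-regular multiresolution analysis,
  since the norms below are then equivalent to the Fourier norm.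
\<close>

definition coarse_index :: "(int \<times> (real^'n)) set" where
  "coarse_index = (SIGMA j:{..<0}. Lambda j)"

definition fine_index :: "(int \<times> (real^'n)) set" where
  "fine_index = (SIGMA j:{0..}. Lambda j)"

definition wavelet_norm ::
    "real \<Rightarrow> (real^'n \<Rightarrow> real^'n \<Rightarrow> complex) \<Rightarrow> (real^'n \<Rightarrow> complex) \<Rightarrow> real" where
  "wavelet_norm s \<psi> u = sqrt (
     (\<Sum>\<^sub>\<infinity>(j, \<mu>)\<in>coarse_index. (cmod (l2_inner u (wavelet \<psi> \<mu>)))\<^sup>2) +
     (\<Sum>\<^sub>\<infinity>(j, \<mu>)\<in>fine_index. 2 powr (2 * of_int j * s) * (cmod (l2_inner u (wavelet \<psi> \<mu>)))\<^sup>2))"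

definition wavelet_inner :: "real \<Rightarrow> (real^'n \<Rightarrow> real^'n \<Rightarrow> complex) \<Rightarrow>
    (real^'n \<Rightarrow> complex) \<Rightarrow> (real^'n \<Rightarrow> complex) \<Rightarrow> complex" where
  "wavelet_inner s \<psi> u v =
     (\<Sum>\<^sub>\<infinity>(j, \<mu>)\<in>coarse_index. l2_inner u (wavelet \<psi> \<mu>) * cnj (l2_inner v (wavelet \<psi> \<mu>))) +
     (\<Sum>\<^sub>\<infinity>(j, \<mu>)\<in>fine_index. of_real (2 powr (2 * of_int j * s)) *
        l2_inner u (wavelet \<psi> \<mu>) * cnj (l2_inner v (wavelet \<psi> \<mu>)))"

definition scaling_wavelet_norm :: "real \<Rightarrow> (real^'n \<Rightarrow> complex) \<Rightarrow>
    (real^'n \<Rightarrow> real^'n \<Rightarrow> complex) \<Rightarrow> (real^'n \<Rightarrow> complex) \<Rightarrow> real" where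
  "scaling_wavelet_norm s \<phi> \<psi> u = sqrt (
     (\<Sum>\<^sub>\<infinity>\<mu>\<in>Gamma 0. (cmod (l2_inner u (scaling \<phi> 0 \<mu>)))\<^sup>2) +
     (\<Sum>\<^sub>\<infinity>(j, \<mu>)\<in>fine_index. 2 powr (2 * of_int j * s) * (cmod (l2_inner u (wavelet \<psi> \<mu>)))\<^sup>2))"

definition scaling_wavelet_inner :: "real \<Rightarrow> (real^'n \<Rightarrow> complex) \<Rightarrow>
    (real^'n \<Rightarrow> real^'n \<Rightarrow> complex) \<Rightarrow>
    (real^'n \<Rightarrow> complex) \<Rightarrow> (real^'n \<Rightarrow> complex) \<Rightarrow> complex" where
  "scaling_wavelet_inner s \<phi> \<psi> u v =
     (\<Sum>\<^sub>\<infinity>\<mu>\<in>Gamma 0. l2_inner u (scaling \<phi> 0 \<mu>) * cnj (l2_inner v (scaling \<phi> 0 \<mu>))) +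
     (\<Sum>\<^sub>\<infinity>(j, \<mu>)\<in>fine_index. of_real (2 powr (2 * of_int j * s)) *
        l2_inner u (wavelet \<psi> \<mu>) * cnj (l2_inner v (wavelet \<psi> \<mu>)))"

lemma infsum_complex_of_real:
  "(\<Sum>\<^sub>\<infinity>x\<in>A. complex_of_real (f x)) = complex_of_real (\<Sum>\<^sub>\<infinity>x\<in>A. f x)"
proof (cases "f summable_on A")
  case True
  then show ?thesis
    by (intro infsumI has_sum_of_real has_sum_infsum)
next
  case False
  then have "\<not> (\<lambda>x. complex_of_real (f x)) summable_on A"
    using summable_on_Re[of "\<lambda>x. complex_of_real (f x)" A] by auto
  with False show ?thesis
    by (simp add: infsum_not_exists)
qed

lemma wavelet_inner_self: "wavelet_inner s \<psi> u u = of_real ((wavelet_norm s \<psi> u)\<^sup>2)"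
  unfolding wavelet_inner_def wavelet_norm_def
  by (subst real_sqrt_pow2)
     (auto simp: mult.assoc complex_norm_square[symmetric] case_prod_unfold
        infsum_complex_of_real[symmetric] simp del: of_real_power
        intro!: add_nonneg_nonneg infsum_nonneg)

lemma scaling_wavelet_inner_self:
  "scaling_wavelet_inner s \<phi> \<psi> u u = of_real ((scaling_wavelet_norm s \<phi> \<psi> u)\<^sup>2)"
  unfolding scaling_wavelet_inner_def scaling_wavelet_norm_def
  by (subst real_sqrt_pow2)
     (auto simp: mult.assoc complex_norm_square[symmetric] case_prod_unfold
        infsum_complex_of_real[symmetric] simp del: of_real_power
        intro!: add_nonneg_nonneg infsum_nonneg)

end

theory Submission
  imports Defs "HOL-Probability.Characteristic_Functions" "HOL-Probability.Sinc_Integral"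
begin

text \<open>
  Let \<open>w\<close> be the sum of the asserted series. Its coefficients with respect to the wavelet basis are
  those of \<open>u\<close> divided by the weights of the inner product of \<open>H\<^sup>s\<close>. Hence the weights cancel in
  \<open>\<langle>w, v\<rangle>\<close>, and Parseval's identity yields \<open>\<langle>w, v\<rangle>\<^bsub>H\<^sup>s\<^esub> = \<langle>u, v\<rangle>\<^bsub>L\<^sub>2\<^esub>\<close> for every \<open>v\<close> in \<open>L\<^sub>2\<close>. Conversely, testing
  the defining equation of the adjoint with the basis functions determines all coefficients of the
  adjoint, so it agrees with \<open>w\<close> almost everywhere. This argument is \<open>embedding_adjoint_expansion\<close>. It
  never uses that the wavelet norm of \<open>v\<close> is finite, so the equivalence of the wavelet norms with the
  Fourier norm is not needed. Two facts remain: both systems are complete orthonormal systems of \<open>L\<^sub>2\<close>,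
  and the basis functions and \<open>w\<close> belong to \<open>H\<^sup>s\<close>.

  Completeness comes from the axioms of a multiresolution analysis. A function orthogonal to \<open>V\<^sub>0\<close> and
  to all \<open>W\<^sub>j\<close> with \<open>j \<ge> 0\<close> is orthogonal to every \<open>V\<^sub>j\<close>, hence zero. If it is merely orthogonal to all
  \<open>W\<^sub>j\<close>, then its projection to \<open>V\<^sub>0\<close> lies in every \<open>V\<^sub>j\<close>, hence vanishes.

  Membership in \<open>H\<^sup>s\<close> follows from Bernstein's inequality \<open>\<parallel>g\<parallel>\<^bsub>H\<^sup>s\<^esub> \<le> C 2\<^sup>j\<^sup>s \<parallel>g\<parallel>\<^bsub>L\<^sub>2\<^esub>\<close> for \<open>g\<close> in \<open>V\<^sub>j\<close> and
  \<open>j \<ge> 0\<close>: the basis functions lie in such spaces, and \<open>w\<close> is the sum of an element of \<open>V\<^sub>0\<close> and of terms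
  \<open>2\<^sup>-\<^sup>2\<^sup>j\<^sup>s g\<^sub>j\<close> with \<open>g\<^sub>j\<close> in \<open>V\<^bsub>j+1\<^esub>\<close> and \<open>\<parallel>g\<^sub>j\<parallel> \<le> \<parallel>u\<parallel>\<close>, whose \<open>H\<^sup>s\<close> norms are dominated by a geometric series if
  \<open>s > 0\<close>. For \<open>s = 0\<close> the partial sums themselves are bounded.

  Bernstein's inequality is reduced by dilation to \<open>V\<^sub>0\<close>. For a finite combination \<open>Y\<close> of integer translates
  of \<open>\<phi>\<close>, the function \<open>(2\<pi>i\<xi>\<^sub>j)\<^sup>r\<close> times the Fourier transform of \<open>Y\<close> is the Fourier transform of the same
  combination of translates of \<open>\<partial>\<^sub>j\<^sup>r\<phi>\<close> (\<open>fourier_weak_deriv\<close>). As \<open>\<partial>\<^sub>j\<^sup>r\<phi>\<close> decreases rapidly, Schur's test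
  bounds the norm of that combination by the \<open>\<ell>\<^sub>2\<close> norm of the coefficients, which is \<open>\<parallel>Y\<parallel>\<close> by
  orthonormality. Of Plancherel's theorem only the inequality \<open>fourier_L1_L2\<close> is needed.
\<close>

section \<open>Square-integrable functions\<close>

abbreviation l2_dist :: "(real^'n \<Rightarrow> complex) \<Rightarrow> (real^'n \<Rightarrow> complex) \<Rightarrow> real" where
  "l2_dist u v \<equiv> l2_norm (\<lambda>x. u x - v x)"

lemma L2_measurable: "u \<in> L2 \<Longrightarrow> u \<in> borel_measurable borel"
  by (simp add: L2_def)

lemma L2_integrable_square: "u \<in> L2 \<Longrightarrow> integrable lborel (\<lambda>x. (cmod (u x))\<^sup>2)"
  by (simp add: L2_def)

lemma borel_measurable_cnj [measurable (raw)]: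
  "f \<in> borel_measurable M \<Longrightarrow> (\<lambda>x. cnj (f x)) \<in> borel_measurable M"
  by (rule measurable_compose[where g = cnj and N = borel, OF _ borel_measurable_continuous_onI])
     (auto intro: continuous_intros)

lemma L2_zero: "(\<lambda>x. 0) \<in> L2"
  by (simp add: L2_def)

lemma L2_mult_left: "u \<in> L2 \<Longrightarrow> (\<lambda>x. c * u x) \<in> L2"
  by (auto simp: L2_def norm_mult power_mult_distrib)

lemma cmod_add_square_le: "(cmod (a + b))\<^sup>2 \<le> 2 * (cmod a)\<^sup>2 + 2 * (cmod b)\<^sup>2"
proof -
  have "(cmod (a + b))\<^sup>2 \<le> (cmod a + cmod b)\<^sup>2"
    by (simp add: norm_triangle_ineq power_mono)
  also have "\<dots> \<le> 2 * (cmod a)\<^sup>2 + 2 * (cmod b)\<^sup>2"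
    using sum_squares_bound[of "cmod a" "cmod b"] by (simp add: power2_sum)
  finally show ?thesis .
qed

lemma L2_add:
  assumes "u \<in> L2" "v \<in> L2" shows "(\<lambda>x. u x + v x) \<in> L2"
proof -
  note [measurable] = assms[THEN L2_measurable]
  have "integrable lborel (\<lambda>x. (cmod (u x + v x))\<^sup>2)"
  proof (rule Bochner_Integration.integrable_bound)
    show "integrable lborel (\<lambda>x. 2 * (cmod (u x))\<^sup>2 + 2 * (cmod (v x))\<^sup>2)"
      using assms by (auto simp: L2_def)
    show "AE x in lborel. norm ((cmod (u x + v x))\<^sup>2) \<le> norm (2 * (cmod (u x))\<^sup>2 + 2 * (cmod (v x))\<^sup>2)"
      using cmod_add_square_le by auto
  qed simp
  then show ?thesis by (simp add: L2_def)
qed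

lemma L2_diff: "u \<in> L2 \<Longrightarrow> v \<in> L2 \<Longrightarrow> (\<lambda>x. u x - v x) \<in> L2"
  using L2_add[of u "\<lambda>x. - 1 * v x"] L2_mult_left[of v "- 1"] by simp

lemma L2_sum: "(\<And>i. i \<in> F \<Longrightarrow> f i \<in> L2) \<Longrightarrow> (\<lambda>x. \<Sum>i\<in>F. f i x) \<in> L2"
  by (induction F rule: infinite_finite_induct) (auto simp: L2_zero L2_add)

lemma L2_inner_integrable:
  assumes "u \<in> L2" "v \<in> L2" shows "integrable lborel (\<lambda>x. u x * cnj (v x))"
proof (rule Bochner_Integration.integrable_bound)
  note [measurable] = assms[THEN L2_measurable]
  show "integrable lborel (\<lambda>x. (cmod (u x))\<^sup>2 + (cmod (v x))\<^sup>2)"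
    using assms by (auto simp: L2_def)
  show "(\<lambda>x. u x * cnj (v x)) \<in> borel_measurable lborel" by measurable
  show "AE x in lborel. norm (u x * cnj (v x)) \<le> norm ((cmod (u x))\<^sup>2 + (cmod (v x))\<^sup>2)"
  proof (rule AE_I2)
    fix x
    have "0 \<le> cmod (u x) * cmod (v x)" by simp
    then show "norm (u x * cnj (v x)) \<le> norm ((cmod (u x))\<^sup>2 + (cmod (v x))\<^sup>2)"
      using sum_squares_bound[of "cmod (u x)" "cmod (v x)"]
      unfolding norm_mult complex_mod_cnj real_norm_def by linarith
  qed
qed

lemma l2_inner_add_left:
  "u \<in> L2 \<Longrightarrow> v \<in> L2 \<Longrightarrow> w \<in> L2 \<Longrightarrow>
   l2_inner (\<lambda>x. u x + v x) w = l2_inner u w + l2_inner v w"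
  unfolding l2_inner_def using L2_inner_integrable[of u w] L2_inner_integrable[of v w]
  by (simp add: distrib_right)

lemma l2_inner_mult_left: "l2_inner (\<lambda>x. c * u x) w = c * l2_inner u w"
  unfolding l2_inner_def by (simp add: mult.assoc)

lemma l2_inner_commute: "l2_inner u v = cnj (l2_inner v u)"
  unfolding l2_inner_def
  by (subst Bochner_Integration.integral_cnj[symmetric]) (simp add: mult.commute)

lemma l2_inner_diff_left:
  "u \<in> L2 \<Longrightarrow> v \<in> L2 \<Longrightarrow> w \<in> L2 \<Longrightarrow>
   l2_inner (\<lambda>x. u x - v x) w = l2_inner u w - l2_inner v w"
  unfolding l2_inner_def using L2_inner_integrable[of u w] L2_inner_integrable[of v w]
  by (simp add: left_diff_distrib)

lemma l2_inner_add_right: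
  "u \<in> L2 \<Longrightarrow> v \<in> L2 \<Longrightarrow> w \<in> L2 \<Longrightarrow>
   l2_inner w (\<lambda>x. u x + v x) = l2_inner w u + l2_inner w v"
  by (subst (1 2 3) l2_inner_commute) (simp add: l2_inner_add_left)

lemma l2_inner_diff_right:
  "u \<in> L2 \<Longrightarrow> v \<in> L2 \<Longrightarrow> w \<in> L2 \<Longrightarrow>
   l2_inner w (\<lambda>x. u x - v x) = l2_inner w u - l2_inner w v"
  by (subst (1 2 3) l2_inner_commute) (simp add: l2_inner_diff_left)

lemma l2_inner_mult_right: "l2_inner w (\<lambda>x. c * u x) = cnj c * l2_inner w u"
  by (subst (1 2) l2_inner_commute) (simp add: l2_inner_mult_left)

lemma l2_inner_zero [simp]: "l2_inner (\<lambda>x. 0) v = 0" "l2_inner v (\<lambda>x. 0) = 0"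
  by (simp_all add: l2_inner_def)

lemma l2_inner_sum_left:
  assumes "\<And>i. i \<in> F \<Longrightarrow> f i \<in> L2" "v \<in> L2"
  shows "l2_inner (\<lambda>x. \<Sum>i\<in>F. f i x) v = (\<Sum>i\<in>F. l2_inner (f i) v)"
  using assms(1)
proof (induction F rule: infinite_finite_induct)
  case (insert i F)
  then show ?case
    using l2_inner_add_left[of "f i" "\<lambda>x. \<Sum>i\<in>F. f i x" v] assms(2) by (simp add: L2_sum)
qed simp_all

lemma l2_inner_sum_right:
  assumes "\<And>i. i \<in> F \<Longrightarrow> f i \<in> L2" "v \<in> L2"
  shows "l2_inner v (\<lambda>x. \<Sum>i\<in>F. f i x) = (\<Sum>i\<in>F. l2_inner v (f i))"
  by (simp add: l2_inner_commute[of v] l2_inner_sum_left[OF assms])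

lemma l2_norm_nonneg [simp]: "0 \<le> l2_norm u"
  by (simp add: l2_norm_def)

lemma l2_norm_square: "(l2_norm u)\<^sup>2 = (\<integral>x. (cmod (u x))\<^sup>2 \<partial>lborel)"
  by (simp add: l2_norm_def)

lemma l2_inner_self: "l2_inner u u = of_real ((l2_norm u)\<^sup>2)"
  unfolding l2_norm_square l2_inner_def
  by (subst integral_complex_of_real[symmetric]) (simp add: complex_norm_square[symmetric])

lemma l2_norm_mult: "l2_norm (\<lambda>x. c * u x) = cmod c * l2_norm u"
  by (simp add: l2_norm_def norm_mult power_mult_distrib real_sqrt_mult)

lemma l2_norm_minus_commute: "l2_dist u v = l2_dist v u"
  by (simp add: l2_norm_def norm_minus_commute)

lemma l2_norm_zero [simp]: "l2_norm (\<lambda>x. 0) = 0"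
  by (simp add: l2_norm_def)

lemma l2_norm_cong_AE:
  assumes "u \<in> borel_measurable borel" "v \<in> borel_measurable borel" "AE x in lborel. u x = v x"
  shows "l2_norm u = l2_norm v"
proof -
  note [measurable] = assms(1,2)
  have "(\<integral>x. (cmod (u x))\<^sup>2 \<partial>lborel) = (\<integral>x. (cmod (v x))\<^sup>2 \<partial>lborel)"
    using assms(3) by (intro integral_cong_AE) auto
  then show ?thesis by (simp add: l2_norm_def)
qed

lemma l2_norm_eq_0_iff: "u \<in> L2 \<Longrightarrow> l2_norm u = 0 \<longleftrightarrow> (AE x in lborel. u x = 0)"
  using integral_nonneg_eq_0_iff_AE[OF L2_integrable_square, of u]
  by (simp add: l2_norm_def)

lemma l2_norm_add_square:
  assumes "u \<in> L2" "v \<in> L2"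
  shows "(l2_norm (\<lambda>x. u x + v x))\<^sup>2 = (l2_norm u)\<^sup>2 + (l2_norm v)\<^sup>2 + 2 * Re (l2_inner u v)"
proof -
  have "complex_of_real ((l2_norm (\<lambda>x. u x + v x))\<^sup>2) =
    of_real ((l2_norm u)\<^sup>2) + of_real ((l2_norm v)\<^sup>2) + (l2_inner u v + cnj (l2_inner u v))"
    using assms l2_inner_commute[of v u]
    by (simp only: l2_inner_self[symmetric] l2_inner_add_left l2_inner_add_right L2_add) simp
  also have "\<dots> = of_real ((l2_norm u)\<^sup>2 + (l2_norm v)\<^sup>2 + 2 * Re (l2_inner u v))"
    by (simp add: complex_add_cnj)
  finally show ?thesis by (simp only: of_real_eq_iff)
qed

lemma l2_Cauchy_Schwarz:
  assumes "u \<in> L2" "v \<in> L2"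
  shows "cmod (l2_inner u v) \<le> l2_norm u * l2_norm v"
proof -
  let ?a = "(l2_norm u)\<^sup>2" and ?b = "(l2_norm v)\<^sup>2" and ?c = "l2_inner u v"
  \<comment> \<open>The right-hand side is \<open>\<parallel>u - t c v\<parallel>\<^sup>2\<close>, where \<open>c\<close> is the inner product of \<open>u\<close> and \<open>v\<close>.\<close>
  have quadratic: "0 \<le> ?a + t\<^sup>2 * (cmod ?c)\<^sup>2 * ?b - 2 * t * (cmod ?c)\<^sup>2" for t :: real
  proof -
    define d where "d = - of_real t * ?c"
    have "0 \<le> (l2_norm (\<lambda>x. u x + d * v x))\<^sup>2" by simp
    also have "\<dots> = ?a + (cmod d * l2_norm v)\<^sup>2 + 2 * Re (cnj d * ?c)"
      using assms by (subst l2_norm_add_square) (auto simp: L2_mult_left l2_norm_mult l2_inner_mult_right)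
    also have "cnj d * ?c = of_real (- t * (cmod ?c)\<^sup>2)"
      by (simp add: d_def complex_norm_square[symmetric] mult.commute[of _ ?c] del: of_real_power)
    finally show ?thesis by (simp add: d_def norm_mult power_mult_distrib)
  qed
  have "(cmod ?c)\<^sup>2 \<le> ?a * ?b"
  proof (cases "?b = 0")
    case False
    then have "0 < ?b" by (simp add: less_le)
    have "0 \<le> ?a + (1/?b)\<^sup>2 * (cmod ?c)\<^sup>2 * ?b - 2 * (1/?b) * (cmod ?c)\<^sup>2" by (rule quadratic)
    also have "\<dots> = ?a - (cmod ?c)\<^sup>2 / ?b" using False by (simp add: power2_eq_square field_simps)
    finally show ?thesis using \<open>0 < ?b\<close> by (simp add: field_simps)
  next
    case True
    have "(cmod ?c)\<^sup>2 \<le> 0"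
    proof (rule ccontr)
      assume "\<not> (cmod ?c)\<^sup>2 \<le> 0"
      moreover have "0 \<le> ?a - 2 * ((?a + 1) / (2 * (cmod ?c)\<^sup>2)) * (cmod ?c)\<^sup>2"
        using quadratic[of "(?a + 1) / (2 * (cmod ?c)\<^sup>2)"] True by simp
      ultimately show False by (simp add: field_simps)
    qed
    with True show ?thesis by simp
  qed
  then have "(cmod ?c)\<^sup>2 \<le> (l2_norm u * l2_norm v)\<^sup>2" by (simp add: power_mult_distrib)
  then show ?thesis by (simp add: abs_le_square_iff[symmetric])
qed

lemma l2_norm_triangle:
  assumes "u \<in> L2" "v \<in> L2"
  shows "l2_norm (\<lambda>x. u x + v x) \<le> l2_norm u + l2_norm v"
proof -
  have "Re (l2_inner u v) \<le> l2_norm u * l2_norm v"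
    using l2_Cauchy_Schwarz[OF assms] complex_Re_le_cmod order_trans by blast
  then have "(l2_norm (\<lambda>x. u x + v x))\<^sup>2 \<le> (l2_norm u + l2_norm v)\<^sup>2"
    by (simp add: l2_norm_add_square[OF assms] power2_sum)
  then show ?thesis by (simp add: abs_le_square_iff[symmetric])
qed

lemma l2_norm_triangle3:
  assumes "u \<in> L2" "v \<in> L2" "w \<in> L2"
  shows "l2_dist u w \<le> l2_dist u v + l2_dist v w"
  using l2_norm_triangle[of "\<lambda>x. u x - v x" "\<lambda>x. v x - w x"] assms by (simp add: L2_diff)

lemma l2_norm_le_add_diff:
  assumes "u \<in> L2" "v \<in> L2"
  shows "l2_norm u \<le> l2_norm v + l2_dist u v"
  using l2_norm_triangle[of v "\<lambda>x. u x - v x"] assms by (simp add: L2_diff)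

lemma l2_norm_nn_integral:
  assumes "u \<in> L2"
  shows "(\<integral>\<^sup>+x. ennreal ((cmod (u x))\<^sup>2) \<partial>lborel) = ennreal ((l2_norm u)\<^sup>2)"
  using assms by (simp add: L2_integrable_square nn_integral_eq_integral l2_norm_square)

lemma L2_nn_integralI:
  assumes "u \<in> borel_measurable borel" "0 \<le> M"
    and "(\<integral>\<^sup>+x. ennreal ((cmod (u x))\<^sup>2) \<partial>lborel) \<le> ennreal (M\<^sup>2)"
  shows "u \<in> L2" and "l2_norm u \<le> M"
proof -
  note [measurable] = assms(1)
  have "integrable lborel (\<lambda>x. (cmod (u x))\<^sup>2)"
  proof (rule integrableI_bounded)
    show "(\<integral>\<^sup>+x. ennreal (norm ((cmod (u x))\<^sup>2)) \<partial>lborel) < \<infinity>"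
      using assms(3) by (simp add: le_less_trans)
  qed simp
  with assms show "u \<in> L2" by (simp add: L2_def)
  with assms have "(l2_norm u)\<^sup>2 \<le> M\<^sup>2" by (simp add: l2_norm_nn_integral)
  then show "l2_norm u \<le> M" using assms(2) by (simp add: abs_le_square_iff[symmetric])
qed

text \<open>
  Fatou's lemma for sequences that are bounded in \<open>L\<^sub>2\<close>.
\<close>

lemma L2_Fatou:
  assumes X: "\<And>n. X n \<in> L2" "\<And>n::nat. l2_norm (X n) \<le> M"
    and u: "u \<in> borel_measurable borel" "AE x in lborel. (\<lambda>n. X n x) \<longlonglongrightarrow> u x"
  shows "u \<in> L2" and "l2_norm u \<le> M"
proof -
  note [measurable] = X(1)[THEN L2_measurable] u(1)
  have "0 \<le> M" using X(2)[of 0] l2_norm_nonneg[of "X 0"] by linarith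
  have "(\<integral>\<^sup>+x. ennreal ((cmod (u x))\<^sup>2) \<partial>lborel)
      = (\<integral>\<^sup>+x. liminf (\<lambda>n. ennreal ((cmod (X n x))\<^sup>2)) \<partial>lborel)"
  proof (rule nn_integral_cong_AE)
    show "AE x in lborel. ennreal ((cmod (u x))\<^sup>2) = liminf (\<lambda>n. ennreal ((cmod (X n x))\<^sup>2))"
      using u(2)
    proof eventually_elim
      case (elim x)
      then have "(\<lambda>n. ennreal ((cmod (X n x))\<^sup>2)) \<longlonglongrightarrow> ennreal ((cmod (u x))\<^sup>2)"
        by (intro tendsto_intros)
      then show ?case by (simp add: lim_imp_Liminf[symmetric])
    qed
  qed
  also have "\<dots> \<le> liminf (\<lambda>n. \<integral>\<^sup>+x. ennreal ((cmod (X n x))\<^sup>2) \<partial>lborel)"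
    by (rule nn_integral_liminf) simp
  also have "\<dots> = liminf (\<lambda>n. ennreal ((l2_norm (X n))\<^sup>2))"
    by (simp add: l2_norm_nn_integral X(1))
  also have "\<dots> \<le> liminf (\<lambda>n::nat. ennreal (M\<^sup>2))"
    by (intro Liminf_mono always_eventually allI ennreal_leI power_mono X l2_norm_nonneg)
  also have "\<dots> = ennreal (M\<^sup>2)" by (simp add: Liminf_const)
  finally show "u \<in> L2" and "l2_norm u \<le> M"
    using u(1) \<open>0 \<le> M\<close> L2_nn_integralI[of u M] by auto
qed

text \<open>
  Applied below to the differences along a rapidly convergent subsequence. The sum of the functions
  \<open>2\<^sup>n |X\<^sub>n|\<^sup>2\<close> is integrable, so that \<open>X\<^sub>n(x) = O(2\<^sup>-\<^sup>n\<^sup>/\<^sup>2)\<close> for almost every \<open>x\<close>.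
\<close>

lemma L2_AE_summable:
  assumes X: "\<And>n. X n \<in> L2" "\<And>n. l2_norm (X n) \<le> (1/2)^n"
  shows "AE x in lborel. summable (\<lambda>n. cmod (X n x))"
proof -
  note [measurable] = X(1)[THEN L2_measurable]
  let ?g = "\<lambda>n x. ennreal (2^n * (cmod (X n x))\<^sup>2)"
  have "(\<integral>\<^sup>+x. (\<Sum>n. ?g n x) \<partial>lborel) = (\<Sum>n. \<integral>\<^sup>+x. ?g n x \<partial>lborel)"
    by (rule nn_integral_suminf) simp
  also have "\<dots> \<le> (\<Sum>n. ennreal ((1/2)^n))"
  proof (rule suminf_le)
    fix n
    have "(\<integral>\<^sup>+x. ?g n x \<partial>lborel) = ennreal (2^n * (l2_norm (X n))\<^sup>2)"
      by (simp add: ennreal_mult nn_integral_cmult l2_norm_nn_integral X)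
    also have "\<dots> \<le> ennreal (2^n * ((1/2)^n)\<^sup>2)"
      by (intro ennreal_leI mult_left_mono power_mono X) auto
    also have "2^n * ((1/2)^n)\<^sup>2 = (1/2::real)^n"
      by (simp add: power2_eq_square mult.assoc[symmetric] power_mult_distrib[symmetric])
    finally show "(\<integral>\<^sup>+x. ?g n x \<partial>lborel) \<le> ennreal ((1/2)^n)" .
  qed auto
  also have "\<dots> = ennreal (\<Sum>n. (1/2)^n)"
    by (rule suminf_ennreal2) (auto simp: summable_geometric)
  also have "\<dots> < \<infinity>" by simp
  finally have "AE x in lborel. (\<Sum>n. ?g n x) \<noteq> \<infinity>"
    by (intro nn_integral_PInf_AE) auto
  then show ?thesis
  proof eventually_elim
    case (elim x)
    then have "(\<Sum>n. ?g n x) \<noteq> top" by simp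
    then have "summable (\<lambda>n. 2^n * (cmod (X n x))\<^sup>2)"
      by (intro summable_suminf_not_top) auto
    then obtain B where B: "\<And>n. 2^n * (cmod (X n x))\<^sup>2 \<le> B"
      using summable_imp_Bseq by (force simp: Bseq_def)
    have bound: "cmod (X n x) \<le> sqrt B * (sqrt (1/2))^n" for n
    proof -
      have "(cmod (X n x))\<^sup>2 \<le> B * (1/2)^n"
        using B[of n] by (simp add: field_simps power_one_over)
      then have "cmod (X n x) \<le> sqrt (B * (1/2)^n)" by (rule real_le_rsqrt)
      then show ?thesis by (simp add: real_sqrt_mult real_sqrt_power)
    qed
    show "summable (\<lambda>n. cmod (X n x))"
    proof (rule summable_comparison_test)
      show "\<exists>N. \<forall>n\<ge>N. norm (cmod (X n x)) \<le> sqrt B * (sqrt (1/2))^n" using bound by auto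
      show "summable (\<lambda>n. sqrt B * (sqrt (1/2))^n)"
        by (intro summable_mult summable_geometric) (simp add: real_sqrt_divide)
    qed
  qed
qed

text \<open>
  The Riesz-Fischer theorem.
\<close>

theorem L2_complete:
  assumes X: "\<And>n. X n \<in> L2"
    and Cauchy: "\<And>e. e > 0 \<Longrightarrow> \<exists>N. \<forall>m\<ge>N. \<forall>n\<ge>N. l2_dist (X m) (X n) < e"
  shows "\<exists>u. l2_tendsto X u sequentially"
proof -
  note [measurable] = X[THEN L2_measurable]
  have "\<exists>\<sigma>. strict_mono \<sigma> \<and> (\<forall>n. \<forall>m\<ge>\<sigma> n. \<forall>k\<ge>\<sigma> n. l2_dist (X m) (X k) < (1/2)^n)"
  proof -
    obtain N where N: "\<And>n m k. N n \<le> m \<Longrightarrow> N n \<le> k \<Longrightarrow> l2_dist (X m) (X k) < (1/2)^n"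
      using Cauchy[of "(1/2)^n" for n] by (metis zero_less_divide_1_iff zero_less_numeral zero_less_power)
    define \<sigma> where "\<sigma> n = (\<Sum>i\<le>n. N i) + n" for n
    have "strict_mono \<sigma>" by (auto simp: strict_mono_Suc_iff \<sigma>_def)
    moreover have "N n \<le> \<sigma> n" for n
      unfolding \<sigma>_def using member_le_sum[of n "{..n}" N] by simp
    ultimately show ?thesis using N order_trans by blast
  qed
  then obtain \<sigma> where \<sigma>: "strict_mono \<sigma>"
    "\<And>n m k. \<sigma> n \<le> m \<Longrightarrow> \<sigma> n \<le> k \<Longrightarrow> l2_dist (X m) (X k) < (1/2)^n" by blast
  define u where "u x = lim (\<lambda>n. X (\<sigma> n) x)" for x
  have [measurable]: "u \<in> borel_measurable borel"
    unfolding u_def by (rule borel_measurable_lim_metric) simp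
  have "AE x in lborel. summable (\<lambda>n. cmod (X (\<sigma> (Suc n)) x - X (\<sigma> n) x))"
    by (rule L2_AE_summable)
       (auto intro!: L2_diff X less_imp_le[OF \<sigma>(2)] simp: strict_mono_less_eq[OF \<sigma>(1)])
  then have lim: "AE x in lborel. (\<lambda>n. X (\<sigma> n) x) \<longlonglongrightarrow> u x"
  proof eventually_elim
    case (elim x)
    then have "summable (\<lambda>n. X (\<sigma> (Suc n)) x - X (\<sigma> n) x)" by (rule summable_norm_cancel)
    then have "convergent (\<lambda>n. \<Sum>i<n. X (\<sigma> (Suc i)) x - X (\<sigma> i) x)"
      by (simp add: summable_iff_convergent)
    then have "convergent (\<lambda>n. (\<Sum>i<n. X (\<sigma> (Suc i)) x - X (\<sigma> i) x) + X (\<sigma> 0) x)"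
      by (intro convergent_add convergent_const)
    then have "convergent (\<lambda>n. X (\<sigma> n) x)"
      by (simp add: sum_lessThan_telescope[where f = "\<lambda>n. X (\<sigma> n) x"])
    then show ?case unfolding u_def by (simp add: convergent_LIMSEQ_iff)
  qed
  have close: "(\<lambda>x. X m x - u x) \<in> L2 \<and> l2_dist (X m) u \<le> (1/2)^n"
    if m: "\<sigma> n \<le> m" for m n
  proof -
    let ?Y = "\<lambda>k x. X m x - X (\<sigma> (k + n)) x"
    have Y: "?Y k \<in> L2" "l2_norm (?Y k) \<le> (1/2)^n" for k
      using m le_trans[OF m] by (auto intro!: L2_diff X less_imp_le[OF \<sigma>(2)] simp: strict_mono_less_eq[OF \<sigma>(1)])
    have lims: "AE x in lborel. (\<lambda>k. ?Y k x) \<longlonglongrightarrow> X m x - u x"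
      using lim
    proof eventually_elim
      case (elim x)
      then show ?case by (intro tendsto_diff tendsto_const LIMSEQ_ignore_initial_segment)
    qed
    show ?thesis using L2_Fatou[of ?Y, OF Y _ lims] by auto
  qed
  have "u \<in> L2"
    using L2_diff[OF X[of "\<sigma> 0"] conjunct1[OF close[of 0 "\<sigma> 0"]]] by simp
  moreover have "(\<lambda>m. l2_dist (X m) u) \<longlonglongrightarrow> 0"
  proof (rule LIMSEQ_I)
    fix e :: real assume "0 < e"
    then obtain n where n: "(1/2)^n < e" using real_arch_pow_inv[of e "1/2"] by auto
    have "norm (l2_dist (X m) u - 0) < e" if "\<sigma> n \<le> m" for m
      using close[OF that] n by simp
    then show "\<exists>no. \<forall>m\<ge>no. norm (l2_dist (X m) u - 0) < e" by blast
  qed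
  ultimately show ?thesis using X by (auto simp: l2_tendsto_def)
qed

lemma l2_tendsto_inner:
  assumes "l2_tendsto X u F" "v \<in> L2"
  shows "((\<lambda>i. l2_inner (X i) v) \<longlongrightarrow> l2_inner u v) F"
proof (rule Lim_null[THEN iffD2], rule Lim_null_comparison)
  have X: "u \<in> L2" "\<forall>\<^sub>F i in F. X i \<in> L2" "((\<lambda>i. l2_dist (X i) u) \<longlongrightarrow> 0) F"
    using assms(1) by (auto simp: l2_tendsto_def)
  show "\<forall>\<^sub>F i in F. norm (l2_inner (X i) v - l2_inner u v) \<le> l2_dist (X i) u * l2_norm v"
    using X(2)
  proof eventually_elim
    case (elim i)
    then show ?case
      using l2_Cauchy_Schwarz[of "\<lambda>x. X i x - u x" v] X(1) assms(2)
      by (simp add: l2_inner_diff_left L2_diff)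
  qed
  show "((\<lambda>i. l2_dist (X i) u * l2_norm v) \<longlongrightarrow> 0) F"
    using X(3) by (rule tendsto_mult_left_zero)
qed

section \<open>Orthonormal expansions\<close>

text \<open>
  Orthonormal families. In contrast to \<^const>\<open>orthonormal_basis\<close>, nothing is said about their span.
\<close>

definition orthonormal :: "('i \<Rightarrow> real^'n \<Rightarrow> complex) \<Rightarrow> 'i set \<Rightarrow> bool" where
  "orthonormal f I \<longleftrightarrow> (\<forall>i\<in>I. f i \<in> L2) \<and>
     (\<forall>i\<in>I. \<forall>k\<in>I. l2_inner (f i) (f k) = (if i = k then 1 else 0))"

text \<open>
  Completeness in \<open>L\<^sub>2\<close>, expressed by the triviality of the orthogonal complement. The zero element is
  represented by all functions that vanish almost everywhere.
\<close>

definition complete_family :: "('i \<Rightarrow> real^'n \<Rightarrow> complex) \<Rightarrow> 'i set \<Rightarrow> bool" where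
  "complete_family f I \<longleftrightarrow> (\<forall>u\<in>L2. (\<forall>i\<in>I. l2_inner u (f i) = 0) \<longrightarrow> (AE x in lborel. u x = 0))"

lemma orthonormal_L2: "orthonormal f I \<Longrightarrow> i \<in> I \<Longrightarrow> f i \<in> L2"
  by (simp add: orthonormal_def)

lemma orthonormal_inner:
  "orthonormal f I \<Longrightarrow> i \<in> I \<Longrightarrow> k \<in> I \<Longrightarrow> l2_inner (f i) (f k) = (if i = k then 1 else 0)"
  by (simp add: orthonormal_def)

lemma L2_lincomb: "orthonormal f I \<Longrightarrow> F \<subseteq> I \<Longrightarrow> (\<lambda>x. \<Sum>i\<in>F. c i * f i x) \<in> L2"
  by (intro L2_sum L2_mult_left) (auto intro: orthonormal_L2)

lemma l2_inner_lincomb_left: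
  assumes "\<And>i. i \<in> F \<Longrightarrow> f i \<in> L2" "v \<in> L2"
  shows "l2_inner (\<lambda>x. \<Sum>i\<in>F. c i * f i x) v = (\<Sum>i\<in>F. c i * l2_inner (f i) v)"
proof -
  have "l2_inner (\<lambda>x. \<Sum>i\<in>F. c i * f i x) v = (\<Sum>i\<in>F. l2_inner (\<lambda>x. c i * f i x) v)"
    by (rule l2_inner_sum_left) (rule L2_mult_left assms, assumption?)+
  then show ?thesis by (simp only: l2_inner_mult_left)
qed

lemma l2_inner_orthonormal_lincomb:
  assumes "orthonormal f I" "finite F" "F \<subseteq> I" "k \<in> I"
  shows "l2_inner (\<lambda>x. \<Sum>i\<in>F. c i * f i x) (f k) = (if k \<in> F then c k else 0)"
proof -
  have "l2_inner (\<lambda>x. \<Sum>i\<in>F. c i * f i x) (f k) = (\<Sum>i\<in>F. c i * l2_inner (f i) (f k))"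
    using assms by (intro l2_inner_lincomb_left) (auto intro: orthonormal_L2)
  also have "\<dots> = (\<Sum>i\<in>F. if i = k then c k else 0)"
    using assms by (intro sum.cong) (auto simp: orthonormal_inner)
  finally show ?thesis using assms by simp
qed

lemma l2_norm_orthonormal_lincomb:
  assumes "orthonormal f I" "finite F" "F \<subseteq> I"
  shows "(l2_norm (\<lambda>x. \<Sum>i\<in>F. c i * f i x))\<^sup>2 = (\<Sum>i\<in>F. (cmod (c i))\<^sup>2)"
proof -
  let ?g = "\<lambda>x. \<Sum>i\<in>F. c i * f i x"
  have "complex_of_real ((l2_norm ?g)\<^sup>2) = (\<Sum>i\<in>F. l2_inner ?g (\<lambda>x. c i * f i x))"
    unfolding l2_inner_self[symmetric] using assms
    by (intro l2_inner_sum_right L2_mult_left L2_lincomb[OF assms(1,3)]) (auto intro: orthonormal_L2)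
  also have "\<dots> = (\<Sum>i\<in>F. of_real ((cmod (c i))\<^sup>2))"
    using assms(3)
    by (intro sum.cong refl)
       (subst l2_inner_mult_right, subst l2_inner_orthonormal_lincomb[OF assms],
        auto simp: complex_norm_square[symmetric] mult.commute simp del: of_real_power)
  finally show ?thesis unfolding of_real_sum[symmetric] of_real_eq_iff .
qed

lemma Bessel_finite:
  assumes "orthonormal f I" "finite F" "F \<subseteq> I" "u \<in> L2"
  shows "(\<Sum>i\<in>F. (cmod (l2_inner u (f i)))\<^sup>2) \<le> (l2_norm u)\<^sup>2"
proof -
  let ?g = "\<lambda>x. \<Sum>i\<in>F. l2_inner u (f i) * f i x"
  let ?S = "\<Sum>i\<in>F. (cmod (l2_inner u (f i)))\<^sup>2"
  have g: "?g \<in> L2" by (rule L2_lincomb[OF assms(1,3)])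
  have "l2_inner ?g u = (\<Sum>i\<in>F. l2_inner u (f i) * l2_inner (f i) u)"
    using assms by (intro l2_inner_lincomb_left) (auto intro: orthonormal_L2)
  also have "\<dots> = of_real ?S"
    by (simp add: l2_inner_commute[of _ u] complex_norm_square del: of_real_power)
  finally have inner: "l2_inner ?g u = of_real ?S" .
  have "?S = cmod (l2_inner ?g u)" unfolding inner norm_of_real by (simp add: sum_nonneg)
  also have "\<dots> \<le> l2_norm ?g * l2_norm u" by (rule l2_Cauchy_Schwarz[OF g assms(4)])
  also have "l2_norm ?g = sqrt ?S"
    unfolding l2_norm_orthonormal_lincomb[OF assms(1-3), symmetric] by simp
  finally have *: "sqrt ?S * sqrt ?S \<le> sqrt ?S * l2_norm u" by (simp add: sum_nonneg)
  have "0 \<le> ?S" by (simp add: sum_nonneg)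
  have "sqrt ?S \<le> l2_norm u"
  proof (cases "?S = 0")
    case False
    with \<open>0 \<le> ?S\<close> have "0 < sqrt ?S" by (simp add: less_le)
    with * show ?thesis by (rule mult_left_le_imp_le)
  qed simp
  then have "(sqrt ?S)\<^sup>2 \<le> (l2_norm u)\<^sup>2" using \<open>0 \<le> ?S\<close> by (intro power_mono) auto
  then show ?thesis by (simp add: sum_nonneg)
qed

lemma Bessel_summable:
  assumes "orthonormal f I" "u \<in> L2"
  shows "(\<lambda>i. (cmod (l2_inner u (f i)))\<^sup>2) summable_on I"
proof (rule nonneg_bdd_above_summable_on)
  show "bdd_above (sum (\<lambda>i. (cmod (l2_inner u (f i)))\<^sup>2) ` {F. F \<subseteq> I \<and> finite F})"
    using Bessel_finite[OF assms(1) _ _ assms(2)] by (intro bdd_aboveI2[of _ _ "(l2_norm u)\<^sup>2"]) simp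
qed simp

text \<open>
  The net of finite partial sums is Cauchy. It converges to the limit of the partial sums over an
  increasing sequence of finite sets beyond which all partial sums are close to each other.
\<close>

lemma orthonormal_has_sum_exists:
  assumes f: "orthonormal f I" and c: "(\<lambda>i. (cmod (c i))\<^sup>2) summable_on I"
  shows "\<exists>u. l2_has_sum (\<lambda>i x. c i * f i x) I u"
proof -
  let ?s = "\<lambda>F. \<Sum>i\<in>F. (cmod (c i))\<^sup>2" and ?g = "\<lambda>F x. \<Sum>i\<in>F. c i * f i x"
  have diff: "(l2_dist (?g G) (?g F))\<^sup>2 = ?s G - ?s F"
    if "finite G" "F \<subseteq> G" "G \<subseteq> I" for F G
  proof -
    have "(\<lambda>x. ?g G x - ?g F x) = ?g (G - F)"
      using that by (simp add: sum_diff)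
    then have "(l2_dist (?g G) (?g F))\<^sup>2 = ?s (G - F)"
      using that by (auto intro!: l2_norm_orthonormal_lincomb[OF f])
    then show ?thesis using that by (simp add: sum_diff)
  qed
  obtain S where S: "(?s \<longlongrightarrow> S) (finite_subsets_at_top I)"
    using c by (auto simp: summable_on_def has_sum_def)
  have "\<exists>F. finite F \<and> F \<subseteq> I \<and> (\<forall>G. finite G \<longrightarrow> F \<subseteq> G \<longrightarrow> G \<subseteq> I \<longrightarrow> l2_dist (?g G) (?g F) < e)"
    if "e > 0" for e
  proof -
    have "\<forall>\<^sub>F F in finite_subsets_at_top I. dist (?s F) S < e\<^sup>2 / 2"
      using that by (intro tendstoD[OF S]) simp
    then obtain F where F: "finite F" "F \<subseteq> I"
      "\<And>G. finite G \<Longrightarrow> F \<subseteq> G \<Longrightarrow> G \<subseteq> I \<Longrightarrow> \<bar>?s G - S\<bar> < e\<^sup>2 / 2"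
      by (auto simp: eventually_finite_subsets_at_top dist_real_def)
    have "l2_dist (?g G) (?g F) < e" if "finite G" "F \<subseteq> G" "G \<subseteq> I" for G
    proof -
      have "(l2_dist (?g G) (?g F))\<^sup>2 < e\<^sup>2"
        unfolding diff[OF that] using F(3)[OF that] F(3)[OF F(1) order_refl F(2)]
        unfolding abs_less_iff by linarith
      then show ?thesis using \<open>e > 0\<close> by (simp add: power2_less_imp_less)
    qed
    with F show ?thesis by blast
  qed
  then have "\<exists>F. finite F \<and> F \<subseteq> I \<and> (\<forall>G. finite G \<longrightarrow> F \<subseteq> G \<longrightarrow> G \<subseteq> I \<longrightarrow>
      l2_dist (?g G) (?g F) < inverse (Suc n))" for n :: nat
    by (simp del: of_nat_Suc)
  from choice[OF allI, OF this]
  obtain F where F': "\<forall>n. finite (F n) \<and> F n \<subseteq> I \<and> (\<forall>G. finite G \<longrightarrow> F n \<subseteq> G \<longrightarrow> G \<subseteq> I \<longrightarrow>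
      l2_dist (?g G) (?g (F n)) < inverse (Suc n))" ..
  have F: "finite (F n)" "F n \<subseteq> I" for n using F' by auto
  have F3: "l2_dist (?g G) (?g (F n)) < inverse (Suc n)"
    if "finite G" "F n \<subseteq> G" "G \<subseteq> I" for n G using F' that by blast
  have g: "?g G \<in> L2" if "G \<subseteq> I" for G using that by (rule L2_lincomb[OF f])
  have close: "l2_dist (?g G) (?g H) < inverse (Suc n) + inverse (Suc n)"
    if "finite G" "F n \<subseteq> G" "G \<subseteq> I" "finite H" "F n \<subseteq> H" "H \<subseteq> I" for G H n
  proof -
    have "l2_dist (?g G) (?g H)
        \<le> l2_dist (?g G) (?g (F n)) + l2_dist (?g (F n)) (?g H)"
      using that F(2) by (intro l2_norm_triangle3 g)
    then show ?thesis
      using F3[of G n] F3[of H n] that by (simp add: l2_norm_minus_commute[of "?g (F n)"])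
  qed
  define A where "A n = (\<Union>k\<le>n. F k)" for n
  have A: "finite (A n)" "A n \<subseteq> I" "m \<le> n \<Longrightarrow> F m \<subseteq> A n" for m n
    using F(1,2) by (auto simp: A_def)
  have "\<exists>u. l2_tendsto (\<lambda>n. ?g (A n)) u sequentially"
  proof (rule L2_complete)
    fix e :: real assume "e > 0"
    then obtain n where n: "inverse (Suc n) < e/2" using reals_Archimedean[of "e/2"] by auto
    have "l2_dist (?g (A m)) (?g (A k)) < e" if "m \<ge> n" "k \<ge> n" for m k
    proof -
      have "l2_dist (?g (A m)) (?g (A k)) < inverse (Suc n) + inverse (Suc n)"
        using A that by (intro close) auto
      with n show ?thesis by simp
    qed
    then show "\<exists>N. \<forall>m\<ge>N. \<forall>n\<ge>N. l2_dist (?g (A m)) (?g (A n)) < e" by blast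
  qed (simp add: g A)
  then obtain u where u: "u \<in> L2" "(\<lambda>n. l2_dist (?g (A n)) u) \<longlonglongrightarrow> 0"
    by (auto simp: l2_tendsto_def)
  have "((\<lambda>G. l2_dist (?g G) u) \<longlongrightarrow> 0) (finite_subsets_at_top I)"
  proof (rule tendstoI)
    fix e :: real assume "e > 0"
    obtain N where N: "\<And>n. n \<ge> N \<Longrightarrow> l2_dist (?g (A n)) u < e/2"
      using LIMSEQ_D[OF u(2), of "e/2"] \<open>e > 0\<close> by auto
    obtain n where n: "inverse (Suc n) < e/4" using reals_Archimedean[of "e/4"] \<open>e > 0\<close> by auto
    have "l2_dist (?g G) u < e" if G: "finite G" "F n \<subseteq> G" "G \<subseteq> I" for G
    proof -
      let ?m = "max N n"
      have "l2_dist (?g G) u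
          \<le> l2_norm (\<lambda>x. ?g G x - ?g (A ?m) x) + l2_norm (\<lambda>x. ?g (A ?m) x - u x)"
        using G A u by (intro l2_norm_triangle3 g) auto
      also have "\<dots> < (inverse (Suc n) + inverse (Suc n)) + e/2"
        using G A by (intro add_strict_mono N close) auto
      also have "\<dots> < e" using n by simp
      finally show ?thesis .
    qed
    then show "\<forall>\<^sub>F G in finite_subsets_at_top I. dist (l2_dist (?g G) u) 0 < e"
      using F(1,2)[of n] by (auto simp: eventually_finite_subsets_at_top)
  qed
  moreover have "\<forall>\<^sub>F G in finite_subsets_at_top I. ?g G \<in> L2"
    using g by (auto intro: eventually_finite_subsets_at_top_weakI)
  ultimately show ?thesis using u(1) by (auto simp: l2_has_sum_def l2_tendsto_def)
qed

lemma infsum_single: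
  fixes f :: "'a \<Rightarrow> 'b::{comm_monoid_add, t2_space}"
  assumes "k \<in> A" "\<And>i. i \<in> A \<Longrightarrow> i \<noteq> k \<Longrightarrow> f i = 0"
  shows "infsum f A = f k"
proof -
  have "infsum f A = infsum f {k}" using assms by (intro infsum_cong_neutral) auto
  then show ?thesis by simp
qed

lemma l2_has_sum_L2: "l2_has_sum f I u \<Longrightarrow> u \<in> L2"
  by (simp add: l2_has_sum_def l2_tendsto_def)

lemma l2_has_sum_inner:
  assumes "l2_has_sum (\<lambda>i x. c i * f i x) I u" "\<And>i. i \<in> I \<Longrightarrow> f i \<in> L2" "v \<in> L2"
  shows "((\<lambda>i. c i * l2_inner (f i) v) has_sum l2_inner u v) I"
proof -
  have "((\<lambda>F. l2_inner (\<lambda>x. \<Sum>i\<in>F. c i * f i x) v) \<longlongrightarrow> l2_inner u v) (finite_subsets_at_top I)"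
    using assms by (auto simp: l2_has_sum_def intro: l2_tendsto_inner)
  moreover have "\<forall>\<^sub>F F in finite_subsets_at_top I.
      l2_inner (\<lambda>x. \<Sum>i\<in>F. c i * f i x) v = (\<Sum>i\<in>F. c i * l2_inner (f i) v)"
    using assms by (intro eventually_finite_subsets_at_top_weakI l2_inner_lincomb_left) auto
  ultimately show ?thesis by (simp add: has_sum_def tendsto_cong)
qed

lemma l2_has_sum_coeff:
  assumes "orthonormal f I" "l2_has_sum (\<lambda>i x. c i * f i x) J u" "J \<subseteq> I" "k \<in> I"
  shows "l2_inner u (f k) = (if k \<in> J then c k else 0)"
proof -
  have sum: "((\<lambda>i. c i * l2_inner (f i) (f k)) has_sum l2_inner u (f k)) J"
    using assms by (intro l2_has_sum_inner) (auto intro: orthonormal_L2)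
  have 0: "c i * l2_inner (f i) (f k) = 0" if "i \<in> J" "i \<noteq> k" for i
    using that assms by (auto simp: orthonormal_inner[OF assms(1)])
  show ?thesis
  proof (cases "k \<in> J")
    case True
    with sum infsum_single[of k J "\<lambda>i. c i * l2_inner (f i) (f k)"] 0 assms(4) show ?thesis
      by (simp add: infsumI[OF sum, symmetric] orthonormal_inner[OF assms(1)])
  next
    case False
    then have "((\<lambda>i. c i * l2_inner (f i) (f k)) has_sum 0) J"
      using 0 by (intro has_sum_0) auto
    with sum False show ?thesis by (auto dest: has_sum_unique)
  qed
qed

lemma Parseval:
  assumes f: "orthonormal f I" "complete_family f I" and "u \<in> L2" "v \<in> L2"
  shows "((\<lambda>i. l2_inner u (f i) * cnj (l2_inner v (f i))) has_sum l2_inner u v) I"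
proof -
  obtain w where w: "l2_has_sum (\<lambda>i x. l2_inner u (f i) * f i x) I w"
    using orthonormal_has_sum_exists[OF f(1) Bessel_summable[OF f(1) assms(3)]] by blast
  have "AE x in lborel. u x - w x = 0"
  proof (rule f(2)[unfolded complete_family_def, rule_format])
    show "(\<lambda>x. u x - w x) \<in> L2" using assms(3) l2_has_sum_L2[OF w] by (rule L2_diff)
    show "l2_inner (\<lambda>x. u x - w x) (f i) = 0" if "i \<in> I" for i
      using assms(3) l2_has_sum_L2[OF w] l2_has_sum_coeff[OF f(1) w order_refl that] that
        orthonormal_L2[OF f(1) that] by (simp add: l2_inner_diff_left)
  qed
  then have "l2_dist u w = 0"
    using assms(3) l2_has_sum_L2[OF w] by (simp add: l2_norm_eq_0_iff L2_diff)
  then have "l2_inner (\<lambda>x. u x - w x) v = 0"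
    using l2_Cauchy_Schwarz[of "\<lambda>x. u x - w x" v] assms l2_has_sum_L2[OF w] by (simp add: L2_diff)
  then have "l2_inner u v = l2_inner w v"
    using assms l2_has_sum_L2[OF w] by (simp add: l2_inner_diff_left)
  then show ?thesis
    using l2_has_sum_inner[OF w _ assms(4)] f(1) by (simp add: l2_inner_commute[of v] orthonormal_L2)
qed

text \<open>
  Two families with different index types are treated as one family over a disjoint sum of index sets.
\<close>

lemma Parseval_Plus:
  assumes "orthonormal (case_sum e f) (A <+> B)" "complete_family (case_sum e f) (A <+> B)" "u \<in> L2" "v \<in> L2"
  shows "(\<Sum>\<^sub>\<infinity>i\<in>A. l2_inner u (e i) * cnj (l2_inner v (e i))) +
         (\<Sum>\<^sub>\<infinity>i\<in>B. l2_inner u (f i) * cnj (l2_inner v (f i))) = l2_inner u v"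
proof -
  let ?h = "\<lambda>i. l2_inner u (case_sum e f i) * cnj (l2_inner v (case_sum e f i))"
  have sum: "(?h has_sum l2_inner u v) (A <+> B)" by (rule Parseval[OF assms])
  then have "l2_inner u v = infsum ?h (Inl ` A \<union> Inr ` B)" by (simp add: infsumI Plus_def)
  also have "\<dots> = infsum ?h (Inl ` A) + infsum ?h (Inr ` B)"
  proof (rule infsum_Un_disjoint)
    have "?h summable_on (A <+> B)" using sum by (rule has_sum_imp_summable)
    then show "?h summable_on Inl ` A" "?h summable_on Inr ` B"
      by (rule summable_on_subset, force simp: Plus_def)+
  qed auto
  also have "infsum ?h (Inl ` A) = (\<Sum>\<^sub>\<infinity>i\<in>A. l2_inner u (e i) * cnj (l2_inner v (e i)))"
    by (subst infsum_reindex) (auto simp: comp_def)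
  also have "infsum ?h (Inr ` B) = (\<Sum>\<^sub>\<infinity>i\<in>B. l2_inner u (f i) * cnj (l2_inner v (f i)))"
    by (subst infsum_reindex) (auto simp: comp_def)
  finally show ?thesis by simp
qed

section \<open>The adjoint in terms of an orthonormal basis\<close>

lemma sobolev_L2: "u \<in> sobolev s \<Longrightarrow> u \<in> L2"
  by (simp add: sobolev_def)

text \<open>
  The inner product \<open>ip\<close> has weight \<open>1\<close> on the family \<open>e\<close> and weights \<open>\<omega>\<close> on the family \<open>f\<close>, and \<open>\<eta>\<close> denotes the
  reciprocal weights. The sums defining \<open>ip w v\<close> converge for \<open>v\<close> in \<open>L\<^sub>2\<close> since the weights cancel, even if
  \<open>ip v v\<close> does not converge.
\<close>

lemma embedding_adjoint_expansion:
  fixes e :: "'a \<Rightarrow> real^'n \<Rightarrow> complex" and f :: "'b \<Rightarrow> real^'n \<Rightarrow> complex"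
    and \<omega> \<eta> :: "'b \<Rightarrow> real" and A :: "'a set" and B :: "'b set"
  defines "ip \<equiv> \<lambda>u v. (\<Sum>\<^sub>\<infinity>i\<in>A. l2_inner u (e i) * cnj (l2_inner v (e i))) +
      (\<Sum>\<^sub>\<infinity>i\<in>B. of_real (\<omega> i) * l2_inner u (f i) * cnj (l2_inner v (f i)))"
  assumes basis: "orthonormal (case_sum e f) (A <+> B)" "complete_family (case_sum e f) (A <+> B)"
    and weights: "\<And>i. i \<in> B \<Longrightarrow> \<omega> i * \<eta> i = 1" "\<And>i. i \<in> B \<Longrightarrow> \<bar>\<eta> i\<bar> \<le> 1"
    and sobolev: "\<And>i. i \<in> A \<Longrightarrow> e i \<in> sobolev s" "\<And>i. i \<in> B \<Longrightarrow> f i \<in> sobolev s"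
    and synthesis: "\<And>a b. l2_has_sum (\<lambda>i x. l2_inner u (e i) * e i x) A a \<Longrightarrow>
      l2_has_sum (\<lambda>i x. of_real (\<eta> i) * l2_inner u (f i) * f i x) B b \<Longrightarrow>
      (\<lambda>x. a x + b x) \<in> sobolev s"
    and u: "u \<in> L2"
  shows "(\<exists>w. is_embedding_adjoint s ip u w) \<and>
     (\<forall>w. is_embedding_adjoint s ip u w \<longrightarrow>
       (\<exists>a b. l2_has_sum (\<lambda>i x. l2_inner u (e i) * e i x) A a \<and>
          l2_has_sum (\<lambda>i x. of_real (\<eta> i) * l2_inner u (f i) * f i x) B b \<and>
          (AE x in lborel. w x = a x + b x)))"
proof -
  note inner = orthonormal_inner[OF basis(1)]
  have e: "orthonormal e A"
    unfolding orthonormal_def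
  proof (intro conjI ballI)
    show "e i \<in> L2" if "i \<in> A" for i
      using orthonormal_L2[OF basis(1) InlI[OF that]] by simp
    show "l2_inner (e i) (e k) = (if i = k then 1 else 0)" if "i \<in> A" "k \<in> A" for i k
      using inner[OF InlI[OF that(1)] InlI[OF that(2)]] by simp
  qed
  have f: "orthonormal f B"
    unfolding orthonormal_def
  proof (intro conjI ballI)
    show "f i \<in> L2" if "i \<in> B" for i
      using orthonormal_L2[OF basis(1) InrI[OF that]] by simp
    show "l2_inner (f i) (f k) = (if i = k then 1 else 0)" if "i \<in> B" "k \<in> B" for i k
      using inner[OF InrI[OF that(1)] InrI[OF that(2)]] by simp
  qed
  have ef: "l2_inner (e i) (f k) = 0" "l2_inner (f k) (e i) = 0" if "i \<in> A" "k \<in> B" for i k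
    using inner[OF InlI[OF that(1)] InrI[OF that(2)]] inner[OF InrI[OF that(2)] InlI[OF that(1)]]
    by simp_all
  obtain a where a: "l2_has_sum (\<lambda>i x. l2_inner u (e i) * e i x) A a"
    using orthonormal_has_sum_exists[OF e Bessel_summable[OF e u]] by blast
  have "(\<lambda>i. (cmod (of_real (\<eta> i) * l2_inner u (f i)))\<^sup>2) summable_on B"
  proof (rule summable_on_comparison_test[OF Bessel_summable[OF f u]])
    fix i assume "i \<in> B"
    then have "(\<bar>\<eta> i\<bar> * cmod (l2_inner u (f i)))\<^sup>2 \<le> (1 * cmod (l2_inner u (f i)))\<^sup>2"
      by (intro power_mono mult_right_mono weights) auto
    then show "(cmod (of_real (\<eta> i) * l2_inner u (f i)))\<^sup>2 \<le> (cmod (l2_inner u (f i)))\<^sup>2"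
      by (simp add: norm_mult)
  qed auto
  then obtain b where b: "l2_has_sum (\<lambda>i x. of_real (\<eta> i) * l2_inner u (f i) * f i x) B b"
    using orthonormal_has_sum_exists[OF f, of "\<lambda>i. of_real (\<eta> i) * l2_inner u (f i)"] by blast
  define w where "w = (\<lambda>x. a x + b x)"
  have ab: "a \<in> L2" "b \<in> L2" using a b by (auto intro: l2_has_sum_L2)
  have w: "w \<in> sobolev s" unfolding w_def using a b by (rule synthesis)
  have eL: "e i \<in> L2" if "i \<in> A" for i using that e by (auto intro: orthonormal_L2)
  have fL: "f i \<in> L2" if "i \<in> B" for i using that f by (auto intro: orthonormal_L2)
  have we: "l2_inner w (e k) = l2_inner u (e k)" if k: "k \<in> A" for k
  proof -
    have "((\<lambda>i. of_real (\<eta> i) * l2_inner u (f i) * l2_inner (f i) (e k)) has_sum l2_inner b (e k)) B"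
      using b fL eL[OF k] by (rule l2_has_sum_inner)
    moreover have "((\<lambda>i. of_real (\<eta> i) * l2_inner u (f i) * l2_inner (f i) (e k)) has_sum 0) B"
      using k by (intro has_sum_0) (simp add: ef)
    ultimately have "l2_inner b (e k) = 0" by (rule has_sum_unique)
    then show ?thesis unfolding w_def
      using l2_has_sum_coeff[OF e a order_refl k] k ab by (simp add: l2_inner_add_left eL)
  qed
  have wf: "l2_inner w (f k) = of_real (\<eta> k) * l2_inner u (f k)" if k: "k \<in> B" for k
  proof -
    have "((\<lambda>i. l2_inner u (e i) * l2_inner (e i) (f k)) has_sum l2_inner a (f k)) A"
      using a eL fL[OF k] by (rule l2_has_sum_inner)
    moreover have "((\<lambda>i. l2_inner u (e i) * l2_inner (e i) (f k)) has_sum 0) A"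
      using k by (intro has_sum_0) (simp add: ef)
    ultimately have "l2_inner a (f k) = 0" by (rule has_sum_unique)
    then show ?thesis unfolding w_def
      using l2_has_sum_coeff[OF f b order_refl k] k ab by (simp add: l2_inner_add_left fL)
  qed
  have "is_embedding_adjoint s ip u w"
    unfolding is_embedding_adjoint_def
  proof (intro conjI ballI w)
    fix v :: "real^'n \<Rightarrow> complex" assume v: "v \<in> sobolev s"
    have "ip w v = (\<Sum>\<^sub>\<infinity>i\<in>A. l2_inner u (e i) * cnj (l2_inner v (e i))) +
        (\<Sum>\<^sub>\<infinity>i\<in>B. l2_inner u (f i) * cnj (l2_inner v (f i)))"
      unfolding ip_def
      by (intro arg_cong2[where f = "(+)"] infsum_cong)
         (auto simp: we wf mult.assoc[symmetric] weights(1) simp flip: of_real_mult)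
    then show "ip w v = l2_inner u v"
      using Parseval_Plus[OF basis u sobolev_L2[OF v]] by simp
  qed
  moreover have "AE x in lborel. w' x = a x + b x" if w': "is_embedding_adjoint s ip u w'" for w'
  proof -
    have adj: "ip w' v = l2_inner u v" if "v \<in> sobolev s" for v
      using w' that by (simp add: is_embedding_adjoint_def)
    have w'L: "w' \<in> L2" using w' sobolev_L2 by (auto simp: is_embedding_adjoint_def)
    have we': "l2_inner w' (e k) = l2_inner u (e k)" if k: "k \<in> A" for k
    proof -
      have "(\<Sum>\<^sub>\<infinity>i\<in>A. l2_inner w' (e i) * cnj (l2_inner (e k) (e i))) =
          l2_inner w' (e k) * cnj (l2_inner (e k) (e k))"
        using k by (intro infsum_single) (auto simp: orthonormal_inner[OF e])
      moreover have "(\<Sum>\<^sub>\<infinity>i\<in>B. of_real (\<omega> i) * l2_inner w' (f i) * cnj (l2_inner (e k) (f i))) = 0"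
        using k by (intro infsum_0) (simp add: ef)
      ultimately show ?thesis
        using adj[OF sobolev(1)[OF k]] k by (simp add: ip_def orthonormal_inner[OF e])
    qed
    have wf': "l2_inner w' (f k) = of_real (\<eta> k) * l2_inner u (f k)" if k: "k \<in> B" for k
    proof -
      have "(\<Sum>\<^sub>\<infinity>i\<in>B. of_real (\<omega> i) * l2_inner w' (f i) * cnj (l2_inner (f k) (f i))) =
          of_real (\<omega> k) * l2_inner w' (f k) * cnj (l2_inner (f k) (f k))"
        using k by (intro infsum_single) (auto simp: orthonormal_inner[OF f])
      moreover have "(\<Sum>\<^sub>\<infinity>i\<in>A. l2_inner w' (e i) * cnj (l2_inner (f k) (e i))) = 0"
        using k by (intro infsum_0) (simp add: ef)
      ultimately have eq: "of_real (\<omega> k) * l2_inner w' (f k) = l2_inner u (f k)"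
        using adj[OF sobolev(2)[OF k]] k by (simp add: ip_def orthonormal_inner[OF f])
      have "of_real (\<omega> k * \<eta> k) * l2_inner w' (f k) = of_real (\<eta> k) * l2_inner u (f k)"
        unfolding eq[symmetric] by (simp add: ac_simps)
      then show ?thesis using weights(1)[OF k] by simp
    qed
    have "\<forall>i\<in>A <+> B. l2_inner (\<lambda>x. w' x - w x) (case_sum e f i) = 0"
      using w'L sobolev_L2[OF w] by (auto simp: l2_inner_diff_left eL fL we we' wf wf')
    moreover have "(\<lambda>x. w' x - w x) \<in> L2" using w'L sobolev_L2[OF w] by (rule L2_diff)
    ultimately have "AE x in lborel. w' x - w x = 0"
      using basis(2) unfolding complete_family_def by blast
    then show ?thesis by eventually_elim (simp add: w_def)
  qed
  ultimately show ?thesis using a b by blast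
qed

section \<open>Gaussian integrals\<close>

lemma prod_UNIV_Basis:
  fixes x :: "real^'n"
  shows "(\<Prod>i\<in>UNIV. f i (x $ i)) = (\<Prod>b\<in>Basis. f (axis_index b) (x \<bullet> b))"
proof -
  have "(\<Prod>b\<in>Basis. f (axis_index b) (x \<bullet> b)) = (\<Prod>b\<in>(\<lambda>i. axis i 1) ` UNIV. f (axis_index b) (x \<bullet> b))"
    by (intro prod.cong) (auto simp: Basis_vec_def)
  also have "\<dots> = (\<Prod>i\<in>UNIV. f i (x $ i))"
    by (subst prod.reindex) (auto simp: inj_on_def axis_eq_axis axis_index_axis inner_axis)
  finally show ?thesis by simp
qed

lemma prod_UNIV_Basis': "(\<Prod>i\<in>UNIV. g i) = (\<Prod>b\<in>(Basis::(real^'n) set). g (axis_index b))"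
  using prod_UNIV_Basis[of "\<lambda>i _. g i"] .

text \<open>
  Fubini's theorem for products of functions of one coordinate each.
\<close>

lemma lborel_integral_prod:
  fixes f :: "'n::finite \<Rightarrow> real \<Rightarrow> 'a::{real_normed_field,banach,second_countable_topology}"
  assumes f: "\<And>i. integrable lborel (f i)"
  shows "integrable (lborel :: (real^'n) measure) (\<lambda>x. \<Prod>i\<in>UNIV. f i (x $ i))"
    and "(\<integral>x. (\<Prod>i\<in>UNIV. f i (x $ i)) \<partial>(lborel :: (real^'n) measure)) = (\<Prod>i\<in>UNIV. \<integral>t. f i t \<partial>lborel)"
proof -
  interpret product_sigma_finite "\<lambda>_::real^'n. lborel :: real measure" ..
  let ?T = "\<lambda>f. \<Sum>b\<in>(Basis::(real^'n) set). f b *\<^sub>R b"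
  let ?P = "\<Pi>\<^sub>M b\<in>(Basis::(real^'n) set). (lborel :: real measure)"
  have [measurable]: "f i \<in> borel_measurable borel" for i using f[of i] by auto
  have T: "(\<Sum>c\<in>Basis. g c *\<^sub>R c) \<bullet> b = g b" if "b \<in> Basis" for g and b :: "real^'n"
    using that by simp
  have eq: "(\<Prod>i\<in>UNIV. f i (?T g $ i)) = (\<Prod>b\<in>(Basis::(real^'n) set). f (axis_index b) (g b))" for g
    unfolding prod_UNIV_Basis by (intro prod.cong) (auto simp: T)
  have "integrable ?P (\<lambda>g. \<Prod>b\<in>(Basis::(real^'n) set). f (axis_index b) (g b))"
    by (rule product_integrable_prod) (auto simp: f)
  then show "integrable (lborel :: (real^'n) measure) (\<lambda>x. \<Prod>i\<in>UNIV. f i (x $ i))"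
    by (subst lborel_eq, subst integrable_distr_eq) (auto simp only: eq, measurable)
  have "(\<integral>x. (\<Prod>i\<in>UNIV. f i (x $ i)) \<partial>(lborel :: (real^'n) measure))
      = (\<integral>g. (\<Prod>b\<in>(Basis::(real^'n) set). f (axis_index b) (g b)) \<partial>?P)"
    by (subst lborel_eq, subst integral_distr) (auto simp only: eq, measurable)
  also have "\<dots> = (\<Prod>b\<in>(Basis::(real^'n) set). \<integral>t. f (axis_index b) t \<partial>lborel)"
    by (rule product_integral_prod) (auto simp: f)
  finally show "(\<integral>x. (\<Prod>i\<in>UNIV. f i (x $ i)) \<partial>(lborel :: (real^'n) measure)) = (\<Prod>i\<in>UNIV. \<integral>t. f i t \<partial>lborel)"
    by (simp add: prod_UNIV_Basis')
qed

text \<open>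
  Obtained from the characteristic function of the standard normal distribution by the substitution
  \<open>x = (2a)\<^sup>1\<^sup>/\<^sup>2 t\<close>.
\<close>

lemma gaussian_fourier_real:
  assumes "0 < a"
  shows "integrable lborel (\<lambda>t. of_real (exp (- a * t\<^sup>2)) * exp (\<i> * of_real (z * t)) :: complex)" (is ?I)
    and "(\<integral>t. of_real (exp (- a * t\<^sup>2)) * exp (\<i> * of_real (z * t)) \<partial>lborel)
      = complex_of_real (sqrt (pi / a) * exp (- z\<^sup>2 / (4 * a)))" (is ?E)
proof -
  let ?c = "sqrt (2 * a)" and ?w = "z / sqrt (2 * a)"
  have c: "0 < ?c" using assms by simp
  have c2: "?c * ?c = 2 * a" using assms by simp
  let ?g = "\<lambda>x. of_real (std_normal_density x) * exp (\<i> * of_real (?w * x)) :: complex"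
  have int: "integrable lborel ?g"
    by (rule Bochner_Integration.integrable_bound[OF integrable_normal_density[of 1 0]])
       (auto simp: norm_mult)
  have "(\<integral>x. ?g x \<partial>lborel) = char std_normal_distribution ?w"
    unfolding char_def by (subst integral_density) (auto simp: scaleR_conv_of_real)
  then have val: "(\<integral>x. ?g x \<partial>lborel) = of_real (exp (- (?w\<^sup>2) / 2))"
    by (simp add: char_std_normal_distribution)
  have eq: "?g (0 + ?c * t) = of_real (1 / sqrt (2 * pi)) * (of_real (exp (- a * t\<^sup>2)) * exp (\<i> * of_real (z * t)))"
    for t
  proof -
    have "(?c * t)\<^sup>2 / 2 = a * t\<^sup>2" using assms by (simp add: power_mult_distrib)
    moreover have "?w * (?c * t) = z * t" using c by simp
    ultimately show ?thesis by (simp add: std_normal_density_def)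
  qed
  have "integrable lborel (\<lambda>t. of_real (1 / sqrt (2 * pi)) * (of_real (exp (- a * t\<^sup>2)) * exp (\<i> * of_real (z * t))) :: complex)"
    using lborel_integrable_real_affine[OF int, of ?c 0] c unfolding eq by simp
  from integrable_mult_right[OF this, of "of_real (sqrt (2 * pi))"] show ?I
    by (simp add: mult.assoc[symmetric] del: mult.assoc)
  have "of_real (exp (- (?w\<^sup>2) / 2)) = ?c *\<^sub>R (\<integral>t. of_real (1 / sqrt (2 * pi)) *
      (of_real (exp (- a * t\<^sup>2)) * exp (\<i> * of_real (z * t))) \<partial>lborel :: complex)"
    using lborel_integral_real_affine[of ?c ?g 0] c unfolding eq val by simp
  also have "\<dots> = of_real (?c / sqrt (2 * pi)) *
      (\<integral>t. of_real (exp (- a * t\<^sup>2)) * exp (\<i> * of_real (z * t)) \<partial>lborel)"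
    by (simp add: scaleR_conv_of_real)
  also have "?c / sqrt (2 * pi) = sqrt (a / pi)" by (simp add: real_sqrt_divide real_sqrt_mult)
  finally have "of_real (sqrt (pi / a) * exp (- (?w\<^sup>2) / 2)) = of_real (sqrt (pi / a) * sqrt (a / pi)) *
      (\<integral>t. of_real (exp (- a * t\<^sup>2)) * exp (\<i> * of_real (z * t)) \<partial>lborel)"
    by simp
  moreover have "sqrt (pi / a) * sqrt (a / pi) = 1"
    using assms by (simp add: real_sqrt_mult[symmetric])
  moreover have "?w\<^sup>2 / 2 = z\<^sup>2 / (4 * a)" using assms by (simp add: power_divide)
  ultimately show ?E by simp
qed

text \<open>
  The kernel \<open>e\<^sup>-\<^sup>2\<^sup>\<pi>\<^sup>i\<^sup>\<xi>\<^sup>x\<close> of the Fourier transform.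
\<close>

abbreviation fourier_character :: "real^'n \<Rightarrow> real^'n \<Rightarrow> complex" where
  "fourier_character \<xi> x \<equiv> exp (- 2 * of_real pi * \<i> * of_real (\<xi> \<bullet> x))"

lemma norm_fourier_character: "cmod (fourier_character \<xi> x) = 1"
  by (simp add: norm_exp_i_times flip: of_real_mult)

text \<open>
  The Fourier transform of \<open>e\<^bsup>-a|\<xi>|\<^sup>2\<^esup>\<close>, which is a probability density.
\<close>

definition gauss_dual :: "real \<Rightarrow> real^'n \<Rightarrow> real" where
  "gauss_dual a z = (\<Prod>i\<in>UNIV. sqrt (pi / a) * exp (- (pi\<^sup>2 / a) * (z $ i)\<^sup>2))"

lemma gaussian_fourier:
  assumes "0 < a"
  shows "integrable lborel (\<lambda>\<xi>::real^'n. of_real (exp (- a * (norm \<xi>)\<^sup>2)) * fourier_character \<xi> z)"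
    and "(\<integral>\<xi>. of_real (exp (- a * (norm \<xi>)\<^sup>2)) * fourier_character \<xi> z \<partial>lborel)
      = complex_of_real (gauss_dual a (z::real^'n))"
proof -
  let ?f = "\<lambda>i t. of_real (exp (- a * t\<^sup>2)) * exp (\<i> * of_real ((- 2 * pi * z $ i) * t)) :: complex"
  have eq: "of_real (exp (- a * (norm \<xi>)\<^sup>2)) * fourier_character \<xi> z = (\<Prod>i\<in>UNIV. ?f i (\<xi> $ i))" for \<xi> :: "real^'n"
  proof -
    have "(norm \<xi>)\<^sup>2 = (\<Sum>i\<in>UNIV. (\<xi> $ i)\<^sup>2)"
      by (simp add: norm_vec_def L2_set_def sum_nonneg)
    then have "exp (- a * (norm \<xi>)\<^sup>2) = (\<Prod>i\<in>UNIV. exp (- a * (\<xi> $ i)\<^sup>2))"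
      by (simp add: exp_sum[symmetric] sum_distrib_left sum_negf)
    moreover have "fourier_character \<xi> z = (\<Prod>i\<in>UNIV. exp (\<i> * of_real ((- 2 * pi * z $ i) * \<xi> $ i)))"
      by (simp add: exp_sum[symmetric] inner_vec_def sum_distrib_left sum_negf mult_ac)
    ultimately show ?thesis by (simp add: prod.distrib)
  qed
  show "integrable lborel (\<lambda>\<xi>::real^'n. of_real (exp (- a * (norm \<xi>)\<^sup>2)) * fourier_character \<xi> z)"
    unfolding eq by (rule lborel_integral_prod gaussian_fourier_real assms)+
  have "(\<integral>\<xi>. of_real (exp (- a * (norm \<xi>)\<^sup>2)) * fourier_character \<xi> z \<partial>lborel) = (\<Prod>i\<in>UNIV. \<integral>t. ?f i t \<partial>lborel)"
    unfolding eq by (rule lborel_integral_prod gaussian_fourier_real assms)+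
  also have "\<dots> = (\<Prod>i\<in>UNIV. of_real (sqrt (pi / a) * exp (- (- 2 * pi * z $ i)\<^sup>2 / (4 * a))))"
    unfolding gaussian_fourier_real(2)[OF assms] ..
  also have "\<dots> = of_real (gauss_dual a z)"
    unfolding gauss_dual_def of_real_prod
    by (intro prod.cong refl arg_cong[where f = of_real]) (simp add: power_mult_distrib)
  finally show "(\<integral>\<xi>. of_real (exp (- a * (norm \<xi>)\<^sup>2)) * fourier_character \<xi> z \<partial>lborel)
      = complex_of_real (gauss_dual a z)" .
qed

lemma gauss_dual_nonneg: "0 < a \<Longrightarrow> 0 \<le> gauss_dual a z"
  by (simp add: gauss_dual_def prod_nonneg)

lemma gauss_dual_minus_commute: "gauss_dual a (x - y) = gauss_dual a (y - x)"
  by (simp add: gauss_dual_def power2_commute)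

lemma borel_measurable_vec_nth [measurable]: "(\<lambda>x::real^'n. x $ i) \<in> borel_measurable borel"
  by (intro borel_measurable_continuous_onI continuous_intros)

lemma borel_measurable_gauss_dual [measurable]: "gauss_dual a \<in> borel_measurable borel"
  unfolding gauss_dual_def by measurable

lemma gauss_dual_integral:
  assumes "0 < a"
  shows "integrable lborel (gauss_dual a :: real^'n \<Rightarrow> real)"
    and "(\<integral>z. gauss_dual a (z::real^'n) \<partial>lborel) = 1"
proof -
  have b: "0 < pi\<^sup>2 / a" using assms by simp
  let ?g = "\<lambda>t. sqrt (pi / a) * exp (- (pi\<^sup>2 / a) * t\<^sup>2)"
  have "complex_of_real \<circ> ?g = (\<lambda>t. of_real (sqrt (pi / a)) * (of_real (exp (- (pi\<^sup>2 / a) * t\<^sup>2)) * exp (\<i> * of_real (0 * t))))"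
    by auto
  then have int: "integrable lborel (\<lambda>t. complex_of_real (?g t))"
    using integrable_mult_right[OF gaussian_fourier_real(1)[OF b, of 0], of "of_real (sqrt (pi / a))"]
    by (simp add: comp_def)
  have int: "integrable lborel ?g"
    using integrable_Re[OF int] by simp
  have "complex_of_real (\<integral>t. exp (- (pi\<^sup>2 / a) * t\<^sup>2) \<partial>lborel) =
      (\<integral>t. of_real (exp (- (pi\<^sup>2 / a) * t\<^sup>2)) * exp (\<i> * of_real (0 * t)) \<partial>lborel)"
    by (subst integral_complex_of_real[symmetric]) simp
  also have "\<dots> = of_real (sqrt (pi / (pi\<^sup>2 / a)))"
    unfolding gaussian_fourier_real(2)[OF b] by simp
  finally have "complex_of_real (\<integral>t. exp (- (pi\<^sup>2 / a) * t\<^sup>2) \<partial>lborel) = of_real (sqrt (pi / (pi\<^sup>2 / a)))" .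
  then have "(\<integral>t. exp (- (pi\<^sup>2 / a) * t\<^sup>2) \<partial>lborel) = sqrt (pi / (pi\<^sup>2 / a))" by (simp only: of_real_eq_iff)
  then have "(\<integral>t. ?g t \<partial>lborel) = sqrt (pi / a) * sqrt (pi / (pi\<^sup>2 / a))" by simp
  also have "\<dots> = 1" using assms by (simp add: real_sqrt_mult[symmetric] power2_eq_square)
  finally have val: "(\<integral>t. ?g t \<partial>lborel) = 1" .
  have eq: "gauss_dual a = (\<lambda>z::real^'n. \<Prod>i\<in>UNIV. ?g (z $ i))" by (simp add: gauss_dual_def fun_eq_iff)
  show "integrable lborel (gauss_dual a :: real^'n \<Rightarrow> real)"
    unfolding eq by (intro lborel_integral_prod int)
  have "(\<integral>z. gauss_dual a (z::real^'n) \<partial>lborel) = (\<Prod>i\<in>(UNIV::'n set). \<integral>t. ?g t \<partial>lborel)"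
    unfolding eq by (intro lborel_integral_prod int)
  then show "(\<integral>z. gauss_dual a (z::real^'n) \<partial>lborel) = 1" unfolding val by simp
qed

lemma nn_integral_lborel_translate:
  fixes c :: "'a::euclidean_space"
  assumes [measurable]: "f \<in> borel_measurable borel"
  shows "(\<integral>\<^sup>+x. f (x + c) \<partial>lborel) = (\<integral>\<^sup>+x. f x \<partial>lborel)"
proof -
  have "(\<integral>\<^sup>+x. f x \<partial>lborel) = (\<integral>\<^sup>+x. f x \<partial>distr lborel borel ((+) c))"
    by (simp add: lborel_distr_plus)
  also have "\<dots> = (\<integral>\<^sup>+x. f (x + c) \<partial>lborel)"
    by (subst nn_integral_distr) (simp_all add: add.commute)
  finally show ?thesis by simp
qed

lemma nn_integral_gauss_dual:
  fixes x :: "real^'n"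
  assumes "0 < a"
  shows "(\<integral>\<^sup>+y. ennreal (gauss_dual a (x - y)) \<partial>lborel) = 1"
proof -
  have "(\<integral>\<^sup>+y. ennreal (gauss_dual a (x - y)) \<partial>lborel) = (\<integral>\<^sup>+y. ennreal (gauss_dual a (y + (- x))) \<partial>lborel)"
    by (simp add: gauss_dual_minus_commute[of a x])
  also have "\<dots> = (\<integral>\<^sup>+y. ennreal (gauss_dual a (y::real^'n)) \<partial>lborel)"
    by (rule nn_integral_lborel_translate) measurable
  also have "\<dots> = 1"
    using gauss_dual_integral[where 'n = 'n, OF assms] by (simp add: nn_integral_eq_integral gauss_dual_nonneg[OF assms])
  finally show ?thesis .
qed

section \<open>The Fourier transform on \<open>L\<^sub>2\<close>\<close>

lemma borel_measurable_fourier_L1 [measurable]: 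
  assumes [measurable]: "u \<in> borel_measurable borel"
  shows "fourier_L1 u \<in> borel_measurable borel"
  unfolding fourier_L1_def[abs_def]
  by (rule lborel.borel_measurable_lebesgue_integral) measurable

lemma integrable_fourier:
  assumes "integrable lborel u"
  shows "integrable lborel (\<lambda>x. fourier_character \<xi> x * u x)"
  using assms borel_measurable_integrable[OF assms]
  by (intro Bochner_Integration.integrable_bound[OF assms]) (auto simp: norm_mult norm_fourier_character)

lemma norm_fourier_L1_le:
  assumes "integrable lborel u"
  shows "cmod (fourier_L1 u \<xi>) \<le> (\<integral>x. cmod (u x) \<partial>lborel)"
  unfolding fourier_L1_def
  by (rule order_trans[OF integral_norm_bound]) (simp add: norm_mult norm_fourier_character)

lemma integrable_tensor:
  fixes f g :: "'a::euclidean_space \<Rightarrow> complex"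
  assumes f: "integrable lborel f" and g: "integrable lborel g"
    and e: "(\<lambda>p. e (fst p) (snd p)) \<in> borel_measurable (borel \<Otimes>\<^sub>M borel)"
    and le: "\<And>x y. cmod (e x y) \<le> cmod (f x) * cmod (g y)"
  shows "integrable (lborel \<Otimes>\<^sub>M lborel) (\<lambda>(x, y). e x y :: complex)"
proof (rule integrableI_bounded)
  have [measurable]: "f \<in> borel_measurable borel" "g \<in> borel_measurable borel"
    using f g by auto
  show "(\<lambda>(x, y). e x y) \<in> borel_measurable (lborel \<Otimes>\<^sub>M lborel)"
    using e by (simp add: case_prod_beta' cong: measurable_cong_sets)
  have "(\<integral>\<^sup>+p. ennreal (norm (case p of (x, y) \<Rightarrow> e x y)) \<partial>(lborel \<Otimes>\<^sub>M lborel))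
      \<le> (\<integral>\<^sup>+p. ennreal (cmod (f (fst p)) * cmod (g (snd p))) \<partial>(lborel \<Otimes>\<^sub>M lborel))"
    by (intro nn_integral_mono) (auto simp: le intro!: ennreal_leI)
  also have "\<dots> = (\<integral>\<^sup>+x. \<integral>\<^sup>+y. ennreal (cmod (f x)) * ennreal (cmod (g y)) \<partial>lborel \<partial>lborel)"
    by (subst lborel.nn_integral_fst[symmetric]) (simp_all add: ennreal_mult)
  also have "\<dots> = (\<integral>\<^sup>+x. ennreal (cmod (f x)) \<partial>lborel) * (\<integral>\<^sup>+y. ennreal (cmod (g y)) \<partial>lborel)"
    by (simp add: nn_integral_cmult nn_integral_multc)
  also have "\<dots> < \<infinity>"
    using f g by (simp add: integrable_iff_bounded ennreal_mult_less_top)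
  finally show "(\<integral>\<^sup>+p. ennreal (norm (case p of (x, y) \<Rightarrow> e x y)) \<partial>(lborel \<Otimes>\<^sub>M lborel)) < \<infinity>" .
qed

text \<open>
  Inserting the definition of the Fourier transform twice and integrating over the frequency first turns
  the Gaussian mean of its squared modulus into a quadratic form with kernel \<open>gauss_dual a (x - y)\<close>.
\<close>

lemma gaussian_mean_fourier_square:
  fixes f :: "real^'n \<Rightarrow> complex"
  assumes a: "0 < a" and f: "integrable lborel f"
  shows "(\<integral>\<xi>. of_real (exp (- a * (norm \<xi>)\<^sup>2)) * (fourier_L1 f \<xi> * cnj (fourier_L1 f \<xi>)) \<partial>lborel) =
    (\<integral>x. (\<integral>y. f x * cnj (f y) * of_real (gauss_dual a (x - y)) \<partial>lborel) \<partial>lborel)"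
proof -
  note [measurable] = borel_measurable_integrable[OF f]
  let ?K = "\<lambda>\<xi>::real^'n. complex_of_real (exp (- a * (norm \<xi>)\<^sup>2))"
  let ?c = "fourier_character" and ?F = "fourier_L1 f"
  let ?C = "\<integral>x. cmod (f x) \<partial>lborel"
  have C: "cmod (?F \<xi>) \<le> ?C" for \<xi> by (rule norm_fourier_L1_le[OF f])
  have "0 \<le> ?C" by simp
  have K: "integrable lborel ?K"
    using gaussian_fourier(1)[OF a, of 0] by simp
  then have KC: "integrable lborel (\<lambda>\<xi>. of_real ?C * ?K \<xi>)" by simp
  have inner: "(\<integral>\<xi>. ?K \<xi> * ?c \<xi> x * cnj (?F \<xi>) \<partial>lborel) = (\<integral>y. cnj (f y) * of_real (gauss_dual a (x - y)) \<partial>lborel)" for x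
  proof -
    have "(\<integral>\<xi>. ?K \<xi> * ?c \<xi> x * cnj (?F \<xi>) \<partial>lborel)
        = (\<integral>\<xi>. (\<integral>y. ?K \<xi> * ?c \<xi> x * cnj (?c \<xi> y * f y) \<partial>lborel) \<partial>lborel)"
      unfolding fourier_L1_def Bochner_Integration.integral_cnj[symmetric]
      by (subst integral_mult_right_zero) simp
    also have "\<dots> = (\<integral>y. (\<integral>\<xi>. ?K \<xi> * ?c \<xi> x * cnj (?c \<xi> y * f y) \<partial>lborel) \<partial>lborel)"
    proof (rule lborel_pair.Fubini_integral)
      show "integrable (lborel \<Otimes>\<^sub>M lborel) (\<lambda>(y, \<xi>). ?K \<xi> * ?c \<xi> x * cnj (?c \<xi> y * f y))"
        by (rule integrable_tensor[OF f K]) (auto simp: norm_mult norm_fourier_character)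
    qed
    also have "\<dots> = (\<integral>y. (\<integral>\<xi>. cnj (f y) * (?K \<xi> * ?c \<xi> (x - y)) \<partial>lborel) \<partial>lborel)"
      by (intro Bochner_Integration.integral_cong refl)
         (simp add: exp_cnj inner_diff_right algebra_simps flip: exp_add exp_diff)
    also have "\<dots> = (\<integral>y. cnj (f y) * of_real (gauss_dual a (x - y)) \<partial>lborel)"
      unfolding integral_mult_right_zero gaussian_fourier(2)[OF a] ..
    finally show ?thesis .
  qed
  have "(\<integral>\<xi>. ?K \<xi> * (?F \<xi> * cnj (?F \<xi>)) \<partial>lborel)
      = (\<integral>\<xi>. (\<integral>x. ?K \<xi> * cnj (?F \<xi>) * (?c \<xi> x * f x) \<partial>lborel) \<partial>lborel)"
    unfolding integral_mult_right_zero fourier_L1_def[of f, symmetric] by (simp add: mult_ac)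
  also have "\<dots> = (\<integral>x. (\<integral>\<xi>. ?K \<xi> * cnj (?F \<xi>) * (?c \<xi> x * f x) \<partial>lborel) \<partial>lborel)"
  proof (rule lborel_pair.Fubini_integral)
    have "cmod (?K \<xi> * cnj (?F \<xi>) * (?c \<xi> x * f x)) \<le> cmod (f x) * cmod (of_real ?C * ?K \<xi>)" for x \<xi>
      using C[of \<xi>] \<open>0 \<le> ?C\<close> mult_right_mono[OF C[of \<xi>], of "cmod (f x) * cmod (?K \<xi>)"]
      by (simp add: norm_mult norm_fourier_character mult_ac)
    then show "integrable (lborel \<Otimes>\<^sub>M lborel) (\<lambda>(x, \<xi>). ?K \<xi> * cnj (?F \<xi>) * (?c \<xi> x * f x))"
      by (intro integrable_tensor[OF f KC]) simp_all
  qed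
  also have "\<dots> = (\<integral>x. f x * (\<integral>\<xi>. ?K \<xi> * ?c \<xi> x * cnj (?F \<xi>) \<partial>lborel) \<partial>lborel)"
    unfolding integral_mult_right_zero[symmetric] by (simp add: mult_ac)
  also have "\<dots> = (\<integral>x. (\<integral>y. f x * cnj (f y) * of_real (gauss_dual a (x - y)) \<partial>lborel) \<partial>lborel)"
    unfolding inner integral_mult_right_zero[symmetric] by (simp add: mult_ac)
  finally show ?thesis .
qed

lemma norm_integral_le_nn_integral:
  fixes f :: "'a \<Rightarrow> complex"
  shows "ennreal (cmod (\<integral>x. f x \<partial>M)) \<le> (\<integral>\<^sup>+x. ennreal (cmod (f x)) \<partial>M)"
  by (cases "integrable M f") (auto simp: integral_norm_bound_ennreal not_integrable_integral_eq)

text \<open>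
  The elementary estimate \<open>|f(x) f(y)| \<le> (|f(x)|\<^sup>2 + |f(y)|\<^sup>2) / 2\<close> suffices because the kernel has integral
  one in each variable.
\<close>

lemma gauss_dual_form_le:
  fixes f :: "real^'n \<Rightarrow> complex"
  assumes a: "0 < a" and f: "f \<in> L2"
  shows "cmod (\<integral>x. (\<integral>y. f x * cnj (f y) * of_real (gauss_dual a (x - y)) \<partial>lborel) \<partial>lborel) \<le> (l2_norm f)\<^sup>2"
proof -
  note [measurable] = L2_measurable[OF f]
  note nonneg = gauss_dual_nonneg[OF a]
  let ?G = "\<lambda>x y::real^'n. ennreal (gauss_dual a (x - y))"
  let ?q = "\<lambda>x. ennreal ((cmod (f x))\<^sup>2 / 2)"
  have q: "(\<integral>\<^sup>+x. ?q x \<partial>lborel) = ennreal ((l2_norm f)\<^sup>2 / 2)"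
    using f by (subst nn_integral_eq_integral) (auto simp: L2_def l2_norm_square)
  have "ennreal (cmod (\<integral>x. (\<integral>y. f x * cnj (f y) * of_real (gauss_dual a (x - y)) \<partial>lborel) \<partial>lborel))
      \<le> (\<integral>\<^sup>+x. ennreal (cmod (\<integral>y. f x * cnj (f y) * of_real (gauss_dual a (x - y)) \<partial>lborel)) \<partial>lborel)"
    by (rule norm_integral_le_nn_integral)
  also have "\<dots> \<le> (\<integral>\<^sup>+x. (\<integral>\<^sup>+y. ennreal (cmod (f x * cnj (f y) * of_real (gauss_dual a (x - y)))) \<partial>lborel) \<partial>lborel)"
    by (intro nn_integral_mono norm_integral_le_nn_integral)
  also have "\<dots> \<le> (\<integral>\<^sup>+x. (\<integral>\<^sup>+y. ?q x * ?G x y + ?q y * ?G x y \<partial>lborel) \<partial>lborel)"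
  proof (intro nn_integral_mono)
    fix x y
    have "cmod (f x) * cmod (f y) \<le> (cmod (f x))\<^sup>2 / 2 + (cmod (f y))\<^sup>2 / 2"
      using sum_squares_bound[of "cmod (f x)" "cmod (f y)"] by simp
    from mult_right_mono[OF this nonneg[of "x - y"]]
    show "ennreal (cmod (f x * cnj (f y) * of_real (gauss_dual a (x - y)))) \<le> ?q x * ?G x y + ?q y * ?G x y"
      by (simp add: norm_mult nonneg distrib_right flip: ennreal_mult ennreal_plus)
  qed
  also have "\<dots> = (\<integral>\<^sup>+x. (\<integral>\<^sup>+y. ?q x * ?G x y \<partial>lborel) \<partial>lborel) + (\<integral>\<^sup>+x. (\<integral>\<^sup>+y. ?q y * ?G x y \<partial>lborel) \<partial>lborel)"
    by (simp add: nn_integral_add)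
  also have "(\<integral>\<^sup>+x. (\<integral>\<^sup>+y. ?q y * ?G x y \<partial>lborel) \<partial>lborel) = (\<integral>\<^sup>+y. (\<integral>\<^sup>+x. ?q y * ?G x y \<partial>lborel) \<partial>lborel)"
    by (rule lborel_pair.Fubini') simp
  also have "(\<integral>\<^sup>+x. (\<integral>\<^sup>+y. ?q x * ?G x y \<partial>lborel) \<partial>lborel) = ennreal ((l2_norm f)\<^sup>2 / 2)"
    by (simp add: nn_integral_cmult nn_integral_gauss_dual[OF a] q)
  also have "(\<integral>\<^sup>+y. (\<integral>\<^sup>+x. ?q y * ?G x y \<partial>lborel) \<partial>lborel) = ennreal ((l2_norm f)\<^sup>2 / 2)"
    by (subst gauss_dual_minus_commute) (simp add: nn_integral_cmult nn_integral_gauss_dual[OF a] q)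
  finally show ?thesis by (simp flip: ennreal_plus)
qed

text \<open>
  The inequality in Plancherel's theorem: let \<open>a\<close> tend to zero in the preceding lemmas and apply Fatou's
  lemma.
\<close>

theorem fourier_L1_L2:
  fixes f :: "real^'n \<Rightarrow> complex"
  assumes f: "integrable lborel f" "f \<in> L2"
  shows "fourier_L1 f \<in> L2" and "l2_norm (fourier_L1 f) \<le> l2_norm f"
proof -
  note [measurable] = borel_measurable_integrable[OF f(1)]
  let ?C = "\<integral>x. cmod (f x) \<partial>lborel" and ?F = "fourier_L1 f"
  define a where "a n = 1 / real (Suc n)" for n
  have a: "0 < a n" for n by (simp add: a_def)
  \<comment> \<open>The square root of the Gaussian weight is moved into the function.\<close>
  define X where "X n \<xi> = of_real (exp (- (a n / 2) * (norm \<xi>)\<^sup>2)) * ?F \<xi>" for n \<xi>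
  have [measurable]: "X n \<in> borel_measurable borel" for n unfolding X_def[abs_def] by measurable
  have X2: "complex_of_real ((cmod (X n \<xi>))\<^sup>2) = of_real (exp (- a n * (norm \<xi>)\<^sup>2)) * (?F \<xi> * cnj (?F \<xi>))" for n \<xi>
    unfolding complex_norm_square X_def
    by (simp add: mult_ac flip: of_real_mult exp_add)
  have X: "X n \<in> L2" "l2_norm (X n) \<le> l2_norm f" for n
  proof -
    have K: "integrable lborel (\<lambda>\<xi>::real^'n. ?C\<^sup>2 * exp (- a n * (norm \<xi>)\<^sup>2))"
      using integrable_norm[OF gaussian_fourier(1)[OF a[of n], of "0::real^'n"]] by (simp add: norm_mult)
    have "integrable lborel (\<lambda>\<xi>. (cmod (X n \<xi>))\<^sup>2)"
    proof (rule Bochner_Integration.integrable_bound[OF K])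
      show "AE \<xi> in lborel. norm ((cmod (X n \<xi>))\<^sup>2) \<le> norm (?C\<^sup>2 * exp (- a n * (norm \<xi>)\<^sup>2))"
      proof (rule AE_I2)
        fix \<xi> :: "real^'n"
        have "(cmod (X n \<xi>))\<^sup>2 = exp (- a n * (norm \<xi>)\<^sup>2) * (cmod (?F \<xi>))\<^sup>2"
          using arg_cong[OF X2[of n \<xi>], of cmod] by (simp add: norm_mult power2_eq_square)
        also have "\<dots> \<le> exp (- a n * (norm \<xi>)\<^sup>2) * ?C\<^sup>2"
          by (intro mult_left_mono power_mono norm_fourier_L1_le f) auto
        finally show "norm ((cmod (X n \<xi>))\<^sup>2) \<le> norm (?C\<^sup>2 * exp (- a n * (norm \<xi>)\<^sup>2))"
          by (simp add: mult.commute)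
      qed
    qed simp
    then show "X n \<in> L2" by (simp add: L2_def)
    have "complex_of_real ((l2_norm (X n))\<^sup>2) =
        (\<integral>x. (\<integral>y. f x * cnj (f y) * of_real (gauss_dual (a n) (x - y)) \<partial>lborel) \<partial>lborel)"
      unfolding gaussian_mean_fourier_square[OF a f(1), symmetric] X2[symmetric] l2_norm_square
      by (rule integral_complex_of_real[symmetric])
    then have "(l2_norm (X n))\<^sup>2 \<le> (l2_norm f)\<^sup>2"
      using gauss_dual_form_le[OF a f(2), of n] by (metis norm_of_real abs_ge_self order_trans)
    then show "l2_norm (X n) \<le> l2_norm f" by (simp add: abs_le_square_iff[symmetric])
  qed
  have lim: "AE \<xi> in lborel. (\<lambda>n. X n \<xi>) \<longlonglongrightarrow> ?F \<xi>"
  proof (rule AE_I2)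
    fix \<xi> :: "real^'n"
    have "a \<longlonglongrightarrow> 0" unfolding a_def by (rule LIMSEQ_Suc[OF lim_1_over_n])
    then have "(\<lambda>n. of_real (exp (- (a n / 2) * (norm \<xi>)\<^sup>2)) * ?F \<xi>) \<longlonglongrightarrow> of_real (exp (- (0 / 2) * (norm \<xi>)\<^sup>2)) * ?F \<xi>"
      by (intro tendsto_intros) auto
    then show "(\<lambda>n. X n \<xi>) \<longlonglongrightarrow> ?F \<xi>" by (simp add: X_def)
  qed
  show "fourier_L1 f \<in> L2" "l2_norm (fourier_L1 f) \<le> l2_norm f"
    by (rule L2_Fatou[OF X _ lim], measurable)+
qed

lemma fourier_L1_diff:
  "integrable lborel u \<Longrightarrow> integrable lborel v \<Longrightarrow>
   fourier_L1 (\<lambda>x. u x - v x) \<xi> = fourier_L1 u \<xi> - fourier_L1 v \<xi>"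
  unfolding fourier_L1_def right_diff_distrib
  by (intro Bochner_Integration.integral_diff integrable_fourier)

lemma fourier_L1_add:
  "integrable lborel u \<Longrightarrow> integrable lborel v \<Longrightarrow>
   fourier_L1 (\<lambda>x. u x + v x) \<xi> = fourier_L1 u \<xi> + fourier_L1 v \<xi>"
  unfolding fourier_L1_def distrib_left
  by (intro Bochner_Integration.integral_add integrable_fourier)

lemma fourier_L1_mult: "fourier_L1 (\<lambda>x. c * u x) \<xi> = c * fourier_L1 u \<xi>"
  unfolding fourier_L1_def by (simp add: mult.left_commute)

lemma fourier_L1_sum:
  assumes "\<And>i. i \<in> F \<Longrightarrow> integrable lborel (f i)"
  shows "fourier_L1 (\<lambda>x. \<Sum>i\<in>F. c i * f i x) \<xi> = (\<Sum>i\<in>F. c i * fourier_L1 (f i) \<xi>)"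
  using assms
proof (induction F rule: infinite_finite_induct)
  case (insert i F)
  have "integrable lborel (\<lambda>x. \<Sum>i\<in>F. c i * f i x)"
    using insert by (intro Bochner_Integration.integrable_sum integrable_mult_right) auto
  with insert show ?case
    using fourier_L1_add[of "\<lambda>x. c i * f i x" "\<lambda>x. \<Sum>i\<in>F. c i * f i x" \<xi>]
    by (simp add: fourier_L1_mult)
qed (simp_all add: fourier_L1_def)

lemma l2_norm_fourier_diff_le:
  assumes "u \<in> L2" "v \<in> L2" "integrable lborel u" "integrable lborel v"
  shows "l2_dist (fourier_L1 u) (fourier_L1 v) \<le> l2_dist u v"
proof -
  have "(\<lambda>\<xi>. fourier_L1 u \<xi> - fourier_L1 v \<xi>) = fourier_L1 (\<lambda>x. u x - v x)"
    using assms by (simp add: fourier_L1_diff fun_eq_iff)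
  then show ?thesis using fourier_L1_L2(2)[of "\<lambda>x. u x - v x"] assms by (simp add: L2_diff)
qed

text \<open>
  \<^const>\<open>fourier_L2\<close> is a limit along some approximating sequence. By the norm inequality the limit
  exists, and it is the same along every approximating sequence.
\<close>

lemma fourier_L2_limit:
  assumes X: "\<And>n. X n \<in> L2" "\<And>n. integrable lborel (X n)" and u: "l2_tendsto X u sequentially"
  shows "l2_tendsto (\<lambda>n. fourier_L1 (X n)) (fourier_L2 u) sequentially"
proof -
  have uL: "u \<in> L2" and lim: "(\<lambda>n. l2_dist (X n) u) \<longlonglongrightarrow> 0"
    using u by (auto simp: l2_tendsto_def)
  have "\<exists>v. l2_tendsto (\<lambda>n. fourier_L1 (X n)) v sequentially"
  proof (rule L2_complete)
    fix e :: real assume "e > 0"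
    then obtain N where N: "\<And>n. n \<ge> N \<Longrightarrow> l2_dist (X n) u < e/2"
      using LIMSEQ_D[OF lim, of "e/2"] by auto
    have "l2_dist (fourier_L1 (X m)) (fourier_L1 (X n)) < e" if "m \<ge> N" "n \<ge> N" for m n
    proof -
      have "l2_dist (fourier_L1 (X m)) (fourier_L1 (X n)) \<le> l2_dist (X m) (X n)"
        by (intro l2_norm_fourier_diff_le X)
      also have "\<dots> \<le> l2_dist (X m) u + l2_dist u (X n)"
        by (intro l2_norm_triangle3 X uL)
      also have "\<dots> < e" using N[OF that(1)] N[OF that(2)] by (simp add: l2_norm_minus_commute[of u])
      finally show ?thesis .
    qed
    then show "\<exists>N. \<forall>m\<ge>N. \<forall>n\<ge>N. l2_dist (fourier_L1 (X m)) (fourier_L1 (X n)) < e" by blast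
  qed (intro fourier_L1_L2 X)
  then have "\<exists>v. \<exists>X. (\<forall>n. X n \<in> L2 \<and> integrable lborel (X n)) \<and>
     l2_tendsto X u sequentially \<and> l2_tendsto (\<lambda>n. fourier_L1 (X n)) v sequentially"
    using X u by blast
  then have "\<exists>X. (\<forall>n. X n \<in> L2 \<and> integrable lborel (X n)) \<and>
     l2_tendsto X u sequentially \<and> l2_tendsto (\<lambda>n. fourier_L1 (X n)) (fourier_L2 u) sequentially"
    unfolding fourier_L2_def by (rule someI_ex)
  then obtain Y where Y: "\<And>n. Y n \<in> L2" "\<And>n. integrable lborel (Y n)"
    "l2_tendsto Y u sequentially" "l2_tendsto (\<lambda>n. fourier_L1 (Y n)) (fourier_L2 u) sequentially"
    by blast
  have v: "fourier_L2 u \<in> L2" using Y(4) by (simp add: l2_tendsto_def)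
  have "(\<lambda>n. l2_dist (fourier_L1 (X n)) (fourier_L2 u)) \<longlonglongrightarrow> 0"
  proof (rule tendsto_sandwich[OF _ _ tendsto_const])
    let ?h = "\<lambda>n. (l2_dist (X n) u + l2_dist (Y n) u) + l2_dist (fourier_L1 (Y n)) (fourier_L2 u)"
    have "?h \<longlonglongrightarrow> (0 + 0) + 0"
      using u Y(3,4) by (intro tendsto_add) (auto simp: l2_tendsto_def)
    then show "?h \<longlonglongrightarrow> 0" by simp
    show "\<forall>\<^sub>F n in sequentially. l2_dist (fourier_L1 (X n)) (fourier_L2 u) \<le> ?h n"
    proof (intro always_eventually allI)
      fix n
      have "l2_dist (fourier_L1 (X n)) (fourier_L2 u) \<le>
          l2_dist (fourier_L1 (X n)) (fourier_L1 (Y n)) + l2_dist (fourier_L1 (Y n)) (fourier_L2 u)"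
        by (intro l2_norm_triangle3 fourier_L1_L2 X Y v)
      moreover have "l2_dist (fourier_L1 (X n)) (fourier_L1 (Y n)) \<le> l2_dist (X n) (Y n)"
        by (intro l2_norm_fourier_diff_le X Y)
      moreover have "l2_dist (X n) (Y n) \<le> l2_dist (X n) u + l2_dist u (Y n)"
        by (intro l2_norm_triangle3 X Y uL)
      ultimately show "l2_dist (fourier_L1 (X n)) (fourier_L2 u) \<le> ?h n"
        by (simp add: l2_norm_minus_commute[of u])
    qed
  qed simp
  then show ?thesis using v X by (auto simp: l2_tendsto_def fourier_L1_L2)
qed

section \<open>Functions of bounded Sobolev norm\<close>

text \<open>
  The weight \<open>(1 + 4\<pi>\<^sup>2|\<xi>|\<^sup>2)\<^sup>s\<^sup>/\<^sup>2\<close> of the Sobolev space of order \<open>s\<close>, and the weighted Fourier transform of an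
  integrable function.
\<close>

definition sobolev_weight :: "real \<Rightarrow> real^'n \<Rightarrow> real" where
  "sobolev_weight s \<xi> = (1 + 4 * pi\<^sup>2 * (norm \<xi>)\<^sup>2) powr (s / 2)"

abbreviation weighted_fourier :: "real \<Rightarrow> (real^'n \<Rightarrow> complex) \<Rightarrow> real^'n \<Rightarrow> complex" where
  "weighted_fourier s X \<equiv> (\<lambda>\<xi>. of_real (sobolev_weight s \<xi>) * fourier_L1 X \<xi>)"

text \<open>
  \<open>u\<close> is a limit in \<open>L\<^sub>2\<close> of integrable functions whose Sobolev norm of order \<open>s\<close> is at most \<open>M\<close>. This
  implies that \<open>u\<close> has Sobolev norm at most \<open>M\<close>, but refers only to Fourier integrals, which unlike
  \<^const>\<open>fourier_L2\<close> are linear and well-defined pointwise.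
\<close>

definition sobolev_bounded :: "real \<Rightarrow> real \<Rightarrow> (real^'n \<Rightarrow> complex) \<Rightarrow> bool" where
  "sobolev_bounded s M u \<longleftrightarrow> u \<in> L2 \<and> (\<forall>e>0. \<exists>X\<in>L2. integrable lborel X \<and>
     l2_dist X u < e \<and>
     weighted_fourier s X \<in> L2 \<and>
     l2_norm (weighted_fourier s X) \<le> M)"

lemma sobolev_boundedD:
  assumes "sobolev_bounded s M u" "e > 0"
  obtains X where "X \<in> L2" "integrable lborel X" "l2_dist X u < e"
    "weighted_fourier s X \<in> L2"
    "l2_norm (weighted_fourier s X) \<le> M"
  using assms unfolding sobolev_bounded_def by blast

lemma sobolev_bounded_L2: "sobolev_bounded s M u \<Longrightarrow> u \<in> L2"
  by (simp add: sobolev_bounded_def)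

lemma sobolev_bounded_mono: "sobolev_bounded s M u \<Longrightarrow> M \<le> M' \<Longrightarrow> sobolev_bounded s M' u"
  unfolding sobolev_bounded_def by (meson order_trans)

lemma sobolev_bounded_closed:
  assumes "u \<in> L2" "\<And>e. e > 0 \<Longrightarrow> \<exists>v. sobolev_bounded s M v \<and> l2_dist v u < e"
  shows "sobolev_bounded s M u"
  unfolding sobolev_bounded_def
proof (intro conjI allI impI)
  fix e :: real assume "e > 0"
  then obtain v where v: "sobolev_bounded s M v" "l2_dist v u < e/2"
    using assms(2)[of "e/2"] by auto
  have e2: "e/2 > 0" using \<open>e > 0\<close> by simp
  obtain X where X: "X \<in> L2" "integrable lborel X" "l2_dist X v < e/2"
    "weighted_fourier s X \<in> L2"
    "l2_norm (weighted_fourier s X) \<le> M"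
    by (rule sobolev_boundedD[OF v(1) e2])
  have "l2_dist X u < e"
    using l2_norm_triangle3[OF X(1) sobolev_bounded_L2[OF v(1)] assms(1)] X(3) v(2) by simp
  with X show "\<exists>X\<in>L2. integrable lborel X \<and> l2_dist X u < e \<and>
     weighted_fourier s X \<in> L2 \<and>
     l2_norm (weighted_fourier s X) \<le> M" by blast
qed (fact assms(1))

lemma sobolev_bounded_add:
  assumes u: "sobolev_bounded s M u" and v: "sobolev_bounded s M' v"
  shows "sobolev_bounded s (M + M') (\<lambda>x. u x + v x)"
  unfolding sobolev_bounded_def
proof (intro conjI allI impI)
  show "(\<lambda>x. u x + v x) \<in> L2" using u v by (intro L2_add sobolev_bounded_L2)
  fix e :: real assume "e > 0"
  then have e2: "e/2 > 0" by simp
  let ?w = "\<lambda>\<xi>. complex_of_real (sobolev_weight s \<xi>)"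
  obtain X where X: "X \<in> L2" "integrable lborel X" "l2_dist X u < e/2"
    "(\<lambda>\<xi>. ?w \<xi> * fourier_L1 X \<xi>) \<in> L2" "l2_norm (\<lambda>\<xi>. ?w \<xi> * fourier_L1 X \<xi>) \<le> M"
    by (rule sobolev_boundedD[OF u e2])
  obtain Y where Y: "Y \<in> L2" "integrable lborel Y" "l2_dist Y v < e/2"
    "(\<lambda>\<xi>. ?w \<xi> * fourier_L1 Y \<xi>) \<in> L2" "l2_norm (\<lambda>\<xi>. ?w \<xi> * fourier_L1 Y \<xi>) \<le> M'"
    by (rule sobolev_boundedD[OF v e2])
  have sum: "(\<lambda>\<xi>. ?w \<xi> * fourier_L1 (\<lambda>x. X x + Y x) \<xi>) = (\<lambda>\<xi>. ?w \<xi> * fourier_L1 X \<xi> + ?w \<xi> * fourier_L1 Y \<xi>)"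
    using X(2) Y(2) by (simp add: fourier_L1_add distrib_left)
  have "l2_norm (\<lambda>x. (X x + Y x) - (u x + v x)) \<le> l2_dist X u + l2_dist Y v"
    using l2_norm_triangle[of "\<lambda>x. X x - u x" "\<lambda>x. Y x - v x"] X(1) Y(1) u v
    by (simp add: L2_diff sobolev_bounded_L2 algebra_simps)
  then have "l2_norm (\<lambda>x. (X x + Y x) - (u x + v x)) < e" using X(3) Y(3) by simp
  moreover have "l2_norm (\<lambda>\<xi>. ?w \<xi> * fourier_L1 (\<lambda>x. X x + Y x) \<xi>) \<le> M + M'"
    unfolding sum using l2_norm_triangle[OF X(4) Y(4)] X(5) Y(5) by simp
  moreover have "(\<lambda>\<xi>. ?w \<xi> * fourier_L1 (\<lambda>x. X x + Y x) \<xi>) \<in> L2"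
    unfolding sum by (rule L2_add[OF X(4) Y(4)])
  ultimately show "\<exists>X\<in>L2. integrable lborel X \<and> l2_norm (\<lambda>x. X x - (u x + v x)) < e \<and>
     (\<lambda>\<xi>. ?w \<xi> * fourier_L1 X \<xi>) \<in> L2 \<and> l2_norm (\<lambda>\<xi>. ?w \<xi> * fourier_L1 X \<xi>) \<le> M + M'"
    using X(1,2) Y(1,2) by (intro bexI[of _ "\<lambda>x. X x + Y x"]) (auto intro: L2_add)
qed

lemma sobolev_bounded_zero: "sobolev_bounded s 0 (\<lambda>x. 0)"
  unfolding sobolev_bounded_def by (auto intro!: bexI[of _ "\<lambda>x. 0"] simp: L2_zero fourier_L1_def)

lemma sobolev_bounded_sum:
  assumes "finite F" "\<And>i. i \<in> F \<Longrightarrow> sobolev_bounded s (M i) (f i)"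
  shows "sobolev_bounded s (\<Sum>i\<in>F. M i) (\<lambda>x. \<Sum>i\<in>F. f i x)"
  using assms
  by (induction F rule: finite_induct) (simp_all add: sobolev_bounded_zero sobolev_bounded_add)

text \<open>
  The weight is unbounded. It is first truncated to balls \<open>|\<xi>| \<le> R\<close>, where the bound \<open>M\<close> passes to the limit
  function; then \<open>R\<close> tends to infinity.
\<close>

lemma sobolev_bounded_imp_sobolev:
  fixes u :: "real^'n \<Rightarrow> complex"
  assumes "sobolev_bounded s M u" "0 \<le> s"
  shows "u \<in> sobolev s"
proof -
  let ?w = "\<lambda>\<xi>. complex_of_real (sobolev_weight s \<xi>)"
  have u: "u \<in> L2" using assms(1) by (rule sobolev_bounded_L2)
  have "\<exists>X. X \<in> L2 \<and> integrable lborel X \<and> l2_dist X u < 1 / real (Suc n) \<and>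
    (\<lambda>\<xi>. ?w \<xi> * fourier_L1 X \<xi>) \<in> L2 \<and> l2_norm (\<lambda>\<xi>. ?w \<xi> * fourier_L1 X \<xi>) \<le> M" for n
    by (rule sobolev_boundedD[OF assms(1), of "1 / real (Suc n)"]) auto
  from choice[OF allI, OF this] obtain X where X': "\<forall>n. X n \<in> L2 \<and> integrable lborel (X n) \<and>
    l2_dist (X n) u < 1 / real (Suc n) \<and>
    (\<lambda>\<xi>. ?w \<xi> * fourier_L1 (X n) \<xi>) \<in> L2 \<and> l2_norm (\<lambda>\<xi>. ?w \<xi> * fourier_L1 (X n) \<xi>) \<le> M" ..
  have X: "X n \<in> L2" "integrable lborel (X n)" "l2_dist (X n) u < 1 / real (Suc n)"
    "(\<lambda>\<xi>. ?w \<xi> * fourier_L1 (X n) \<xi>) \<in> L2" "l2_norm (\<lambda>\<xi>. ?w \<xi> * fourier_L1 (X n) \<xi>) \<le> M" for n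
    using X'[rule_format, of n] by (blast, blast, blast, blast, blast)
  have "(\<lambda>n. l2_dist (X n) u) \<longlonglongrightarrow> 0"
    by (rule tendsto_sandwich[OF _ _ tendsto_const LIMSEQ_Suc[OF lim_1_over_n]])
       (use X(3) in \<open>auto intro!: always_eventually less_imp_le simp del: of_nat_Suc\<close>)
  then have "l2_tendsto X u sequentially" using X(1) u by (simp add: l2_tendsto_def)
  then have "l2_tendsto (\<lambda>n. fourier_L1 (X n)) (fourier_L2 u) sequentially"
    by (intro fourier_L2_limit X)
  then have v: "fourier_L2 u \<in> L2" and lim: "(\<lambda>n. l2_dist (fourier_L1 (X n)) (fourier_L2 u)) \<longlonglongrightarrow> 0"
    by (auto simp: l2_tendsto_def)
  note [measurable] = L2_measurable[OF v]
  have [measurable]: "(sobolev_weight s :: real^'n \<Rightarrow> real) \<in> borel_measurable borel"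
    unfolding sobolev_weight_def by measurable
  have [measurable]: "(cball 0 r :: (real^'n) set) \<in> sets borel" for r
    by (intro borel_closed closed_cball)
  define Z where "Z R = (\<lambda>(g :: real^'n \<Rightarrow> complex) \<xi>. (indicator (cball 0 (real R)) \<xi> * ?w \<xi>) * g \<xi> :: complex)" for R
  let ?B = "\<lambda>R::nat. (1 + 4 * pi\<^sup>2 * (real R)\<^sup>2) powr (s / 2)"
  have weight_bound: "cmod (indicator (cball 0 (real R)) \<xi> * ?w \<xi>) \<le> ?B R" for R and \<xi> :: "real^'n"
  proof (cases "norm \<xi> \<le> real R")
    case True
    then have "sobolev_weight s \<xi> \<le> ?B R"
      unfolding sobolev_weight_def using assms(2)
      by (intro powr_mono2 add_left_mono mult_left_mono power_mono) auto
    with True show ?thesis by (simp add: sobolev_weight_def)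
  qed simp
  have bounded: "Z R g \<in> L2 \<and> l2_norm (Z R g) \<le> ?B R * l2_norm g" if g: "g \<in> L2" for R g
  proof -
    note [measurable] = L2_measurable[OF g]
    have [measurable]: "Z R g \<in> borel_measurable borel" unfolding Z_def by measurable
    have "(\<integral>\<^sup>+\<xi>. ennreal ((cmod (Z R g \<xi>))\<^sup>2) \<partial>lborel) \<le> (\<integral>\<^sup>+\<xi>. ennreal ((?B R)\<^sup>2 * (cmod (g \<xi>))\<^sup>2) \<partial>lborel)"
    proof (intro nn_integral_mono ennreal_leI)
      fix \<xi>
      have "cmod (Z R g \<xi>) \<le> ?B R * cmod (g \<xi>)"
        unfolding Z_def norm_mult[of "_ * _"] by (intro mult_right_mono weight_bound) simp
      then have "(cmod (Z R g \<xi>))\<^sup>2 \<le> (?B R * cmod (g \<xi>))\<^sup>2" by (rule power_mono) simp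
      then show "(cmod (Z R g \<xi>))\<^sup>2 \<le> (?B R)\<^sup>2 * (cmod (g \<xi>))\<^sup>2" unfolding power_mult_distrib .
    qed
    also have "\<dots> = ennreal ((?B R * l2_norm g)\<^sup>2)"
      by (simp add: ennreal_mult nn_integral_cmult l2_norm_nn_integral[OF g] power_mult_distrib)
    finally show ?thesis using L2_nn_integralI[of "Z R g" "?B R * l2_norm g"] by simp
  qed
  have ZM: "l2_norm (Z R (fourier_L2 u)) \<le> M" for R
  proof (rule LIMSEQ_le_const)
    show "(\<lambda>n. M + ?B R * l2_dist (fourier_L1 (X n)) (fourier_L2 u)) \<longlonglongrightarrow> M"
      using tendsto_add[OF tendsto_const tendsto_mult_right_zero[OF lim]] by simp
    have "l2_norm (Z R (fourier_L2 u)) \<le> M + ?B R * l2_dist (fourier_L1 (X n)) (fourier_L2 u)" for n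
    proof -
      have F: "fourier_L1 (X n) \<in> L2" by (intro fourier_L1_L2 X)
      note [measurable] = L2_measurable[OF F]
      have Z1: "l2_norm (Z R (fourier_L1 (X n))) \<le> M"
      proof -
        have "(l2_norm (Z R (fourier_L1 (X n))))\<^sup>2 \<le> (l2_norm (\<lambda>\<xi>. ?w \<xi> * fourier_L1 (X n) \<xi>))\<^sup>2"
          unfolding l2_norm_square
          by (intro integral_mono L2_integrable_square X(4) conjunct1[OF bounded] F)
             (auto simp: Z_def indicator_def)
        then show ?thesis using X(5)[of n] by (simp add: abs_le_square_iff[symmetric])
      qed
      have "Z R (\<lambda>\<xi>. fourier_L1 (X n) \<xi> - fourier_L2 u \<xi>) = (\<lambda>\<xi>. Z R (fourier_L1 (X n)) \<xi> - Z R (fourier_L2 u) \<xi>)"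
        by (simp add: Z_def right_diff_distrib)
      then have "l2_norm (\<lambda>\<xi>. Z R (fourier_L2 u) \<xi> - Z R (fourier_L1 (X n)) \<xi>) \<le>
          ?B R * l2_dist (fourier_L1 (X n)) (fourier_L2 u)"
        using bounded[OF L2_diff[OF F v], of R] by (simp add: l2_norm_minus_commute)
      with Z1 l2_norm_le_add_diff[of "Z R (fourier_L2 u)" "Z R (fourier_L1 (X n))"] bounded[OF v] bounded[OF F]
      show ?thesis by force
    qed
    then show "\<exists>N. \<forall>n\<ge>N. l2_norm (Z R (fourier_L2 u)) \<le> M + ?B R * l2_dist (fourier_L1 (X n)) (fourier_L2 u)"
      by blast
  qed
  have "(\<lambda>\<xi>. ?w \<xi> * fourier_L2 u \<xi>) \<in> L2"
  proof (rule L2_Fatou)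
    show "Z R (fourier_L2 u) \<in> L2" for R using bounded[OF v] by blast
    show "l2_norm (Z R (fourier_L2 u)) \<le> M" for R by (rule ZM)
    show "AE \<xi> in lborel. (\<lambda>R. Z R (fourier_L2 u) \<xi>) \<longlonglongrightarrow> ?w \<xi> * fourier_L2 u \<xi>"
    proof (rule AE_I2)
      fix \<xi> :: "real^'n"
      obtain N where N: "norm \<xi> \<le> real N" using real_arch_simple by blast
      have "Z n (fourier_L2 u) \<xi> = ?w \<xi> * fourier_L2 u \<xi>" if "n \<ge> N" for n
        using N that by (simp add: Z_def)
      then show "(\<lambda>R. Z R (fourier_L2 u) \<xi>) \<longlonglongrightarrow> ?w \<xi> * fourier_L2 u \<xi>"
        by (intro tendsto_eventually eventually_sequentiallyI)
    qed
  qed measurable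
  then show ?thesis using u by (simp add: sobolev_def sobolev_weight_def)
qed

section \<open>Smooth functions of one variable\<close>

text \<open>
  The function \<open>p(1/t) e\<^sup>-\<^sup>1\<^sup>/\<^sup>t\<close>, continued by zero to \<open>t \<le> 0\<close>. Functions of this form are closed under
  differentiation.
\<close>

definition flat_exp :: "real poly \<Rightarrow> real \<Rightarrow> real" where
  "flat_exp p t = (if t > 0 then poly p (1 / t) * exp (- (1 / t)) else 0)"

lemma poly_times_exp_tendsto_0: "((\<lambda>x. poly p x * exp (- x)) \<longlongrightarrow> (0::real)) at_top"
proof -
  have "((\<lambda>x. \<Sum>i\<le>degree p. coeff p i * (x ^ i / exp x)) \<longlongrightarrow> (\<Sum>i\<le>degree p. coeff p i * 0)) at_top"
    by (intro tendsto_intros tendsto_power_div_exp_0)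
  then show ?thesis
    by (simp add: poly_altdef sum_distrib_right exp_minus divide_inverse mult.assoc)
qed

lemma flat_has_derivative:
  "(flat_exp p has_real_derivative flat_exp ([:0, 0, 1:] * (p - pderiv p)) t) (at t)"
proof -
  consider "t > 0" | "t < 0" | "t = 0" by linarith
  then show ?thesis
  proof cases
    case 1
    have "((\<lambda>t. poly p (1 / t) * exp (- (1 / t))) has_real_derivative
        flat_exp ([:0, 0, 1:] * (p - pderiv p)) t) (at t)"
      using 1 by (auto intro!: derivative_eq_intros simp: flat_exp_def field_simps power2_eq_square)
    moreover have "\<forall>\<^sub>F x in nhds t. flat_exp p x = poly p (1 / x) * exp (- (1 / x))"
      using 1 by (intro eventually_mono[OF eventually_nhds_in_open[of "{0<..}" t]]) (auto simp: flat_exp_def)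
    ultimately show ?thesis by (subst DERIV_cong_ev[OF refl _ refl])
  next
    case 2
    have "((\<lambda>t. 0) has_real_derivative flat_exp ([:0, 0, 1:] * (p - pderiv p)) t) (at t)"
      using 2 by (simp add: flat_exp_def)
    moreover have "\<forall>\<^sub>F x in nhds t. flat_exp p x = 0"
      using 2 by (intro eventually_mono[OF eventually_nhds_in_open[of "{..<0}" t]]) (auto simp: flat_exp_def)
    ultimately show ?thesis by (subst DERIV_cong_ev[OF refl _ refl])
  next
    case 3
    have "((\<lambda>h. flat_exp p h / h) \<longlongrightarrow> 0) (at 0)"
      unfolding filterlim_at_split
    proof
      have "\<forall>\<^sub>F h in at_left 0. 0 = flat_exp p h / h"
        using eventually_at_left_real[of "-1" 0] by (auto elim!: eventually_mono simp: flat_exp_def)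
      then show "((\<lambda>h. flat_exp p h / h) \<longlongrightarrow> 0) (at_left 0)" by (rule Lim_transform_eventually[OF tendsto_const])
      have "((\<lambda>h. poly ([:0, 1:] * p) (inverse h) * exp (- inverse h)) \<longlongrightarrow> 0) (at_right 0)"
        by (rule filterlim_compose[OF poly_times_exp_tendsto_0 filterlim_inverse_at_top_right])
      moreover have "\<forall>\<^sub>F h in at_right 0. poly ([:0, 1:] * p) (inverse h) * exp (- inverse h) = flat_exp p h / h"
        using eventually_at_right_real[of 0 1] by (auto elim!: eventually_mono simp: flat_exp_def field_simps)
      ultimately show "((\<lambda>h. flat_exp p h / h) \<longlongrightarrow> 0) (at_right 0)"
        by (rule Lim_transform_eventually)
    qed
    then show ?thesis unfolding 3 has_field_derivative_iff by (simp add: flat_exp_def)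
  qed
qed

lemma flat_1: "flat_exp 1 t \<in> {0..1}"
  by (auto simp: flat_exp_def)

text \<open>
  \<open>D\<close> is the sequence of all derivatives of the smooth function \<open>D 0\<close>.
\<close>

definition derivative_seq :: "(nat \<Rightarrow> real \<Rightarrow> complex) \<Rightarrow> bool" where
  "derivative_seq D \<longleftrightarrow> (\<forall>n t. (D n has_vector_derivative D (Suc n) t) (at t))"

text \<open>
  \<open>leibniz_seq D E n k l\<close> is the \<open>n\<close>-th derivative of the product of \<open>D k\<close> and \<open>E l\<close>, obtained by iterating the
  product rule without collecting equal terms.
\<close>

primrec leibniz_seq :: "(nat \<Rightarrow> real \<Rightarrow> complex) \<Rightarrow> (nat \<Rightarrow> real \<Rightarrow> complex) \<Rightarrow>
    nat \<Rightarrow> nat \<Rightarrow> nat \<Rightarrow> real \<Rightarrow> complex" where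
  "leibniz_seq D E 0 k l = (\<lambda>t. D k t * E l t)"
| "leibniz_seq D E (Suc n) k l = (\<lambda>t. leibniz_seq D E n (Suc k) l t + leibniz_seq D E n k (Suc l) t)"

abbreviation product_seq :: "(nat \<Rightarrow> real \<Rightarrow> complex) \<Rightarrow> (nat \<Rightarrow> real \<Rightarrow> complex) \<Rightarrow> nat \<Rightarrow> real \<Rightarrow> complex" where
  "product_seq D E n \<equiv> leibniz_seq D E n 0 0"

lemma derivative_seq_product:
  assumes "derivative_seq D" "derivative_seq E"
  shows "derivative_seq (product_seq D E)"
proof -
  have "(leibniz_seq D E n k l has_vector_derivative leibniz_seq D E (Suc n) k l t) (at t)" for n k l t
  proof (induction n arbitrary: k l)
    case 0
    have "((\<lambda>t. D k t * E l t) has_vector_derivative (D k t * E (Suc l) t + D (Suc k) t * E l t)) (at t)"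
      using assms by (intro has_vector_derivative_mult) (auto simp: derivative_seq_def)
    then show ?case by (simp add: add.commute)
  next
    case (Suc n)
    show ?case
      using has_vector_derivative_add[OF Suc.IH[of "Suc k" l] Suc.IH[of k "Suc l"]] by simp
  qed
  then show ?thesis by (simp add: derivative_seq_def)
qed

text \<open>
  The derivatives of \<open>t \<mapsto> D 0 (c t + d)\<close>.
\<close>

definition affine_seq :: "(nat \<Rightarrow> real \<Rightarrow> complex) \<Rightarrow> real \<Rightarrow> real \<Rightarrow> nat \<Rightarrow> real \<Rightarrow> complex" where
  "affine_seq D c d n t = of_real c ^ n * D n (c * t + d)"

lemma derivative_seq_affine:
  assumes "derivative_seq D"
  shows "derivative_seq (affine_seq D c d)"
  unfolding derivative_seq_def
proof (intro allI)
  fix n t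
  have "((\<lambda>t. c * t + d) has_vector_derivative c) (at t)"
    by (auto intro!: derivative_eq_intros simp flip: has_real_derivative_iff_has_vector_derivative)
  moreover have "(D n has_vector_derivative D (Suc n) (c * t + d)) (at (c * t + d))"
    using assms by (simp add: derivative_seq_def)
  ultimately have "(D n \<circ> (\<lambda>t. c * t + d) has_vector_derivative c *\<^sub>R D (Suc n) (c * t + d)) (at t)"
    by (rule vector_diff_chain_at)
  then have "((\<lambda>t. of_real c ^ n * D n (c * t + d)) has_vector_derivative
      of_real c ^ n * (c *\<^sub>R D (Suc n) (c * t + d))) (at t)"
    by (intro has_vector_derivative_mult_right) (simp add: comp_def)
  then show "(affine_seq D c d n has_vector_derivative affine_seq D c d (Suc n) t) (at t)"
    by (simp add: affine_seq_def[abs_def] scaleR_conv_of_real mult_ac)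
qed

text \<open>
  The derivatives of \<open>t \<mapsto> e\<^sup>c\<^sup>t\<close>.
\<close>

definition exp_seq :: "complex \<Rightarrow> nat \<Rightarrow> real \<Rightarrow> complex" where
  "exp_seq c n t = c ^ n * exp (c * of_real t)"

lemma derivative_seq_exp: "derivative_seq (exp_seq c)"
  unfolding derivative_seq_def
proof (intro allI)
  fix n t
  have "((\<lambda>t. exp (t *\<^sub>R c)) has_vector_derivative c * exp (t *\<^sub>R c)) (at t)"
    using exp_scaleR_has_vector_derivative_left[of c t] by simp
  then have "((\<lambda>t. c ^ n * exp (t *\<^sub>R c)) has_vector_derivative c ^ n * (c * exp (t *\<^sub>R c))) (at t)"
    by (rule has_vector_derivative_mult_right)
  then show "(exp_seq c n has_vector_derivative exp_seq c (Suc n) t) (at t)"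
    by (simp add: exp_seq_def[abs_def] scaleR_conv_of_real mult_ac)
qed

text \<open>
  The derivatives of \<open>t \<mapsto> e\<^sup>-\<^sup>1\<^sup>/\<^sup>t\<close>, continued by zero to \<open>t \<le> 0\<close>.
\<close>

definition flat_seq :: "nat \<Rightarrow> real \<Rightarrow> complex" where
  "flat_seq n t = of_real (flat_exp (((\<lambda>p. [:0, 0, 1:] * (p - pderiv p)) ^^ n) 1) t)"

lemma derivative_seq_flat: "derivative_seq flat_seq"
  unfolding derivative_seq_def flat_seq_def[abs_def] funpow.simps(2) comp_apply
  by (intro allI has_vector_derivative_of_real flat_has_derivative)

lemma flat_seq_nonpos: "t \<le> 0 \<Longrightarrow> flat_seq n t = 0"
  by (simp add: flat_seq_def flat_exp_def)

text \<open>
  The derivatives of \<open>t \<mapsto> h(c(t - a)) h(c(b - t))\<close>, where \<open>h(t) = e\<^sup>-\<^sup>1\<^sup>/\<^sup>t\<close> for \<open>t > 0\<close> and \<open>h(t) = 0\<close> otherwise. For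
  \<open>c > 0\<close> this is a bump function supported in \<open>[a, b]\<close> that converges to the indicator function of \<open>(a, b)\<close> as \<open>c\<close> tends to infinity.
\<close>

definition bump_seq :: "real \<Rightarrow> real \<Rightarrow> real \<Rightarrow> nat \<Rightarrow> real \<Rightarrow> complex" where
  "bump_seq c a b = product_seq (affine_seq flat_seq c (- c * a)) (affine_seq flat_seq (- c) (c * b))"

lemma derivative_seq_bump: "derivative_seq (bump_seq c a b)"
  unfolding bump_seq_def by (intro derivative_seq_product derivative_seq_affine derivative_seq_flat)

lemma leibniz_seq_eq_0:
  assumes "(\<forall>k. D k t = 0) \<or> (\<forall>l. E l t = 0)"
  shows "leibniz_seq D E n k l t = 0"
proof (induction n arbitrary: k l)
  case 0
  from assms show ?case by (elim disjE) simp_all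
qed simp

lemma bump_seq_0: "bump_seq c a b 0 t = of_real (flat_exp 1 (c * (t - a)) * flat_exp 1 (c * (b - t)))"
  by (simp add: bump_seq_def affine_seq_def flat_seq_def algebra_simps)

lemma bump_seq_outside:
  assumes "0 \<le> c" "t \<notin> {a<..<b}"
  shows "bump_seq c a b n t = 0"
proof -
  have "c * (t - a) \<le> 0 \<or> c * (b - t) \<le> 0"
    using assms by (auto simp: mult_nonneg_nonpos)
  then have "(\<forall>k. affine_seq flat_seq c (- c * a) k t = 0) \<or> (\<forall>l. affine_seq flat_seq (- c) (c * b) l t = 0)"
    by (auto simp: affine_seq_def flat_seq_nonpos algebra_simps)
  then show ?thesis unfolding bump_seq_def by (intro leibniz_seq_eq_0) auto
qed

lemma derivative_seq_continuous: "derivative_seq D \<Longrightarrow> continuous_on S (D n)"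
  unfolding derivative_seq_def
  by (intro continuous_at_imp_continuous_on ballI has_vector_derivative_continuous) blast

lemma bump_seq_bounded: "\<exists>B. \<forall>t. cmod (bump_seq 1 a b n t) \<le> B"
proof -
  have "compact (bump_seq 1 a b n ` {a..b})"
    by (intro compact_continuous_image derivative_seq_continuous derivative_seq_bump) simp
  then have "bounded (bump_seq 1 a b n ` {a..b})" by (rule compact_imp_bounded)
  then obtain B where B: "\<forall>y\<in>bump_seq 1 a b n ` {a..b}. cmod y \<le> B"
    unfolding bounded_iff ..
  have "cmod (bump_seq 1 a b n t) \<le> max B 0" for t
  proof (cases "t \<in> {a..b}")
    case True
    then have "cmod (bump_seq 1 a b n t) \<le> B" using B by blast
    then show ?thesis by linarith
  next
    case False
    then have "bump_seq 1 a b n t = 0" by (intro bump_seq_outside) auto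
    then show ?thesis by simp
  qed
  then show ?thesis by blast
qed

section \<open>Tensor products as test functions\<close>

text \<open>
  The product of the derivatives of order \<open>m i\<close> of the functions \<open>D i 0\<close> in the coordinates \<open>x\<^sub>i\<close>; this is
  the mixed derivative with multi-index \<open>m\<close> of the tensor product of the functions \<open>D i 0\<close>.
\<close>

definition tensor :: "('n::finite \<Rightarrow> nat \<Rightarrow> real \<Rightarrow> complex) \<Rightarrow> ('n \<Rightarrow> nat) \<Rightarrow> real^'n \<Rightarrow> complex" where
  "tensor D m x = (\<Prod>i\<in>UNIV. D i (m i) (x $ i))"

lemma tensor_has_derivative:
  assumes "\<And>i. derivative_seq (D i)"
  shows "(tensor D m has_derivative
    (\<lambda>y. \<Sum>i\<in>UNIV. (y $ i) *\<^sub>R D i (Suc (m i)) (x $ i) * (\<Prod>j\<in>UNIV - {i}. D j (m j) (x $ j)))) (at x)"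
  unfolding tensor_def[abs_def]
proof (rule has_derivative_prod)
  fix i
  have "(D i (m i) has_derivative (\<lambda>y. y *\<^sub>R D i (Suc (m i)) (x $ i))) (at (x $ i))"
    using assms[of i] by (simp add: derivative_seq_def has_vector_derivative_def)
  moreover have "((\<lambda>x. x $ i) has_derivative (\<lambda>y. y $ i)) (at x)"
    by (rule bounded_linear.has_derivative[OF bounded_linear_vec_nth has_derivative_ident])
  ultimately show "((\<lambda>x. D i (m i) (x $ i)) has_derivative (\<lambda>y. (y $ i) *\<^sub>R D i (Suc (m i)) (x $ i))) (at x)"
    by (rule has_derivative_compose[rotated])
qed

lemma partial_tensor:
  assumes "\<And>i. derivative_seq (D i)"
  shows "partial j (tensor D m) = tensor D (m(j := Suc (m j)))"
proof
  fix x
  have "partial j (tensor D m) x =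
    (\<Sum>i\<in>UNIV. (axis j 1 $ i) *\<^sub>R D i (Suc (m i)) (x $ i) * (\<Prod>k\<in>UNIV - {i}. D k (m k) (x $ k)))"
    unfolding partial_def frechet_derivative_at[OF tensor_has_derivative[OF assms], symmetric] ..
  also have "\<dots> = (\<Sum>i\<in>UNIV. if i = j then D j (Suc (m j)) (x $ j) * (\<Prod>k\<in>UNIV - {j}. D k (m k) (x $ k)) else 0)"
    by (intro sum.cong) (auto simp: axis_def)
  also have "\<dots> = D j (Suc (m j)) (x $ j) * (\<Prod>k\<in>UNIV - {j}. D k (m k) (x $ k))" by simp
  also have "\<dots> = tensor D (m(j := Suc (m j))) x"
    unfolding tensor_def by (subst (2) prod.remove[of _ j]) auto
  finally show "partial j (tensor D m) x = tensor D (m(j := Suc (m j))) x" .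
qed

lemma foldr_partial_tensor:
  assumes "\<And>i. derivative_seq (D i)"
  shows "foldr partial is (tensor D m) = tensor D (\<lambda>i. m i + count_list is i)"
proof (induction "is")
  case (Cons a "is")
  have "(\<lambda>i. m i + count_list is i)(a := Suc (m a + count_list is a)) = (\<lambda>i. m i + count_list (a # is) i)"
    by auto
  then show ?case by (simp add: Cons.IH partial_tensor[OF assms])
qed simp

lemma smooth_tensor:
  assumes "\<And>i. derivative_seq (D i)"
  shows "smooth (tensor D m)"
  unfolding smooth_def foldr_partial_tensor[OF assms]
  by (intro allI differentiableI) (rule tensor_has_derivative[OF assms])

lemma test_function_tensor:
  assumes D: "\<And>i. derivative_seq (D i)" and 0: "\<And>i t. t \<notin> {a i..b i} \<Longrightarrow> D i 0 t = 0"
  shows "test_function (tensor D (\<lambda>_. 0))"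
proof -
  have "{x. tensor D (\<lambda>_. 0) x \<noteq> 0} \<subseteq> cbox (\<chi> i. a i) (\<chi> i. b i)"
  proof
    fix x assume "x \<in> {x. tensor D (\<lambda>_. 0) x \<noteq> 0}"
    then have "D i 0 (x $ i) \<noteq> 0" for i by (auto simp: tensor_def)
    then have "x $ i \<in> {a i..b i}" for i using 0 by blast
    then show "x \<in> cbox (\<chi> i. a i) (\<chi> i. b i)" by (simp add: mem_box_cart)
  qed
  then have "bounded {x. tensor D (\<lambda>_. 0) x \<noteq> 0}"
    using bounded_cbox bounded_subset by blast
  then show ?thesis using smooth_tensor[OF D] by (simp add: test_function_def compact_closure)
qed

text \<open>
  The multi-index of the derivative \<open>\<partial>\<^sub>j\<^sup>r\<close>.
\<close>

abbreviation pure_index :: "'n \<Rightarrow> nat \<Rightarrow> 'n \<Rightarrow> nat" where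
  "pure_index j r \<equiv> (\<lambda>i. if i = j then r else 0)"

lemma count_list_replicate: "count_list (replicate n x) y = (if y = x then n else 0)"
  by (induction n) auto

text \<open>
  For tensor products, the derivative does not depend on the order in which \<^const>\<open>mi_deriv\<close> takes the
  partial derivatives.
\<close>

lemma mi_deriv_tensor:
  assumes "\<And>i. derivative_seq (D i)"
  shows "mi_deriv (pure_index j r) (tensor D (\<lambda>_. 0)) = tensor D (pure_index j r)"
proof -
  have "\<forall>i. count_list (SOME is. \<forall>i. count_list is i = pure_index j r i) i = pure_index j r i"
    by (rule someI[of "\<lambda>is. \<forall>i. count_list is i = pure_index j r i" "replicate r j"])
       (simp add: count_list_replicate)
  then show ?thesis
    unfolding mi_deriv_def foldr_partial_tensor[OF assms] by (simp add: fun_eq_iff)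
qed

lemma mi_deriv_0: "mi_deriv (\<lambda>_. 0) f = f"
proof -
  have "\<forall>i. count_list (SOME is. \<forall>i::'a. count_list is i = 0) i = 0"
    by (rule someI[of "\<lambda>is. \<forall>i. count_list is i = 0" "[]"]) simp
  then have "(SOME is. \<forall>i::'a. count_list is i = 0) = []"
    by (cases "SOME is. \<forall>i::'a. count_list is i = 0") (auto split: if_splits)
  then show ?thesis by (simp add: mi_deriv_def)
qed

lemma mi_order_pure: "mi_order (pure_index j r) = r"
  by (simp add: mi_order_def)

section \<open>The fundamental lemma of the calculus of variations\<close>

text \<open>
  Tensor products of bump functions converge boundedly to the indicator function of a box. Thus the
  integral of \<open>h\<close> over every box vanishes, and \<open>h\<close> is almost everywhere the limit of its averages over
  small cubes.
\<close>

lemma fundamental_lemma_variations: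
  fixes h :: "real^'n \<Rightarrow> complex"
  assumes h: "locally_integrable h"
    and zero: "\<And>\<eta>. test_function \<eta> \<Longrightarrow> (\<integral>x. h x * \<eta> x \<partial>lborel) = 0"
  shows "AE x in lborel. h x = 0"
proof -
  have [measurable]: "h \<in> borel_measurable borel" using h by (simp add: locally_integrable_def)
  have cbox: "set_integrable lborel (cbox a b) h" for a b
    using h compact_cbox by (auto simp: locally_integrable_def)
  have box: "set_integrable lborel (box a b) h" for a b
    by (rule set_integrable_subset[OF cbox[of a b]]) (auto simp: box_subset_cbox)
  have int0: "(LINT x:box a b|lborel. h x) = 0" for a b
  proof -
    define \<eta> where "\<eta> n = tensor (\<lambda>i. bump_seq (real n) (a $ i) (b $ i)) (\<lambda>_. 0)" for n
    have test: "test_function (\<eta> n)" for n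
      unfolding \<eta>_def
      by (rule test_function_tensor[where a = "\<lambda>i. a $ i" and b = "\<lambda>i. b $ i"])
         (auto intro: derivative_seq_bump bump_seq_outside)
    have \<eta>: "\<eta> n x = of_real (\<Prod>i\<in>UNIV. flat_exp 1 (real n * (x $ i - a $ i)) * flat_exp 1 (real n * (b $ i - x $ i)))" for n x
      by (simp add: \<eta>_def tensor_def bump_seq_0)
    have [measurable]: "flat_exp 1 \<in> borel_measurable borel"
      by (intro borel_measurable_continuous_onI continuous_at_imp_continuous_on ballI DERIV_isCont)
         (rule flat_has_derivative)
    have lim: "(\<lambda>n. \<eta> n x) \<longlonglongrightarrow> indicator (box a b) x" for x
    proof -
      have flat_lim: "(\<lambda>n. flat_exp 1 (real n * y)) \<longlonglongrightarrow> (if y > 0 then 1 else 0)" for y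
      proof (cases "y > 0")
        case True
        have "(\<lambda>n. exp (- (inverse (real n) * (1 / y)))) \<longlonglongrightarrow> exp (- (0 * (1 / y)))"
          by (intro tendsto_intros lim_inverse_n)
        moreover have "\<forall>\<^sub>F n in sequentially. exp (- (inverse (real n) * (1 / y))) = flat_exp 1 (real n * y)"
          using eventually_gt_at_top[of 0] by eventually_elim (use True in \<open>simp add: flat_exp_def field_simps\<close>)
        ultimately show ?thesis using True by (simp add: Lim_transform_eventually)
      next
        case False
        then have "flat_exp 1 (real n * y) = 0" for n by (simp add: flat_exp_def mult_nonneg_nonpos not_less)
        with False show ?thesis by simp
      qed
      have "(\<lambda>n. \<eta> n x) \<longlonglongrightarrow> of_real (\<Prod>i\<in>UNIV. (if x $ i - a $ i > 0 then 1 else 0) * (if b $ i - x $ i > 0 then 1 else 0))"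
        unfolding \<eta> by (intro tendsto_intros flat_lim)
      also have "(\<Prod>i\<in>UNIV. (if x $ i - a $ i > 0 then 1 else 0) * (if b $ i - x $ i > 0 then 1 else 0)) = (indicator (box a b) x :: real)"
      proof (cases "x \<in> box a b")
        case False
        then obtain i where "\<not> (x $ i - a $ i > 0) \<or> \<not> (b $ i - x $ i > 0)"
          by (auto simp: mem_box_cart)
        then have "\<exists>i\<in>UNIV. (if x $ i - a $ i > 0 then 1 else 0) * (if b $ i - x $ i > 0 then 1 else 0) = (0::real)"
          by (intro bexI[of _ i]) auto
        with False show ?thesis by (subst prod_zero) auto
      qed (simp add: mem_box_cart)
      finally show ?thesis by (cases "x \<in> box a b") auto
    qed
    have "(\<lambda>n. \<integral>x. h x * \<eta> n x \<partial>lborel) \<longlonglongrightarrow> (\<integral>x. h x * indicator (box a b) x \<partial>lborel)"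
    proof (rule integral_dominated_convergence)
      show "integrable lborel (\<lambda>x. norm (indicator (cbox a b) x *\<^sub>R h x))"
        by (rule integrable_norm[OF cbox[of a b, unfolded set_integrable_def]])
      show "AE x in lborel. norm (h x * \<eta> n x) \<le> norm (indicator (cbox a b) x *\<^sub>R h x)" for n
      proof (rule AE_I2)
        fix x
        show "norm (h x * \<eta> n x) \<le> norm (indicator (cbox a b) x *\<^sub>R h x)"
        proof (cases "x \<in> cbox a b")
          case True
          have "\<bar>\<Prod>i\<in>UNIV. flat_exp 1 (real n * (x $ i - a $ i)) * flat_exp 1 (real n * (b $ i - x $ i))\<bar> \<le> 1"
            unfolding abs_prod using flat_1 by (intro prod_le_1) (auto simp: abs_mult intro!: mult_le_one)
          then have "norm (\<eta> n x) \<le> 1" unfolding \<eta> norm_of_real by simp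
          with True show ?thesis by (simp add: norm_mult mult_left_le)
        next
          case False
          then obtain i where "\<not> (a $ i \<le> x $ i \<and> x $ i \<le> b $ i)" by (auto simp: mem_box_cart)
          then have "x $ i \<notin> {a $ i<..<b $ i}" by auto
          then have "bump_seq (real n) (a $ i) (b $ i) 0 (x $ i) = 0" by (intro bump_seq_outside) auto
          then have "\<eta> n x = 0" unfolding \<eta>_def tensor_def by (intro prod_zero) auto
          then show ?thesis by simp
        qed
      qed
      show "AE x in lborel. (\<lambda>n. h x * \<eta> n x) \<longlonglongrightarrow> h x * indicator (box a b) x"
        by (intro AE_I2 tendsto_mult tendsto_const lim)
    qed (simp_all add: \<eta>)
    then have "(\<lambda>n. 0) \<longlonglongrightarrow> (\<integral>x. h x * indicator (box a b) x \<partial>lborel)" by (simp add: zero[OF test])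
    then have "(\<integral>x. h x * indicator (box a b) x \<partial>lborel) = 0" by (simp add: LIMSEQ_const_iff)
    moreover have "(LINT x:box a b|lborel. h x) = (\<integral>x. h x * indicator (box a b) x \<partial>lborel)"
      unfolding set_lebesgue_integral_def by (intro Bochner_Integration.integral_cong) (auto simp: indicator_def)
    ultimately show ?thesis by simp
  qed
  have hk: "h integrable_on cbox a b" "integral (cbox a b) h = 0" for a b
  proof -
    show "h integrable_on cbox a b" by (rule set_borel_integral_eq_integral(1)[OF cbox])
    show "integral (cbox a b) h = 0"
      using set_borel_integral_eq_integral(2)[OF box[of a b]] int0[of a b] by (simp add: integral_open_interval)
  qed
  obtain N where N: "negligible N" "\<And>x e. x \<notin> N \<Longrightarrow> 0 < e \<Longrightarrow>
     \<exists>d>0. \<forall>t. 0 < t \<and> t < d \<longrightarrow> norm (integral (cbox x (x + t *\<^sub>R One)) h /\<^sub>R t ^ DIM(real^'n) - h x) < e"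
    by (rule integrable_ccontinuous_explicit[OF hk(1)]) blast
  have "h x = 0" if x: "x \<notin> N" for x
  proof (rule ccontr)
    assume "h x \<noteq> 0"
    then obtain d where "d > 0" "\<And>t. 0 < t \<Longrightarrow> t < d \<Longrightarrow>
        norm (integral (cbox x (x + t *\<^sub>R One)) h /\<^sub>R t ^ DIM(real^'n) - h x) < norm (h x)"
      using N(2)[OF x, of "norm (h x)"] by auto
    from this(2)[of "d/2"] \<open>d > 0\<close> show False by (simp add: hk)
  qed
  moreover have "AE x in lebesgue. x \<notin> N"
    using N(1) by (simp add: negligible_iff_null_sets AE_not_in)
  ultimately have "AE x in lebesgue. h x = 0" by auto
  then show ?thesis by (simp add: AE_completion_iff)
qed


section \<open>Fourier transforms of weak derivatives\<close>

text \<open>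
  The derivatives of \<open>t \<mapsto> e\<^sup>c\<^sup>t b(t/(n+1))\<close> with a bump function \<open>b\<close> on \<open>[-1, 1]\<close>. For \<open>n\<close> tending to infinity they
  converge to those of \<open>b(0) e\<^sup>c\<^sup>t\<close>, and boundedly so if \<open>c\<close> is imaginary. The constant \<open>b(0)\<close> is not normalised
  because it cancels in the end.
\<close>

definition cutoff_exp_seq :: "complex \<Rightarrow> nat \<Rightarrow> nat \<Rightarrow> real \<Rightarrow> complex" where
  "cutoff_exp_seq c n = product_seq (exp_seq c) (affine_seq (bump_seq 1 (- 1) 1) (1 / real (Suc n)) 0)"

lemma derivative_seq_cutoff_exp: "derivative_seq (cutoff_exp_seq c n)"
  unfolding cutoff_exp_seq_def
  by (intro derivative_seq_product derivative_seq_exp derivative_seq_affine derivative_seq_bump)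

lemma cutoff_exp_seq_outside:
  assumes "t \<notin> {- real (Suc n)..real (Suc n)}"
  shows "cutoff_exp_seq c n k t = 0"
  unfolding cutoff_exp_seq_def
proof (rule leibniz_seq_eq_0)
  have "1 / real (Suc n) * t + 0 \<notin> {- 1<..<1}" using assms by (auto simp: field_simps)
  then have "bump_seq 1 (- 1) 1 l (1 / real (Suc n) * t + 0) = 0" for l
    by (intro bump_seq_outside) auto
  then show "(\<forall>k. exp_seq c k t = 0) \<or> (\<forall>l. affine_seq (bump_seq 1 (- 1) 1) (1 / real (Suc n)) 0 l t = 0)"
    unfolding affine_seq_def by simp
qed

lemma cutoff_exp_seq_bounded:
  assumes "Re c = 0"
  shows "\<exists>M. \<forall>n t. cmod (cutoff_exp_seq c n k t) \<le> M"
proof -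
  let ?L = "\<lambda>n. leibniz_seq (exp_seq c) (affine_seq (bump_seq 1 (- 1) 1) (1 / real (Suc n)) 0)"
  have "\<exists>M. \<forall>n t. cmod (?L n r k l t) \<le> M" for r k l
  proof (induction r arbitrary: k l)
    case 0
    obtain B where B: "\<forall>t. cmod (bump_seq 1 (- 1) 1 l t) \<le> B" using bump_seq_bounded by blast
    have "cmod (?L n 0 k l t) \<le> cmod c ^ k * B" for n t
    proof -
      have "cmod (affine_seq (bump_seq 1 (- 1) 1) (1 / real (Suc n)) 0 l t) \<le> 1 * B"
        unfolding affine_seq_def norm_mult norm_power norm_of_real
        by (intro mult_mono power_le_one B[rule_format]) auto
      moreover have "cmod (exp_seq c k t) = cmod c ^ k"
        using assms by (simp add: exp_seq_def norm_mult norm_power)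
      ultimately show ?thesis by (simp add: norm_mult mult_left_mono)
    qed
    then show ?case by blast
  next
    case (Suc r)
    obtain M1 where M1: "\<forall>n t. cmod (?L n r (Suc k) l t) \<le> M1" using Suc by blast
    obtain M2 where M2: "\<forall>n t. cmod (?L n r k (Suc l) t) \<le> M2" using Suc by blast
    have "cmod (?L n (Suc r) k l t) \<le> M1 + M2" for n t
      unfolding leibniz_seq.simps using M1 M2 by (intro norm_triangle_le add_mono) auto
    then show ?case by blast
  qed
  then show ?thesis by (simp add: cutoff_exp_seq_def)
qed

abbreviation bump_centre :: complex where
  "bump_centre \<equiv> bump_seq 1 (- 1) 1 0 0"

lemma bump_centre_nonzero: "bump_centre \<noteq> 0"
  unfolding bump_seq_0 by (simp add: flat_exp_def)

lemma cutoff_exp_seq_limit: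
  "(\<lambda>n. cutoff_exp_seq c n k t) \<longlonglongrightarrow> c ^ k * exp (c * of_real t) * bump_centre"
proof -
  let ?L = "\<lambda>n. leibniz_seq (exp_seq c) (affine_seq (bump_seq 1 (- 1) 1) (1 / real (Suc n)) 0)"
  have "(\<lambda>n. ?L n r k l t) \<longlonglongrightarrow> c ^ (k + r) * exp (c * of_real t) * (0 ^ l * bump_seq 1 (- 1) 1 l 0)" for r k l
  proof (induction r arbitrary: k l)
    case 0
    have "(\<lambda>n. 1 / real (Suc n)) \<longlonglongrightarrow> 0" by (rule LIMSEQ_Suc[OF lim_1_over_n])
    moreover have "isCont (bump_seq 1 (- 1) 1 l) (0 * t + 0)"
      using derivative_seq_continuous[OF derivative_seq_bump, of UNIV] by (simp add: continuous_on_eq_continuous_at)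
    ultimately have "(\<lambda>n. affine_seq (bump_seq 1 (- 1) 1) (1 / real (Suc n)) 0 l t) \<longlonglongrightarrow> of_real 0 ^ l * bump_seq 1 (- 1) 1 l (0 * t + 0)"
      unfolding affine_seq_def by (intro tendsto_intros isCont_tendsto_compose[of _ "bump_seq 1 (- 1) 1 l"])
    from tendsto_mult_left[OF this, of "exp_seq c k t"] show ?case
      by (simp add: exp_seq_def)
  next
    case (Suc r)
    from tendsto_add[OF Suc.IH[of "Suc k" l] Suc.IH[of k "Suc l"]] show ?case by simp
  qed
  from this[of k 0 0] show ?thesis by (simp add: cutoff_exp_seq_def)
qed

lemma borel_measurable_tensor:
  assumes "\<And>i. derivative_seq (D i)"
  shows "tensor D m \<in> borel_measurable borel"
proof -
  have [measurable]: "D i k \<in> borel_measurable borel" for i k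
    by (intro borel_measurable_continuous_onI derivative_seq_continuous assms)
  show ?thesis unfolding tensor_def[abs_def] by measurable
qed

lemma cutoff_exp_integral_limit:
  fixes f :: "real^'n \<Rightarrow> complex" and \<xi> :: "real^'n"
  defines "c \<equiv> \<lambda>i. - 2 * of_real pi * \<i> * of_real (\<xi> $ i)"
  assumes f: "integrable lborel f"
  shows "(\<lambda>n. \<integral>x. f x * tensor (\<lambda>i. cutoff_exp_seq (c i) n) m x \<partial>lborel) \<longlonglongrightarrow>
    (\<Prod>i\<in>UNIV. c i ^ m i) * bump_centre ^ CARD('n) * fourier_L1 f \<xi>"
proof -
  let ?T = "\<lambda>n. tensor (\<lambda>i. cutoff_exp_seq (c i) n) m"
  let ?C = "(\<Prod>i\<in>UNIV. c i ^ m i) * bump_centre ^ CARD('n)"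
  have lim: "(\<lambda>n. ?T n x) \<longlonglongrightarrow> ?C * fourier_character \<xi> x" for x
  proof -
    have "(\<lambda>n. ?T n x) \<longlonglongrightarrow> (\<Prod>i\<in>UNIV. c i ^ m i * exp (c i * of_real (x $ i)) * bump_centre)"
      unfolding tensor_def by (intro tendsto_prod cutoff_exp_seq_limit)
    also have "(\<Prod>i\<in>UNIV. c i ^ m i * exp (c i * of_real (x $ i)) * bump_centre) =
        (\<Prod>i\<in>UNIV. c i ^ m i) * (\<Prod>i\<in>UNIV. exp (c i * of_real (x $ i))) * bump_centre ^ CARD('n)"
      by (simp add: prod.distrib)
    also have "(\<Prod>i\<in>UNIV. exp (c i * of_real (x $ i))) = fourier_character \<xi> x"
      by (simp add: c_def exp_sum[symmetric] inner_vec_def sum_distrib_left sum_negf mult_ac)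
    finally show ?thesis by (simp add: mult_ac)
  qed
  have "\<exists>M. \<forall>n t. cmod (cutoff_exp_seq (c i) n (m i) t) \<le> M" for i
    by (rule cutoff_exp_seq_bounded) (simp add: c_def)
  from choice[OF allI, OF this] obtain M where M: "\<forall>i n t. cmod (cutoff_exp_seq (c i) n (m i) t) \<le> M i" ..
  have bound: "cmod (?T n x) \<le> (\<Prod>i\<in>UNIV. M i)" for n x
    unfolding tensor_def prod_norm[symmetric] using M by (intro prod_mono) auto
  note [measurable] = borel_measurable_integrable[OF f]
    borel_measurable_tensor[OF derivative_seq_cutoff_exp]
  have "(\<lambda>n. \<integral>x. f x * ?T n x \<partial>lborel) \<longlonglongrightarrow> (\<integral>x. f x * (?C * fourier_character \<xi> x) \<partial>lborel)"
  proof (rule integral_dominated_convergence)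
    show "integrable lborel (\<lambda>x. cmod (f x) * (\<Prod>i\<in>UNIV. M i))" using f by simp
    show "AE x in lborel. (\<lambda>n. f x * ?T n x) \<longlonglongrightarrow> f x * (?C * fourier_character \<xi> x)"
      by (intro AE_I2 tendsto_mult tendsto_const lim)
    show "AE x in lborel. norm (f x * ?T n x) \<le> cmod (f x) * (\<Prod>i\<in>UNIV. M i)" for n
      unfolding norm_mult by (intro AE_I2 mult_left_mono bound) simp
  qed measurable
  also have "(\<integral>x. f x * (?C * fourier_character \<xi> x) \<partial>lborel) = ?C * fourier_L1 f \<xi>"
    unfolding fourier_L1_def integral_mult_right_zero[symmetric] by (simp only: mult_ac)
  finally show ?thesis .
qed

text \<open>
  The characters are not admissible test functions. They are replaced by tensor products of exponential
  functions with cutoffs, for which both sides of the definition of the weak derivative converge.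
\<close>

theorem fourier_weak_deriv:
  fixes f g :: "real^'n \<Rightarrow> complex"
  assumes f: "integrable lborel f" and g: "integrable lborel g"
    and weak: "weak_deriv (pure_index j r) f g"
  shows "fourier_L1 g \<xi> = (2 * of_real pi * \<i> * of_real (\<xi> $ j)) ^ r * fourier_L1 f \<xi>"
proof -
  define c where "c i = - 2 * of_real pi * \<i> * of_real (\<xi> $ i)" for i
  let ?\<eta> = "\<lambda>n. tensor (\<lambda>i. cutoff_exp_seq (c i) n)"
  have test: "test_function (?\<eta> n (\<lambda>_. 0))" for n
    by (rule test_function_tensor[where a = "\<lambda>_. - real (Suc n)" and b = "\<lambda>_. real (Suc n)"])
       (auto intro: derivative_seq_cutoff_exp cutoff_exp_seq_outside)
  have eq: "(\<integral>x. f x * ?\<eta> n (pure_index j r) x \<partial>lborel) = (- 1) ^ r * (\<integral>x. g x * ?\<eta> n (\<lambda>_. 0) x \<partial>lborel)" for n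
    using weak test[of n] unfolding weak_deriv_def
    by (auto simp: mi_deriv_tensor[OF derivative_seq_cutoff_exp] mi_order_pure)
  have "(\<Prod>i\<in>UNIV. c i ^ pure_index j r i) = c j ^ r"
    by (simp add: prod.delta if_distrib[of "\<lambda>k. _ ^ k"] cong: if_cong)
  then have "(\<lambda>n. \<integral>x. f x * ?\<eta> n (pure_index j r) x \<partial>lborel) \<longlonglongrightarrow> c j ^ r * bump_centre ^ CARD('n) * fourier_L1 f \<xi>"
    using cutoff_exp_integral_limit[OF f, of \<xi> "pure_index j r"] by (simp add: c_def)
  moreover have "(\<lambda>n. (- 1) ^ r * (\<integral>x. g x * ?\<eta> n (\<lambda>_. 0) x \<partial>lborel)) \<longlonglongrightarrow>
      (- 1) ^ r * (bump_centre ^ CARD('n) * fourier_L1 g \<xi>)"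
    using cutoff_exp_integral_limit[OF g, of \<xi> "\<lambda>_. 0"] by (intro tendsto_mult_left) (simp add: c_def)
  ultimately have "c j ^ r * bump_centre ^ CARD('n) * fourier_L1 f \<xi> = (- 1) ^ r * (bump_centre ^ CARD('n) * fourier_L1 g \<xi>)"
    unfolding eq by (rule LIMSEQ_unique)
  then have "bump_centre ^ CARD('n) * (c j ^ r * fourier_L1 f \<xi>) = bump_centre ^ CARD('n) * ((- 1) ^ r * fourier_L1 g \<xi>)"
    by (simp only: mult_ac)
  then have "c j ^ r * fourier_L1 f \<xi> = (- 1) ^ r * fourier_L1 g \<xi>"
    by (rule mult_left_cancel[THEN iffD1, OF power_not_zero[OF bump_centre_nonzero]])
  then have "(- 1) ^ r * (c j ^ r * fourier_L1 f \<xi>) = ((- 1) ^ r * (- 1) ^ r) * fourier_L1 g \<xi>"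
    by (simp only: mult.assoc)
  moreover have "(- 1) ^ r * c j ^ r = (2 * of_real pi * \<i> * of_real (\<xi> $ j)) ^ r"
    by (simp add: c_def power_mult_distrib[symmetric])
  moreover have "(- 1) ^ r * (- 1) ^ r = (1::complex)" by (simp add: power_mult_distrib[symmetric])
  ultimately show ?thesis by (simp add: mult.assoc[symmetric])
qed

section \<open>Sums of integer translates\<close>

lemma sum_inverse_square_int_le:
  assumes "finite D"
  shows "(\<Sum>n\<in>D. inverse (real (Suc (nat \<bar>k - n\<bar>)) ^ 2)) \<le> 2 * (\<Sum>d. inverse (real (Suc d) ^ 2))"
proof -
  let ?v = "\<lambda>d::nat. inverse (real (Suc d) ^ 2)"
  have sm: "summable ?v"
    by (subst summable_Suc_iff[of "\<lambda>d. inverse (real d ^ 2)"]) (rule inverse_power_summable, simp)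
  have half: "(\<Sum>n\<in>A. ?v (nat \<bar>k - n\<bar>)) \<le> suminf ?v" if "finite A" "inj_on (\<lambda>n. nat \<bar>k - n\<bar>) A" for A
  proof -
    have "(\<Sum>n\<in>A. ?v (nat \<bar>k - n\<bar>)) = sum ?v ((\<lambda>n. nat \<bar>k - n\<bar>) ` A)"
      by (simp add: sum.reindex[OF that(2)])
    also have "\<dots> \<le> suminf ?v" using that by (intro sum_le_suminf sm) auto
    finally show ?thesis .
  qed
  have "(\<Sum>n\<in>D. ?v (nat \<bar>k - n\<bar>)) = (\<Sum>n\<in>D \<inter> {..k}. ?v (nat \<bar>k - n\<bar>)) + (\<Sum>n\<in>D - {..k}. ?v (nat \<bar>k - n\<bar>))"
    using assms by (rule sum.Int_Diff)
  also have "\<dots> \<le> suminf ?v + suminf ?v"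
    using assms by (intro add_mono half) (auto intro!: inj_onI)
  finally show ?thesis by simp
qed

lemma cauchy_kernel_lattice_sum:
  assumes "finite S" "S \<subseteq> \<int>"
  shows "(\<Sum>m\<in>S. inverse (1 + (t - m)\<^sup>2)) \<le> 16 * (\<Sum>d. inverse (real (Suc d) ^ 2))"
proof -
  define D where "D = floor ` S"
  have S: "S = real_of_int ` D" using assms(2) by (force simp: D_def image_image Ints_def)
  have le: "inverse (1 + (t - real_of_int n)\<^sup>2) \<le> 8 * inverse (real (Suc (nat \<bar>\<lfloor>t\<rfloor> - n\<bar>)) ^ 2)" for n
  proof -
    define d where "d = real (nat \<bar>\<lfloor>t\<rfloor> - n\<bar>)"
    have d: "0 \<le> d" "d - 1 \<le> \<bar>t - real_of_int n\<bar>" unfolding d_def by linarith+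
    define y where "y = (t - real_of_int n)\<^sup>2"
    have "0 \<le> y" by (simp add: y_def)
    have "(d + 1)\<^sup>2 \<le> 8 * (1 + y)"
    proof (cases "d \<ge> 1")
      case True
      then have "(d - 1)\<^sup>2 \<le> y"
        using d power_mono[of "d - 1" "\<bar>t - real_of_int n\<bar>" 2] by (simp add: y_def)
      then have "8 * (1 + (d - 1)\<^sup>2) \<le> 8 * (1 + y)" by simp
      \<comment> \<open>Completing the square.\<close>
      moreover have "8 * (1 + (d - 1)\<^sup>2) = (d + 1)\<^sup>2 + (7 * (d - 9 / 7)\<^sup>2 + 24 / 7)"
        by (simp add: power2_eq_square field_simps)
      then have "(d + 1)\<^sup>2 \<le> 8 * (1 + (d - 1)\<^sup>2)" by simp
      ultimately show ?thesis by (rule order_trans[rotated])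
    next
      case False
      then have "(d + 1)\<^sup>2 \<le> 2\<^sup>2" using d by (intro power_mono) auto
      also have "\<dots> \<le> 8 * (1 + y)" using \<open>0 \<le> y\<close> by simp
      finally show ?thesis .
    qed
    then have "inverse (8 * (1 + y)) \<le> inverse ((d + 1)\<^sup>2)"
      using d by (intro le_imp_inverse_le) auto
    then have "inverse (1 + y) \<le> 8 * inverse ((d + 1)\<^sup>2)" unfolding inverse_mult_distrib by simp
    then show ?thesis by (simp add: y_def d_def add.commute)
  qed
  have "(\<Sum>m\<in>S. inverse (1 + (t - m)\<^sup>2)) = (\<Sum>n\<in>D. inverse (1 + (t - real_of_int n)\<^sup>2))"
    unfolding S by (subst sum.reindex) (auto simp: inj_on_def)
  also have "\<dots> \<le> (\<Sum>n\<in>D. 8 * inverse (real (Suc (nat \<bar>\<lfloor>t\<rfloor> - n\<bar>)) ^ 2))" by (intro sum_mono le)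
  also have "\<dots> \<le> 8 * (2 * (\<Sum>d. inverse (real (Suc d) ^ 2)))"
    unfolding sum_distrib_left[symmetric]
    using assms(1) by (intro mult_left_mono sum_inverse_square_int_le) (auto simp: D_def)
  finally show ?thesis by simp
qed

text \<open>
  Up to constants, an integrable majorant of all rapidly decreasing functions. Its integral and its lattice
  sums factorise over the coordinates.
\<close>

definition decay_kernel :: "real^'n \<Rightarrow> real" where
  "decay_kernel x = (\<Prod>i\<in>UNIV. inverse (1 + (x $ i)\<^sup>2))"

lemma decay_kernel_nonneg: "0 \<le> decay_kernel x"
  by (auto simp: decay_kernel_def intro!: prod_nonneg)

lemma borel_measurable_decay_kernel [measurable]: "decay_kernel \<in> borel_measurable borel"
  unfolding decay_kernel_def[abs_def] by measurable

lemma integrable_decay_kernel: "integrable lborel decay_kernel"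
  unfolding decay_kernel_def[abs_def]
proof (rule lborel_integral_prod(1))
  show "integrable lborel (\<lambda>t::real. inverse (1 + t\<^sup>2))"
    using integrable_inverse_1_plus_square by (simp add: set_integrable_def)
qed

lemma decay_kernel_lattice_sum:
  "\<exists>B\<ge>0. \<forall>F\<subseteq>int_vectors. \<forall>x::real^'n. finite F \<longrightarrow> (\<Sum>k\<in>F. decay_kernel (x - k)) \<le> B"
proof (intro exI[of _ "(16 * (\<Sum>d. inverse (real (Suc d) ^ 2))) ^ CARD('n)"] conjI allI impI)
  have "0 \<le> 16 * (\<Sum>d. inverse (real (Suc d) ^ 2))"
    using cauchy_kernel_lattice_sum[of "{}"] by simp
  then show "0 \<le> (16 * (\<Sum>d. inverse (real (Suc d) ^ 2))) ^ CARD('n)" by simp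
  fix F :: "(real^'n) set" and x :: "real^'n"
  assume F: "F \<subseteq> int_vectors" "finite F"
  let ?S = "\<lambda>i. (\<lambda>k. k $ i) ` F" and ?\<kappa> = "\<lambda>i m. inverse (1 + (x $ i - m)\<^sup>2)"
  have S: "finite (?S i)" "?S i \<subseteq> \<int>" for i using F by (auto simp: int_vectors_def)
  have inj: "inj_on vec_nth F" by (auto intro!: inj_onI simp: vec_eq_iff)
  have "(\<Sum>k\<in>F. decay_kernel (x - k)) = (\<Sum>g\<in>vec_nth ` F. \<Prod>i\<in>UNIV. ?\<kappa> i (g i))"
    by (simp add: sum.reindex[OF inj] decay_kernel_def)
  also have "\<dots> \<le> (\<Sum>g\<in>PiE UNIV ?S. \<Prod>i\<in>UNIV. ?\<kappa> i (g i))"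
    using S(1) by (intro sum_mono2 finite_PiE) (auto intro!: prod_nonneg)
  also have "\<dots> = (\<Prod>i\<in>UNIV. \<Sum>m\<in>?S i. ?\<kappa> i m)"
    by (rule prod_sum_PiE[symmetric]) (auto simp: S(1))
  also have "\<dots> \<le> (\<Prod>i\<in>(UNIV::'n set). 16 * (\<Sum>d. inverse (real (Suc d) ^ 2)))"
    using S by (intro prod_mono conjI cauchy_kernel_lattice_sum sum_nonneg) auto
  finally show "(\<Sum>k\<in>F. decay_kernel (x - k)) \<le> (16 * (\<Sum>d. inverse (real (Suc d) ^ 2))) ^ CARD('n)" by simp
qed

text \<open>
  Each factor \<open>1 + x\<^sub>i\<^sup>2\<close> is at most \<open>(1 + |x|)\<^sup>2\<close>, which determines the exponent.
\<close>

lemma rapid_decay_le_decay_kernel: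
  fixes x :: "real^'n"
  shows "(1 + norm x) powr (- real (2 * CARD('n))) \<le> decay_kernel x"
proof -
  have "(\<Prod>i\<in>UNIV. 1 + (x $ i)\<^sup>2) \<le> (\<Prod>i\<in>(UNIV::'n set). (1 + norm x)\<^sup>2)"
  proof (intro prod_mono conjI)
    fix i
    have "\<bar>x $ i\<bar>\<^sup>2 \<le> (norm x)\<^sup>2" by (intro power_mono component_le_norm_cart) auto
    then show "1 + (x $ i)\<^sup>2 \<le> (1 + norm x)\<^sup>2" by (simp add: power2_sum add_increasing2)
  qed simp
  also have "\<dots> = (1 + norm x) ^ (2 * CARD('n))" by (simp add: power_mult)
  finally have "inverse ((1 + norm x) ^ (2 * CARD('n))) \<le> inverse (\<Prod>i\<in>UNIV. 1 + (x $ i)\<^sup>2)"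
    by (intro le_imp_inverse_le prod_pos) (auto simp: add_pos_nonneg)
  moreover have "(1 + norm x) powr (- real (2 * CARD('n))) = inverse ((1 + norm x) ^ (2 * CARD('n)))"
    unfolding powr_minus using norm_ge_zero[of x] by (subst powr_realpow) (auto simp: add_pos_nonneg simp del: of_nat_mult)
  ultimately show ?thesis by (simp add: decay_kernel_def prod_inversef[symmetric] comp_def)
qed

text \<open>
  Schur's test for the kernel \<open>g (x - k)\<close> with \<open>x\<close> in \<open>\<real>\<^sup>n\<close> and integer vectors \<open>k\<close>.
\<close>

lemma translates_norm_bound:
  fixes g :: "real^'n \<Rightarrow> complex"
  assumes [measurable]: "g \<in> borel_measurable borel" and g: "\<And>x. cmod (g x) \<le> C * decay_kernel x"
  shows "\<exists>A\<ge>0. \<forall>(F :: 'b set) k c. finite F \<longrightarrow> inj_on k F \<longrightarrow> k ` F \<subseteq> int_vectors \<longrightarrow>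
     (\<lambda>x. \<Sum>i\<in>F. c i * g (x - k i)) \<in> L2 \<and>
     (l2_norm (\<lambda>x. \<Sum>i\<in>F. c i * g (x - k i)))\<^sup>2 \<le> A * (\<Sum>i\<in>F. (cmod (c i))\<^sup>2)"
proof -
  obtain B where B: "0 \<le> B" "\<forall>F\<subseteq>int_vectors. \<forall>x::real^'n. finite F \<longrightarrow> (\<Sum>k\<in>F. decay_kernel (x - k)) \<le> B"
    using decay_kernel_lattice_sum by blast
  let ?I = "\<integral>x. decay_kernel (x::real^'n) \<partial>lborel"
  have I: "0 \<le> ?I" by (simp add: decay_kernel_nonneg)
  have main: "(\<lambda>x. \<Sum>i\<in>F. c i * g (x - k i)) \<in> L2 \<and>
     (l2_norm (\<lambda>x. \<Sum>i\<in>F. c i * g (x - k i)))\<^sup>2 \<le> (C\<^sup>2 * B * ?I) * (\<Sum>i\<in>F. (cmod (c i))\<^sup>2)"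
    if F: "finite F" "inj_on k F" "k ` F \<subseteq> int_vectors" for F :: "'b set" and k c
  proof -
    let ?u = "\<lambda>x. \<Sum>i\<in>F. c i * g (x - k i)" and ?s = "\<Sum>i\<in>F. (cmod (c i))\<^sup>2"
    let ?M = "sqrt ((C\<^sup>2 * B * ?I) * ?s)"
    have nonneg: "0 \<le> (C\<^sup>2 * B * ?I) * ?s"
      by (intro mult_nonneg_nonneg sum_nonneg B(1) I zero_le_power2)
    then have M: "?M\<^sup>2 = (C\<^sup>2 * B * ?I) * ?s" by (rule real_sqrt_pow2)
    have pointwise: "(cmod (?u x))\<^sup>2 \<le> (C\<^sup>2 * B) * (\<Sum>i\<in>F. (cmod (c i))\<^sup>2 * decay_kernel (x - k i))" for x
    proof -
      let ?K = "\<lambda>i. decay_kernel (x - k i)"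
      have "cmod (?u x) \<le> (\<Sum>i\<in>F. cmod (c i) * (C * ?K i))"
        by (rule order_trans[OF norm_sum sum_mono]) (simp add: norm_mult mult_left_mono g)
      also have "\<dots> = C * (\<Sum>i\<in>F. (cmod (c i) * sqrt (?K i)) * sqrt (?K i))"
        unfolding sum_distrib_left
        by (intro sum.cong refl) (simp add: mult.assoc mult.left_commute[of _ C] decay_kernel_nonneg)
      finally have "(cmod (?u x))\<^sup>2 \<le> (C * (\<Sum>i\<in>F. (cmod (c i) * sqrt (?K i)) * sqrt (?K i)))\<^sup>2"
        by (rule power_mono) simp
      also have "\<dots> \<le> C\<^sup>2 * ((\<Sum>i\<in>F. (cmod (c i) * sqrt (?K i))\<^sup>2) * (\<Sum>i\<in>F. (sqrt (?K i))\<^sup>2))"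
        unfolding power_mult_distrib[of C] by (intro mult_left_mono Cauchy_Schwarz_ineq_sum) simp
      also have "\<dots> = C\<^sup>2 * ((\<Sum>i\<in>F. (cmod (c i))\<^sup>2 * ?K i) * (\<Sum>i\<in>F. ?K i))"
        by (simp add: power_mult_distrib decay_kernel_nonneg)
      also have "\<dots> \<le> C\<^sup>2 * ((\<Sum>i\<in>F. (cmod (c i))\<^sup>2 * ?K i) * B)"
      proof (intro mult_left_mono)
        have "(\<Sum>i\<in>F. ?K i) = (\<Sum>l\<in>k ` F. decay_kernel (x - l))" by (simp add: sum.reindex[OF F(2)])
        then show "(\<Sum>i\<in>F. ?K i) \<le> B" using B(2) F by simp
      qed (auto intro!: sum_nonneg simp: decay_kernel_nonneg)
      finally show ?thesis by (simp add: mult_ac)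
    qed
    have translate: "(\<integral>\<^sup>+x. ennreal (decay_kernel (x - l)) \<partial>lborel) = ennreal ?I" for l :: "real^'n"
      using nn_integral_lborel_translate[of "\<lambda>x. ennreal (decay_kernel x)" "- l"]
      by (simp add: nn_integral_eq_integral integrable_decay_kernel decay_kernel_nonneg)
    have "(\<integral>\<^sup>+x. ennreal ((cmod (?u x))\<^sup>2) \<partial>lborel) \<le>
        (\<integral>\<^sup>+x. ennreal (C\<^sup>2 * B) * (\<Sum>i\<in>F. ennreal ((cmod (c i))\<^sup>2) * ennreal (decay_kernel (x - k i))) \<partial>lborel)"
    proof (intro nn_integral_mono)
      fix x
      have "ennreal ((cmod (?u x))\<^sup>2) \<le> ennreal ((C\<^sup>2 * B) * (\<Sum>i\<in>F. (cmod (c i))\<^sup>2 * decay_kernel (x - k i)))"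
        by (intro ennreal_leI pointwise)
      also have "\<dots> = ennreal (C\<^sup>2 * B) * (\<Sum>i\<in>F. ennreal ((cmod (c i))\<^sup>2) * ennreal (decay_kernel (x - k i)))"
        using B(1) by (simp add: ennreal_mult sum_nonneg decay_kernel_nonneg flip: sum_ennreal)
      finally show "ennreal ((cmod (?u x))\<^sup>2) \<le>
        ennreal (C\<^sup>2 * B) * (\<Sum>i\<in>F. ennreal ((cmod (c i))\<^sup>2) * ennreal (decay_kernel (x - k i)))" .
    qed
    also have "\<dots> = ennreal (C\<^sup>2 * B) * (\<Sum>i\<in>F. ennreal ((cmod (c i))\<^sup>2) * ennreal ?I)"
      by (simp add: nn_integral_cmult nn_integral_sum translate)
    also have "\<dots> = ennreal (?M\<^sup>2)"
    proof -
      have "(\<Sum>i\<in>F. ennreal ((cmod (c i))\<^sup>2) * ennreal ?I) = ennreal ((\<Sum>i\<in>F. (cmod (c i))\<^sup>2) * ?I)"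
        using I by (simp add: sum_distrib_right sum_ennreal flip: ennreal_mult)
      then show ?thesis
        unfolding M using B(1) I by (simp add: sum_nonneg mult_ac flip: ennreal_mult)
    qed
    finally have "(\<integral>\<^sup>+x. ennreal ((cmod (?u x))\<^sup>2) \<partial>lborel) \<le> ennreal (?M\<^sup>2)" .
    moreover have "0 \<le> ?M" using nonneg by (rule real_sqrt_ge_zero)
    moreover have "?u \<in> borel_measurable borel" by measurable
    ultimately have u: "?u \<in> L2" "l2_norm ?u \<le> ?M" by (blast intro: L2_nn_integralI)+
    have "(l2_norm ?u)\<^sup>2 \<le> ?M\<^sup>2" by (rule power_mono[OF u(2)]) simp
    with u(1) show ?thesis unfolding M by blast
  qed
  show ?thesis
    using main mult_nonneg_nonneg[OF mult_nonneg_nonneg[OF zero_le_power2[of C] B(1)] I] by blast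
qed

section \<open>The Fourier transform under translations and dilations\<close>

lemma integrable_lborel_translate:
  fixes f :: "'a::euclidean_space \<Rightarrow> complex"
  assumes "integrable lborel f"
  shows "integrable lborel (\<lambda>x. f (x - c))" and "(\<integral>x. f (x - c) \<partial>lborel) = (\<integral>x. f x \<partial>lborel)"
proof -
  note [measurable] = borel_measurable_integrable[OF assms]
  have eq: "distr lborel borel ((+) (- c)) = (lborel :: 'a measure)" by (rule lborel_distr_plus)
  have "integrable (distr lborel borel ((+) (- c))) f" unfolding eq by (rule assms)
  then show "integrable lborel (\<lambda>x. f (x - c))" by (subst (asm) integrable_distr_eq) (simp_all add: algebra_simps)
  have "(\<integral>x. f x \<partial>lborel) = (\<integral>x. f x \<partial>distr lborel borel ((+) (- c)))" unfolding eq ..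
  also have "\<dots> = (\<integral>x. f (x - c) \<partial>lborel)" by (subst integral_distr) (simp_all add: algebra_simps)
  finally show "(\<integral>x. f (x - c) \<partial>lborel) = (\<integral>x. f x \<partial>lborel)" by simp
qed

lemma fourier_L1_translate:
  fixes f :: "real^'n \<Rightarrow> complex"
  assumes "integrable lborel f"
  shows "fourier_L1 (\<lambda>x. f (x - c)) \<xi> = fourier_character \<xi> c * fourier_L1 f \<xi>"
proof -
  have "fourier_L1 (\<lambda>x. f (x - c)) \<xi> = (\<integral>x. (\<lambda>y. fourier_character \<xi> c * (fourier_character \<xi> y * f y)) (x - c) \<partial>lborel)"
    unfolding fourier_L1_def
    by (intro Bochner_Integration.integral_cong refl) (simp add: inner_diff_right algebra_simps flip: exp_add)
  also have "\<dots> = (\<integral>x. fourier_character \<xi> c * (fourier_character \<xi> x * f x) \<partial>lborel)"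
    by (rule integrable_lborel_translate(2)) (intro integrable_mult_right integrable_fourier assms)
  finally show ?thesis by (simp add: fourier_L1_def)
qed

lemma
  assumes "0 < q"
  shows nn_integral_lborel_scale: "f \<in> borel_measurable borel \<Longrightarrow>
      (\<integral>\<^sup>+x. f (x::real^'n) \<partial>lborel) = ennreal (q ^ CARD('n)) * (\<integral>\<^sup>+x. f (q *\<^sub>R x) \<partial>lborel)"
    and integrable_lborel_scale: "integrable lborel (g :: real^'n \<Rightarrow> complex) \<Longrightarrow> integrable lborel (\<lambda>x. g (q *\<^sub>R x))"
    and integral_lborel_scale: "integrable lborel g \<Longrightarrow>
      (\<integral>x. g x \<partial>lborel) = of_real (q ^ CARD('n)) * (\<integral>x. g (q *\<^sub>R x) \<partial>lborel)"
proof -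
  have eq: "(lborel :: (real^'n) measure) = density (distr lborel borel (\<lambda>x. q *\<^sub>R x)) (\<lambda>_. ennreal (q ^ CARD('n)))"
    using lborel_affine[of q "0::real^'n"] assms by simp
  show nn: "(\<integral>\<^sup>+x. f (x::real^'n) \<partial>lborel) = ennreal (q ^ CARD('n)) * (\<integral>\<^sup>+x. f (q *\<^sub>R x) \<partial>lborel)"
    if [measurable]: "f \<in> borel_measurable borel" for f
    by (subst eq, subst nn_integral_density) (simp_all add: nn_integral_cmult nn_integral_distr)
  assume g: "integrable lborel (g :: real^'n \<Rightarrow> complex)"
  note [measurable] = borel_measurable_integrable[OF g]
  have "ennreal (q ^ CARD('n)) * (\<integral>\<^sup>+x. ennreal (norm (g (q *\<^sub>R x))) \<partial>lborel) < \<infinity>"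
    using g nn[of "\<lambda>x. ennreal (norm (g x))"] by (simp add: integrable_iff_bounded)
  then show "integrable lborel (\<lambda>x. g (q *\<^sub>R x))"
    using assms by (intro integrableI_bounded) (auto simp: ennreal_mult_less_top)
  have "(\<integral>x. g x \<partial>lborel) = (\<integral>x. q ^ CARD('n) *\<^sub>R g x \<partial>distr lborel borel (\<lambda>x. q *\<^sub>R x))"
    using assms by (subst eq, subst integral_density) simp_all
  also have "\<dots> = (\<integral>x. q ^ CARD('n) *\<^sub>R g (q *\<^sub>R x) \<partial>lborel)"
    by (subst integral_distr) simp_all
  finally show "(\<integral>x. g x \<partial>lborel) = of_real (q ^ CARD('n)) * (\<integral>x. g (q *\<^sub>R x) \<partial>lborel)"
    by (simp add: scaleR_conv_of_real)
qed

lemma fourier_L1_scale: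
  fixes g :: "real^'n \<Rightarrow> complex"
  assumes q: "0 < q" and g: "integrable lborel g"
  shows "fourier_L1 (\<lambda>x. g (q *\<^sub>R x)) \<xi> = of_real (1 / q ^ CARD('n)) * fourier_L1 g ((1 / q) *\<^sub>R \<xi>)"
proof -
  have "fourier_L1 g ((1 / q) *\<^sub>R \<xi>) = of_real (q ^ CARD('n)) * fourier_L1 (\<lambda>x. g (q *\<^sub>R x)) \<xi>"
    unfolding fourier_L1_def using q
    by (subst integral_lborel_scale[OF q integrable_fourier[OF g]]) simp
  then show ?thesis using q by (simp add: field_simps)
qed

lemma sobolev_weight_scale_le:
  assumes "1 \<le> q" "0 \<le> s"
  shows "sobolev_weight s (q *\<^sub>R \<xi>) \<le> q powr s * sobolev_weight s \<xi>"
proof -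
  have "1 + 4 * pi\<^sup>2 * (norm (q *\<^sub>R \<xi>))\<^sup>2 \<le> q\<^sup>2 * (1 + 4 * pi\<^sup>2 * (norm \<xi>)\<^sup>2)"
    using assms(1) by (simp add: power_mult_distrib distrib_left mult_ac)
  then have "sobolev_weight s (q *\<^sub>R \<xi>) \<le> (q\<^sup>2 * (1 + 4 * pi\<^sup>2 * (norm \<xi>)\<^sup>2)) powr (s / 2)"
    unfolding sobolev_weight_def using assms(2) by (intro powr_mono2) auto
  also have "\<dots> = (q\<^sup>2) powr (s / 2) * sobolev_weight s \<xi>"
    unfolding sobolev_weight_def by (rule powr_mult)
  also have "(q\<^sup>2) powr (s / 2) = q powr s"
    using assms(1) by (simp add: powr_powr flip: powr_numeral)
  finally show ?thesis .
qed

lemma borel_measurable_sobolev_weight [measurable]: "sobolev_weight s \<in> borel_measurable borel"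
  unfolding sobolev_weight_def[abs_def] by measurable

text \<open>
  An \<open>L\<^sub>2\<close> normalised dilation by \<open>q \<ge> 1\<close> increases the Sobolev norm of order \<open>s\<close> at most by the factor \<open>q\<^sup>s\<close>.
\<close>

lemma sobolev_norm_scale:
  fixes Y :: "real^'n \<Rightarrow> complex"
  assumes q: "1 \<le> q" and s: "0 \<le> s" and Y: "integrable lborel Y" and a: "\<bar>a\<bar>\<^sup>2 = q ^ CARD('n)"
    and w: "weighted_fourier s Y \<in> L2"
  defines "X \<equiv> \<lambda>x. of_real a * Y (q *\<^sub>R x)"
  shows "weighted_fourier s X \<in> L2"
    and "l2_norm (weighted_fourier s X)
      \<le> q powr s * l2_norm (weighted_fourier s Y)"
proof -
  let ?w = "\<lambda>\<xi>. complex_of_real (sobolev_weight s \<xi>)" and ?N = "CARD('n)"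
  let ?M = "q powr s * l2_norm (\<lambda>\<xi>. ?w \<xi> * fourier_L1 Y \<xi>)"
  have q0: "0 < q" using q by simp
  have X: "fourier_L1 X \<xi> = of_real (a / q ^ ?N) * fourier_L1 Y ((1 / q) *\<^sub>R \<xi>)" for \<xi>
    unfolding X_def fourier_L1_mult fourier_L1_scale[OF q0 Y] by simp
  have [measurable]: "Y \<in> borel_measurable borel" using Y by simp
  have [measurable]: "X \<in> borel_measurable borel" unfolding X_def by measurable
  have "(\<integral>\<^sup>+\<xi>. ennreal ((cmod (?w \<xi> * fourier_L1 X \<xi>))\<^sup>2) \<partial>lborel)
      = ennreal (q ^ ?N) * (\<integral>\<^sup>+\<xi>. ennreal ((cmod (?w (q *\<^sub>R \<xi>) * fourier_L1 X (q *\<^sub>R \<xi>)))\<^sup>2) \<partial>lborel)"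
    by (rule nn_integral_lborel_scale[OF q0]) measurable
  also have "\<dots> \<le> ennreal (q ^ ?N) * (\<integral>\<^sup>+\<xi>. ennreal (1 / q ^ ?N * (q powr s)\<^sup>2) * ennreal ((cmod (?w \<xi> * fourier_L1 Y \<xi>))\<^sup>2) \<partial>lborel)"
  proof (intro mult_left_mono nn_integral_mono)
    fix \<xi> :: "real^'n"
    have "(cmod (?w (q *\<^sub>R \<xi>)))\<^sup>2 \<le> (q powr s * sobolev_weight s \<xi>)\<^sup>2"
      unfolding norm_of_real using sobolev_weight_scale_le[OF q s, of \<xi>]
      by (intro power_mono) (auto simp: sobolev_weight_def)
    moreover have "(cmod (fourier_L1 X (q *\<^sub>R \<xi>)))\<^sup>2 = 1 / q ^ ?N * (cmod (fourier_L1 Y \<xi>))\<^sup>2"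
    proof -
      have "\<bar>a / q ^ ?N\<bar>\<^sup>2 = 1 / q ^ ?N"
        using q0 a by (simp add: abs_divide power_divide power2_eq_square)
      then show ?thesis unfolding X norm_mult norm_of_real power_mult_distrib using q0 by simp
    qed
    ultimately have "(cmod (?w (q *\<^sub>R \<xi>) * fourier_L1 X (q *\<^sub>R \<xi>)))\<^sup>2 \<le>
        (q powr s * sobolev_weight s \<xi>)\<^sup>2 * (1 / q ^ ?N * (cmod (fourier_L1 Y \<xi>))\<^sup>2)"
      unfolding norm_mult power_mult_distrib using q0 by (intro mult_mono) auto
    also have "\<dots> = 1 / q ^ ?N * (q powr s)\<^sup>2 * (cmod (?w \<xi> * fourier_L1 Y \<xi>))\<^sup>2"
      by (simp add: norm_mult power_mult_distrib)
    finally show "ennreal ((cmod (?w (q *\<^sub>R \<xi>) * fourier_L1 X (q *\<^sub>R \<xi>)))\<^sup>2) \<le>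
        ennreal (1 / q ^ ?N * (q powr s)\<^sup>2) * ennreal ((cmod (?w \<xi> * fourier_L1 Y \<xi>))\<^sup>2)"
      using q0 by (simp add: ennreal_leI flip: ennreal_mult)
  qed simp
  also have "\<dots> = ennreal (q ^ ?N * (1 / q ^ ?N * (q powr s)\<^sup>2) * (l2_norm (\<lambda>\<xi>. ?w \<xi> * fourier_L1 Y \<xi>))\<^sup>2)"
    using q0 by (subst nn_integral_cmult)
      (measurable, simp add: l2_norm_nn_integral[OF w] mult.assoc[symmetric] flip: ennreal_mult)
  also have "\<dots> = ennreal (?M\<^sup>2)" using q0 by (simp add: power_mult_distrib)
  finally have "(\<integral>\<^sup>+\<xi>. ennreal ((cmod (?w \<xi> * fourier_L1 X \<xi>))\<^sup>2) \<partial>lborel) \<le> ennreal (?M\<^sup>2)" .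
  then show "(\<lambda>\<xi>. ?w \<xi> * fourier_L1 X \<xi>) \<in> L2" "l2_norm (\<lambda>\<xi>. ?w \<xi> * fourier_L1 X \<xi>) \<le> ?M"
    using L2_nn_integralI[of "\<lambda>\<xi>. ?w \<xi> * fourier_L1 X \<xi>" ?M] by simp_all
qed

section \<open>Orthonormal bases of subspaces\<close>

lemma orthonormal_basis_orthonormal:
  "orthonormal_basis f I S \<Longrightarrow> S \<subseteq> L2 \<Longrightarrow> orthonormal f I"
  by (auto simp: orthonormal_basis_def orthonormal_def)

lemma l2_has_sum_cong_AE:
  assumes "l2_has_sum f I w" "g \<in> L2" "AE x in lborel. g x = w x" "\<And>i. i \<in> I \<Longrightarrow> f i \<in> L2"
  shows "l2_has_sum f I g"
proof -
  have w: "w \<in> L2" using assms(1) by (rule l2_has_sum_L2)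
  have "((\<lambda>F. l2_norm (\<lambda>x. (\<Sum>i\<in>F. f i x) - w x)) \<longlongrightarrow> 0) (finite_subsets_at_top I)"
    using assms(1) by (simp add: l2_has_sum_def l2_tendsto_def)
  moreover have "\<forall>\<^sub>F F in finite_subsets_at_top I.
      l2_norm (\<lambda>x. (\<Sum>i\<in>F. f i x) - w x) = l2_norm (\<lambda>x. (\<Sum>i\<in>F. f i x) - g x)"
  proof (rule eventually_finite_subsets_at_top_weakI)
    fix F assume F: "finite F" "F \<subseteq> I"
    then have "(\<lambda>x. \<Sum>i\<in>F. f i x) \<in> L2" using assms(4) by (intro L2_sum) auto
    then show "l2_norm (\<lambda>x. (\<Sum>i\<in>F. f i x) - w x) = l2_norm (\<lambda>x. (\<Sum>i\<in>F. f i x) - g x)"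
      using assms(2,3) w by (intro l2_norm_cong_AE L2_measurable L2_diff) auto
  qed
  ultimately have "((\<lambda>F. l2_norm (\<lambda>x. (\<Sum>i\<in>F. f i x) - g x)) \<longlongrightarrow> 0) (finite_subsets_at_top I)"
    by (rule Lim_transform_eventually)
  then show ?thesis using assms(1,2) by (simp add: l2_has_sum_def l2_tendsto_def)
qed

text \<open>
  The difference \<open>d\<close> of \<open>g\<close> and the sum of its expansion is orthogonal to all finite linear combinations of
  the basis functions, and these approximate \<open>g\<close>.
\<close>

lemma orthonormal_basis_expansion:
  assumes basis: "orthonormal_basis f I S" and S: "S \<subseteq> L2" and g: "g \<in> S"
  shows "l2_has_sum (\<lambda>i x. l2_inner g (f i) * f i x) I g"
proof -
  have f: "orthonormal f I" using basis S by (rule orthonormal_basis_orthonormal)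
  have gL: "g \<in> L2" using g S by blast
  obtain w where w: "l2_has_sum (\<lambda>i x. l2_inner g (f i) * f i x) I w"
    using orthonormal_has_sum_exists[OF f Bessel_summable[OF f gL]] by blast
  have wL: "w \<in> L2" using w by (rule l2_has_sum_L2)
  define d where "d = (\<lambda>x. g x - w x)"
  have d: "d \<in> L2" unfolding d_def using gL wL by (rule L2_diff)
  have fL: "f i \<in> L2" if "i \<in> I" for i using f that by (rule orthonormal_L2)
  have fd: "l2_inner (f i) d = 0" if i: "i \<in> I" for i
  proof -
    have "l2_inner d (f i) = 0"
      unfolding d_def using gL wL fL[OF i] l2_has_sum_coeff[OF f w order_refl i] i
      by (simp add: l2_inner_diff_left)
    then show ?thesis by (subst l2_inner_commute) simp
  qed
  have wd: "l2_inner w d = 0"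
  proof (rule has_sum_unique)
    show "((\<lambda>i. l2_inner g (f i) * l2_inner (f i) d) has_sum l2_inner w d) I"
      by (rule l2_has_sum_inner[OF w fL d])
    show "((\<lambda>i. l2_inner g (f i) * l2_inner (f i) d) has_sum 0) I"
      by (rule has_sum_0) (simp add: fd)
  qed
  have small: "l2_norm d \<le> e" if e: "e > 0" for e
  proof -
    obtain F c where F: "finite F" "F \<subseteq> I" "l2_norm (\<lambda>x. g x - (\<Sum>i\<in>F. c i * f i x)) < e"
      using basis g e unfolding orthonormal_basis_def by blast
    define h where "h = (\<lambda>x. \<Sum>i\<in>F. c i * f i x)"
    have h: "h \<in> L2" unfolding h_def by (rule L2_lincomb[OF f F(2)])
    have hd: "l2_inner h d = 0"
      unfolding h_def using F(2) fL fd d by (subst l2_inner_lincomb_left) (auto intro!: sum.neutral)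
    have "l2_inner d d = l2_inner g d - l2_inner w d"
      using l2_inner_diff_left[OF gL wL d] unfolding d_def[symmetric] .
    then have "l2_inner d d = l2_inner (\<lambda>x. g x - h x) d"
      using gL h d hd wd by (simp add: l2_inner_diff_left)
    then have "(l2_norm d)\<^sup>2 = cmod (l2_inner (\<lambda>x. g x - h x) d)"
      unfolding l2_inner_self by (metis norm_of_real abs_of_nonneg zero_le_power2)
    also have "\<dots> \<le> l2_dist g h * l2_norm d"
      by (rule l2_Cauchy_Schwarz[OF L2_diff[OF gL h] d])
    also have "\<dots> \<le> e * l2_norm d" using F(3) by (intro mult_right_mono) (auto simp: h_def)
    finally have le: "l2_norm d * l2_norm d \<le> e * l2_norm d" by (simp add: power2_eq_square)
    show ?thesis
    proof (cases "l2_norm d = 0")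
      case False
      then have "0 < l2_norm d" by (simp add: less_le)
      with le show ?thesis by (rule mult_right_le_imp_le)
    qed (use e in simp)
  qed
  have "l2_norm d \<le> 0" using field_le_epsilon[of "l2_norm d" 0] small by simp
  then have "l2_norm d = 0" by (intro antisym l2_norm_nonneg)
  then have "AE x in lborel. d x = 0" by (rule l2_norm_eq_0_iff[OF d, THEN iffD1])
  then have "AE x in lborel. g x = w x" unfolding d_def by eventually_elim simp
  with w gL fL show ?thesis by (intro l2_has_sum_cong_AE[OF w]) (auto intro: L2_mult_left)
qed

lemma orthonormal_basis_approx:
  assumes "orthonormal_basis f I S" "S \<subseteq> L2" "g \<in> S" "e > 0"
  obtains F where "finite F" "F \<subseteq> I" "l2_norm (\<lambda>x. (\<Sum>i\<in>F. l2_inner g (f i) * f i x) - g x) < e"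
proof -
  have "((\<lambda>F. l2_norm (\<lambda>x. (\<Sum>i\<in>F. l2_inner g (f i) * f i x) - g x)) \<longlongrightarrow> 0) (finite_subsets_at_top I)"
    using orthonormal_basis_expansion[OF assms(1-3)] by (simp add: l2_has_sum_def l2_tendsto_def)
  from tendstoD[OF this assms(4)] that show thesis
    by (auto simp: eventually_finite_subsets_at_top)
qed

section \<open>Regular scaling functions\<close>

lemma test_function_mult_integrable:
  assumes f: "locally_integrable f" and \<eta>: "test_function \<eta>"
  shows "integrable lborel (\<lambda>x. f x * \<eta> x)"
proof -
  let ?K = "closure {x. \<eta> x \<noteq> 0}"
  have K: "compact ?K" using \<eta> by (simp add: test_function_def)
  have "\<eta> differentiable (at x)" for x
    using \<eta> unfolding test_function_def smooth_def by (metis foldr.simps(1) id_apply)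
  then have cont: "continuous_on S \<eta>" for S
    by (intro continuous_at_imp_continuous_on ballI differentiable_imp_continuous_within)
  have "bounded (\<eta> ` ?K)"
    by (intro compact_imp_bounded compact_continuous_image cont K)
  then obtain B where B: "\<forall>y\<in>\<eta> ` ?K. cmod y \<le> B" unfolding bounded_iff ..
  have [measurable]: "f \<in> borel_measurable borel" "\<eta> \<in> borel_measurable borel"
    using f borel_measurable_continuous_onI[OF cont] by (auto simp: locally_integrable_def)
  have "integrable lborel (\<lambda>x. of_real B * (indicator ?K x *\<^sub>R f x))"
    using f K by (intro integrable_mult_right) (auto simp: locally_integrable_def set_integrable_def)
  then show ?thesis
  proof (rule Bochner_Integration.integrable_bound)
    show "AE x in lborel. norm (f x * \<eta> x) \<le> norm (of_real B * (indicator ?K x *\<^sub>R f x))"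
    proof (rule AE_I2)
      fix x
      show "norm (f x * \<eta> x) \<le> norm (of_real B * (indicator ?K x *\<^sub>R f x))"
      proof (cases "x \<in> ?K")
        case True
        then have "cmod (\<eta> x) \<le> \<bar>B\<bar>" using B by force
        with True show ?thesis by (simp add: norm_mult mult.commute mult_right_mono)
      next
        case False
        then have "\<eta> x = 0" using closure_subset[of "{x. \<eta> x \<noteq> 0}"] by auto
        then show ?thesis by simp
      qed
    qed
  qed measurable
qed

text \<open>
  In the definition of \<^const>\<open>regular\<close>, the bound on \<open>\<phi>\<close> itself is stated for a weak derivative of
  order zero of \<open>\<phi>\<close>, which thus agrees with \<open>\<phi>\<close> almost everywhere.
\<close>

lemma weak_deriv_0_imp_AE_eq:
  assumes "weak_deriv (\<lambda>_. 0) f g"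
  shows "AE x in lborel. f x = g x"
proof -
  have f: "locally_integrable f" and g: "locally_integrable g"
    using assms by (auto simp: weak_deriv_def)
  have "locally_integrable (\<lambda>x. f x - g x)"
    using f g unfolding locally_integrable_def by (auto intro: set_integral_diff)
  moreover have "(\<integral>x. (f x - g x) * \<eta> x \<partial>lborel) = 0" if \<eta>: "test_function \<eta>" for \<eta>
  proof -
    have "(\<integral>x. (f x - g x) * \<eta> x \<partial>lborel) = (\<integral>x. f x * \<eta> x \<partial>lborel) - (\<integral>x. g x * \<eta> x \<partial>lborel)"
      unfolding left_diff_distrib
      by (intro Bochner_Integration.integral_diff test_function_mult_integrable f g \<eta>)
    also have "(\<integral>x. f x * \<eta> x \<partial>lborel) = (\<integral>x. g x * \<eta> x \<partial>lborel)"
      using assms \<eta> unfolding weak_deriv_def by (auto simp: mi_deriv_0 mi_order_def)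
    finally show ?thesis by simp
  qed
  ultimately have "AE x in lborel. f x - g x = 0" by (rule fundamental_lemma_variations)
  then show ?thesis by eventually_elim simp
qed

lemma integrable_decay:
  fixes g :: "real^'n \<Rightarrow> complex"
  assumes "g \<in> borel_measurable borel" "\<And>x. cmod (g x) \<le> C * decay_kernel x"
  shows "integrable lborel g"
proof (rule Bochner_Integration.integrable_bound)
  show "integrable lborel (\<lambda>x::real^'n. C * decay_kernel x)"
    by (intro integrable_mult_right integrable_decay_kernel)
  show "AE x in lborel. norm (g x) \<le> norm (C * decay_kernel x)"
    using assms(2) by (intro AE_I2) (simp add: order_trans[OF _ abs_ge_self])
qed (use assms(1) in simp)

lemma regularD:
  fixes \<phi> :: "real^'n \<Rightarrow> complex"
  assumes "regular r \<phi>"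
  obtains C where "\<And>\<alpha>. mi_order \<alpha> \<le> r \<Longrightarrow> \<exists>g. weak_deriv \<alpha> \<phi> g \<and> (\<forall>x. cmod (g x) \<le> C * decay_kernel x)"
proof -
  obtain C where C: "C > 0" and g: "\<And>\<alpha>. mi_order \<alpha> \<le> r \<Longrightarrow>
      \<exists>g. weak_deriv \<alpha> \<phi> g \<and> (\<forall>x. cmod (g x) \<le> C * (1 + norm x) powr (- real (2 * CARD('n))))"
    using assms unfolding regular_def by blast
  have "C * (1 + norm x) powr (- real (2 * CARD('n))) \<le> C * decay_kernel x" for x :: "real^'n"
    using C by (intro mult_left_mono rapid_decay_le_decay_kernel) auto
  note le = this
  show thesis
  proof (rule that)
    fix \<alpha> :: "'n \<Rightarrow> nat" assume "mi_order \<alpha> \<le> r"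
    then obtain h where h: "weak_deriv \<alpha> \<phi> h" "\<forall>x. cmod (h x) \<le> C * (1 + norm x) powr (- real (2 * CARD('n)))"
      using g by blast
    have "cmod (h x) \<le> C * decay_kernel x" for x by (rule order_trans[OF h(2)[rule_format] le])
    with h(1) show "\<exists>g. weak_deriv \<alpha> \<phi> g \<and> (\<forall>x. cmod (g x) \<le> C * decay_kernel x)" by blast
  qed
qed

lemma regular_integrable:
  assumes "regular r \<phi>" "\<phi> \<in> borel_measurable borel"
  shows "integrable lborel \<phi>"
proof -
  obtain C where C: "\<And>\<alpha>. mi_order \<alpha> \<le> r \<Longrightarrow> \<exists>g. weak_deriv \<alpha> \<phi> g \<and> (\<forall>x. cmod (g x) \<le> C * decay_kernel x)"
    using regularD[OF assms(1)] by blast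
  obtain g where g: "weak_deriv (\<lambda>_. 0) \<phi> g" "\<And>x. cmod (g x) \<le> C * decay_kernel x"
    using C[of "\<lambda>_. 0"] by (auto simp: mi_order_def)
  have [measurable]: "g \<in> borel_measurable borel" "\<phi> \<in> borel_measurable borel"
    using g(1) assms(2) by (auto simp: weak_deriv_def locally_integrable_def)
  have "integrable lborel g" by (rule integrable_decay[OF _ g(2)]) measurable
  moreover have "integrable lborel \<phi> \<longleftrightarrow> integrable lborel g"
    by (rule integrable_cong_AE[OF _ _ weak_deriv_0_imp_AE_eq[OF g(1)]]) measurable
  ultimately show ?thesis by simp
qed

lemma sobolev_weight_square_le:
  fixes \<xi> :: "real^'n"
  assumes "s \<le> real r"
  shows "(sobolev_weight s \<xi>)\<^sup>2 \<le> (real CARD('n) + 1) ^ r * (1 + (\<Sum>j\<in>UNIV. ((2 * pi * \<xi> $ j)\<^sup>2) ^ r))"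
proof -
  let ?y = "\<lambda>j. (2 * pi * \<xi> $ j)\<^sup>2" and ?b = "1 + 4 * pi\<^sup>2 * (norm \<xi>)\<^sup>2"
  \<comment> \<open>The sum is at most \<open>N + 1\<close> times its largest term, and the power of the largest term is one of the summands on the right.\<close>
  define m where "m = Max (insert 1 (range ?y))"
  have m: "m \<in> insert 1 (range ?y)" unfolding m_def by (rule Max_in) auto
  have m_ge: "1 \<le> m" "?y j \<le> m" for j unfolding m_def by (auto intro!: Max_ge simp del: Max_insert)
  have "(norm \<xi>)\<^sup>2 = (\<Sum>j\<in>UNIV. (\<xi> $ j)\<^sup>2)" by (simp add: norm_vec_def L2_set_def sum_nonneg)
  then have b: "?b = 1 + (\<Sum>j\<in>UNIV. ?y j)" by (simp add: power_mult_distrib sum_distrib_left)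
  have "(x powr (s / 2))\<^sup>2 = x powr s" for x :: real
    using powr_add[of x "s / 2" "s / 2"] by (simp add: power2_eq_square)
  then have "(sobolev_weight s \<xi>)\<^sup>2 = ?b powr s" unfolding sobolev_weight_def .
  also have "\<dots> \<le> ?b powr real r" using assms by (intro powr_mono) auto
  also have "\<dots> = ?b ^ r" by (rule powr_realpow) (simp add: add_pos_nonneg)
  also have "\<dots> \<le> ((real CARD('n) + 1) * m) ^ r"
  proof (rule power_mono)
    have "(\<Sum>j\<in>UNIV. ?y j) \<le> (\<Sum>j\<in>(UNIV::'n set). m)" by (intro sum_mono m_ge)
    then show "?b \<le> (real CARD('n) + 1) * m" unfolding b using m_ge(1) by (simp add: distrib_right)
  qed simp
  also have "\<dots> \<le> (real CARD('n) + 1) ^ r * (1 + (\<Sum>j\<in>UNIV. ?y j ^ r))"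
    unfolding power_mult_distrib[of _ m]
  proof (rule mult_left_mono)
    have nonneg: "0 \<le> (\<Sum>j\<in>UNIV. ?y j ^ r)" by (intro sum_nonneg) simp
    show "m ^ r \<le> 1 + (\<Sum>j\<in>UNIV. ?y j ^ r)"
    proof (cases "m = 1")
      case True
      then have "m ^ r = 1" by simp
      with nonneg show ?thesis by linarith
    next
      case False
      then obtain j where "m = ?y j" using m by auto
      then have "m ^ r \<le> (\<Sum>j\<in>UNIV. ?y j ^ r)" by (simp only:) (rule member_le_sum, auto)
      then show ?thesis by simp
    qed
  qed simp
  finally show ?thesis .
qed

text \<open>
  Bernstein's inequality on \<open>V\<^sub>0\<close> for finite linear combinations. By \<open>sobolev_weight_square_le\<close>, only the pure
  derivatives \<open>\<partial>\<^sub>j\<^sup>r\<phi>\<close> enter.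
\<close>

lemma translates_sobolev_bound:
  fixes \<phi> :: "real^'n \<Rightarrow> complex"
  assumes reg: "regular r \<phi>" and \<phi>: "\<phi> \<in> L2" and s: "s \<le> real r"
    and orth: "orthonormal (\<lambda>k x. \<phi> (x - k)) int_vectors"
  shows "\<exists>C\<ge>0. \<forall>(F :: 'b set) k c. finite F \<longrightarrow> inj_on k F \<longrightarrow> k ` F \<subseteq> int_vectors \<longrightarrow>
    (let Y = \<lambda>x. \<Sum>i\<in>F. c i * \<phi> (x - k i) in integrable lborel Y \<and>
     weighted_fourier s Y \<in> L2 \<and>
     l2_norm (weighted_fourier s Y) \<le> C * sqrt (\<Sum>i\<in>F. (cmod (c i))\<^sup>2))"
proof -
  have \<phi>1: "integrable lborel \<phi>" using reg L2_measurable[OF \<phi>] by (rule regular_integrable)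
  obtain C where C: "\<And>\<alpha>. mi_order \<alpha> \<le> r \<Longrightarrow> \<exists>g. weak_deriv \<alpha> \<phi> g \<and> (\<forall>x. cmod (g x) \<le> C * decay_kernel x)"
    by (rule regularD[OF reg]) (rule that)
  have "\<exists>g. weak_deriv (pure_index j r) \<phi> g \<and> (\<forall>x. cmod (g x) \<le> C * decay_kernel x)" for j
    by (rule C) (simp add: mi_order_pure)
  from choice[OF allI, OF this] obtain \<theta> where
    \<theta>: "\<forall>j. weak_deriv (pure_index j r) \<phi> (\<theta> j) \<and> (\<forall>x. cmod (\<theta> j x) \<le> C * decay_kernel x)" ..
  have \<theta>w: "weak_deriv (pure_index j r) \<phi> (\<theta> j)" and \<theta>C: "cmod (\<theta> j x) \<le> C * decay_kernel x" for j x
    using \<theta> by auto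
  have \<theta>m: "\<theta> j \<in> borel_measurable borel" for j
    using \<theta>w[of j] by (auto simp: weak_deriv_def locally_integrable_def)
  have \<theta>1: "integrable lborel (\<theta> j)" for j using \<theta>m \<theta>C by (rule integrable_decay)
  have "\<exists>A\<ge>0. \<forall>(F :: 'b set) k c. finite F \<longrightarrow> inj_on k F \<longrightarrow> k ` F \<subseteq> int_vectors \<longrightarrow>
     (\<lambda>x. \<Sum>i\<in>F. c i * \<theta> j (x - k i)) \<in> L2 \<and>
     (l2_norm (\<lambda>x. \<Sum>i\<in>F. c i * \<theta> j (x - k i)))\<^sup>2 \<le> A * (\<Sum>i\<in>F. (cmod (c i))\<^sup>2)" for j
    using \<theta>m \<theta>C by (rule translates_norm_bound)
  from choice[OF allI, OF this] obtain A where A: "\<forall>j. 0 \<le> A j \<and>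
     (\<forall>(F :: 'b set) k c. finite F \<longrightarrow> inj_on k F \<longrightarrow> k ` F \<subseteq> int_vectors \<longrightarrow>
     (\<lambda>x. \<Sum>i\<in>F. c i * \<theta> j (x - k i)) \<in> L2 \<and>
     (l2_norm (\<lambda>x. \<Sum>i\<in>F. c i * \<theta> j (x - k i)))\<^sup>2 \<le> A j * (\<Sum>i\<in>F. (cmod (c i))\<^sup>2))" ..
  have A0: "0 \<le> A j" for j using A[THEN spec, of j] by (rule conjunct1)
  define D where "D = (real CARD('n) + 1) ^ r"
  have D: "0 \<le> D" by (simp add: D_def)
  let ?C = "sqrt (D * (1 + (\<Sum>j\<in>UNIV. A j)))"
  have C2: "0 \<le> D * (1 + (\<Sum>j\<in>UNIV. A j))" using D A0 by (intro mult_nonneg_nonneg add_nonneg_nonneg sum_nonneg) auto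
  have main: "integrable lborel (\<lambda>x. \<Sum>i\<in>F. c i * \<phi> (x - k i)) \<and>
     (weighted_fourier s (\<lambda>x. \<Sum>i\<in>F. c i * \<phi> (x - k i))) \<in> L2 \<and>
     l2_norm (weighted_fourier s (\<lambda>x. \<Sum>i\<in>F. c i * \<phi> (x - k i)))
       \<le> ?C * sqrt (\<Sum>i\<in>F. (cmod (c i))\<^sup>2)"
    if F: "finite F" "inj_on k F" "k ` F \<subseteq> int_vectors" for F :: "'b set" and k c
  proof -
    define Y where "Y = (\<lambda>x. \<Sum>i\<in>F. c i * \<phi> (x - k i))"
    define T where "T j = (\<lambda>x. \<Sum>i\<in>F. c i * \<theta> j (x - k i))" for j
    let ?S = "\<Sum>i\<in>F. (cmod (c i))\<^sup>2"
    have Y1: "integrable lborel Y"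
      unfolding Y_def by (intro Bochner_Integration.integrable_sum integrable_mult_right integrable_lborel_translate \<phi>1)
    have T1: "integrable lborel (T j)" for j
      unfolding T_def by (intro Bochner_Integration.integrable_sum integrable_mult_right integrable_lborel_translate \<theta>1)
    have T2: "T j \<in> L2" "(l2_norm (T j))\<^sup>2 \<le> A j * ?S" for j
      using A F unfolding T_def by blast+
    have orthF: "orthonormal (\<lambda>i x. \<phi> (x - k i)) F"
      unfolding orthonormal_def
    proof (intro conjI ballI)
      show "(\<lambda>x. \<phi> (x - k i)) \<in> L2" if "i \<in> F" for i
        using F(3) that by (intro orthonormal_L2[OF orth]) auto
      show "l2_inner (\<lambda>x. \<phi> (x - k i)) (\<lambda>x. \<phi> (x - k l)) = (if i = l then 1 else 0)" if "i \<in> F" "l \<in> F" for i l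
      proof -
        have "k i \<in> int_vectors" "k l \<in> int_vectors" using F(3) that by auto
        from orthonormal_inner[OF orth this] show ?thesis by (simp add: inj_on_eq_iff[OF F(2) that])
      qed
    qed
    have Y2: "Y \<in> L2" "(l2_norm Y)\<^sup>2 = ?S"
      unfolding Y_def
      by (rule L2_lincomb[OF orthF order_refl], rule l2_norm_orthonormal_lincomb[OF orthF F(1) order_refl])
    have FT: "fourier_L1 (T j) \<xi> = (2 * of_real pi * \<i> * of_real (\<xi> $ j)) ^ r * fourier_L1 Y \<xi>" for j \<xi>
    proof -
      have "fourier_L1 (T j) \<xi> = (\<Sum>i\<in>F. c i * (fourier_character \<xi> (k i) * fourier_L1 (\<theta> j) \<xi>))"
        unfolding T_def by (subst fourier_L1_sum) (auto simp only: fourier_L1_translate[OF \<theta>1] intro!: integrable_lborel_translate \<theta>1)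
      also have "\<dots> = (2 * of_real pi * \<i> * of_real (\<xi> $ j)) ^ r * (\<Sum>i\<in>F. c i * (fourier_character \<xi> (k i) * fourier_L1 \<phi> \<xi>))"
        unfolding fourier_weak_deriv[OF \<phi>1 \<theta>1 \<theta>w] sum_distrib_left by (simp only: mult_ac)
      also have "(\<Sum>i\<in>F. c i * (fourier_character \<xi> (k i) * fourier_L1 \<phi> \<xi>)) = fourier_L1 Y \<xi>"
        unfolding Y_def by (subst fourier_L1_sum) (auto simp only: fourier_L1_translate[OF \<phi>1] intro!: integrable_lborel_translate \<phi>1)
      finally show ?thesis .
    qed
    have FT2: "(cmod (fourier_L1 (T j) \<xi>))\<^sup>2 = ((2 * pi * \<xi> $ j)\<^sup>2) ^ r * (cmod (fourier_L1 Y \<xi>))\<^sup>2" for j \<xi>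
    proof -
      have "cmod (2 * of_real pi * \<i> * of_real (\<xi> $ j)) = \<bar>2 * pi * \<xi> $ j\<bar>"
        by (simp add: norm_mult abs_mult)
      then show ?thesis
        unfolding FT norm_mult norm_power power_mult_distrib[of "_ ^ r"]
        by (simp flip: power_mult add: mult.commute[of r]) (simp add: power_mult)
    qed
    note fY = fourier_L1_L2[OF Y1 Y2(1)] and fT = fourier_L1_L2[OF T1 T2(1)]
    note [measurable] = L2_measurable[OF fY(1)] L2_measurable[OF fT(1)]
    have "(\<integral>\<^sup>+\<xi>. ennreal ((cmod (of_real (sobolev_weight s \<xi>) * fourier_L1 Y \<xi>))\<^sup>2) \<partial>lborel) \<le>
      (\<integral>\<^sup>+\<xi>. ennreal D * (ennreal ((cmod (fourier_L1 Y \<xi>))\<^sup>2) + (\<Sum>j\<in>UNIV. ennreal ((cmod (fourier_L1 (T j) \<xi>))\<^sup>2))) \<partial>lborel)"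
    proof (intro nn_integral_mono)
      fix \<xi> :: "real^'n"
      have "(cmod (of_real (sobolev_weight s \<xi>) * fourier_L1 Y \<xi>))\<^sup>2 = (sobolev_weight s \<xi>)\<^sup>2 * (cmod (fourier_L1 Y \<xi>))\<^sup>2"
        by (simp add: norm_mult power_mult_distrib)
      also have "\<dots> \<le> (D * (1 + (\<Sum>j\<in>UNIV. ((2 * pi * \<xi> $ j)\<^sup>2) ^ r))) * (cmod (fourier_L1 Y \<xi>))\<^sup>2"
        unfolding D_def by (intro mult_right_mono sobolev_weight_square_le s) simp
      also have "\<dots> = D * ((cmod (fourier_L1 Y \<xi>))\<^sup>2 + (\<Sum>j\<in>UNIV. (cmod (fourier_L1 (T j) \<xi>))\<^sup>2))"
        unfolding FT2 by (simp only: mult.assoc distrib_right sum_distrib_right mult_1_left)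
      finally show "ennreal ((cmod (of_real (sobolev_weight s \<xi>) * fourier_L1 Y \<xi>))\<^sup>2) \<le>
        ennreal D * (ennreal ((cmod (fourier_L1 Y \<xi>))\<^sup>2) + (\<Sum>j\<in>UNIV. ennreal ((cmod (fourier_L1 (T j) \<xi>))\<^sup>2)))"
        using D by (simp add: ennreal_leI sum_nonneg flip: ennreal_mult ennreal_plus)
    qed
    also have "\<dots> = ennreal D * (ennreal ((l2_norm (fourier_L1 Y))\<^sup>2) + (\<Sum>j\<in>UNIV. ennreal ((l2_norm (fourier_L1 (T j)))\<^sup>2)))"
      by (simp add: nn_integral_cmult nn_integral_add nn_integral_sum l2_norm_nn_integral[OF fY(1)]
          l2_norm_nn_integral[OF fT(1)] del: sum_ennreal)
    also have "\<dots> = ennreal (D * ((l2_norm (fourier_L1 Y))\<^sup>2 + (\<Sum>j\<in>UNIV. (l2_norm (fourier_L1 (T j)))\<^sup>2)))"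
      using D by (simp add: sum_nonneg flip: ennreal_mult ennreal_plus)
    also have "\<dots> \<le> ennreal (D * (?S + (\<Sum>j\<in>UNIV. A j * ?S)))"
    proof (intro ennreal_leI mult_left_mono add_mono sum_mono D)
      show "(l2_norm (fourier_L1 Y))\<^sup>2 \<le> ?S"
        using power_mono[OF fY(2) l2_norm_nonneg, of 2] unfolding Y2(2) .
      show "(l2_norm (fourier_L1 (T j)))\<^sup>2 \<le> A j * ?S" for j
        by (rule order_trans[OF power_mono[OF fT(2) l2_norm_nonneg] T2(2)])
    qed
    also have "D * (?S + (\<Sum>j\<in>UNIV. A j * ?S)) = (?C * sqrt ?S)\<^sup>2"
    proof -
      have "(sqrt ?S)\<^sup>2 = ?S" by (intro real_sqrt_pow2 sum_nonneg) simp
      then show ?thesis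
        unfolding power_mult_distrib real_sqrt_pow2[OF C2] sum_distrib_right[symmetric]
        by (simp only: distrib_left distrib_right mult_1_left mult_1_right mult.assoc)
    qed
    finally have "(\<integral>\<^sup>+\<xi>. ennreal ((cmod (of_real (sobolev_weight s \<xi>) * fourier_L1 Y \<xi>))\<^sup>2) \<partial>lborel)
      \<le> ennreal ((?C * sqrt ?S)\<^sup>2)" .
    moreover have "weighted_fourier s Y \<in> borel_measurable borel" by measurable
    moreover have "0 \<le> ?C * sqrt ?S" by (intro mult_nonneg_nonneg real_sqrt_ge_zero C2 sum_nonneg zero_le_power2)
    ultimately show ?thesis
      using Y1 L2_nn_integralI[of "weighted_fourier s Y" "?C * sqrt ?S"]
      unfolding Y_def by (intro conjI)
  qed
  show ?thesis
    unfolding Let_def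
    by (intro exI[of _ ?C] conjI allI impI real_sqrt_ge_zero C2 main[THEN conjunct1]
        main[THEN conjunct2, THEN conjunct1] main[THEN conjunct2, THEN conjunct2])
qed

section \<open>Bernstein's inequality\<close>

lemma closed_subspace_L2: "closed_subspace S \<Longrightarrow> S \<subseteq> L2"
  unfolding closed_subspace_def by (elim conjE)

lemma closed_subspace_add:
  assumes "closed_subspace S" "u \<in> S" "v \<in> S"
  shows "(\<lambda>x. u x + v x) \<in> S"
proof -
  have "\<forall>u\<in>S. \<forall>v\<in>S. (\<lambda>x. u x + v x) \<in> S"
    using assms(1) unfolding closed_subspace_def by (elim conjE)
  then show ?thesis using assms(2,3) by blast
qed

lemma closed_subspace_mult:
  assumes "closed_subspace S" "u \<in> S"
  shows "(\<lambda>x. c * u x) \<in> S"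
proof -
  have "\<forall>c. \<forall>u\<in>S. (\<lambda>x. c * u x) \<in> S"
    using assms(1) unfolding closed_subspace_def by (elim conjE)
  then show ?thesis using assms(2) by blast
qed

lemma closed_subspace_sum:
  assumes S: "closed_subspace S" and f: "\<And>i. i \<in> F \<Longrightarrow> f i \<in> S"
  shows "(\<lambda>x. \<Sum>i\<in>F. f i x) \<in> S"
  using f
proof (induction F rule: infinite_finite_induct)
  case (insert i F)
  then have "(\<lambda>x. f i x + (\<Sum>i\<in>F. f i x)) \<in> S" by (intro closed_subspace_add[OF S]) auto
  then show ?case using insert by simp
next
  case empty
  show ?case using S unfolding closed_subspace_def by (elim conjE) simp
next
  case (infinite F)
  then show ?case using S unfolding closed_subspace_def by (elim conjE) simp
qed

lemma closed_subspace_diff: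
  assumes "closed_subspace S" "u \<in> S" "v \<in> S"
  shows "(\<lambda>x. u x - v x) \<in> S"
proof -
  have "(\<lambda>x. u x + (- 1) * v x) \<in> S"
    using assms by (intro closed_subspace_add closed_subspace_mult)
  then show ?thesis by simp
qed

lemma closed_subspace_limit:
  assumes "closed_subspace S" "\<And>n. X n \<in> S" "l2_tendsto X u sequentially"
  shows "u \<in> S"
proof -
  have "\<forall>X u. (\<forall>n. X n \<in> S) \<longrightarrow> l2_tendsto X u sequentially \<longrightarrow> u \<in> S"
    using assms(1) unfolding closed_subspace_def by (elim conjE)
  then show ?thesis using assms(2,3) by blast
qed

lemma closed_subspace_cong_AE:
  assumes S: "closed_subspace S" and u: "u \<in> S" and v: "v \<in> L2" and eq: "AE x in lborel. u x = v x"
  shows "v \<in> S"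
proof -
  have uL: "u \<in> L2" using S u closed_subspace_L2 by blast
  have "AE x in lborel. u x - v x = 0" using eq by eventually_elim simp
  then have "l2_dist u v = 0" using l2_norm_eq_0_iff[OF L2_diff[OF uL v]] by blast
  then have "l2_tendsto (\<lambda>_. u) v sequentially" using uL v by (simp add: l2_tendsto_def)
  with S u show ?thesis by (rule closed_subspace_limit)
qed

lemma closed_subspace_has_sum:
  assumes S: "closed_subspace S" and f: "\<And>i. i \<in> I \<Longrightarrow> f i \<in> S" and u: "l2_has_sum f I u"
  shows "u \<in> S"
proof -
  have lim: "((\<lambda>F. l2_norm (\<lambda>x. (\<Sum>i\<in>F. f i x) - u x)) \<longlongrightarrow> 0) (finite_subsets_at_top I)"
    using u by (simp add: l2_has_sum_def l2_tendsto_def)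
  have "\<exists>v. v \<in> S \<and> l2_dist v u < 1 / real (Suc n)" for n
  proof -
    have "\<forall>\<^sub>F F in finite_subsets_at_top I. dist (l2_norm (\<lambda>x. (\<Sum>i\<in>F. f i x) - u x)) 0 < 1 / real (Suc n)"
      by (rule tendstoD[OF lim]) simp
    then obtain F where F: "finite F" "F \<subseteq> I" "l2_norm (\<lambda>x. (\<Sum>i\<in>F. f i x) - u x) < 1 / real (Suc n)"
      by (auto simp: eventually_finite_subsets_at_top)
    have "(\<lambda>x. \<Sum>i\<in>F. f i x) \<in> S" using F(2) f by (intro closed_subspace_sum[OF S]) auto
    with F(3) show ?thesis by blast
  qed
  from choice[OF allI, OF this] obtain X where X: "\<forall>n. X n \<in> S \<and> l2_dist (X n) u < 1 / real (Suc n)" ..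
  have "(\<lambda>n. l2_dist (X n) u) \<longlonglongrightarrow> 0"
  proof (rule tendsto_sandwich[OF _ _ tendsto_const LIMSEQ_Suc[OF lim_1_over_n]])
    show "\<forall>\<^sub>F n in sequentially. l2_dist (X n) u \<le> 1 / real (Suc n)"
      using X by (intro always_eventually allI less_imp_le) blast
  qed simp
  then have Xu: "l2_tendsto X u sequentially"
    using X closed_subspace_L2[OF S] l2_has_sum_L2[OF u] unfolding l2_tendsto_def by (blast intro: always_eventually)
  have "X n \<in> S" for n using X by blast
  then show ?thesis by (rule closed_subspace_limit[OF S _ Xu])
qed

lemma mra_closed: "mra V \<phi> \<Longrightarrow> closed_subspace (V j)"
  by (simp add: mra_def)

lemma mra_L2: "mra V \<phi> \<Longrightarrow> V j \<subseteq> L2"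
  by (intro closed_subspace_L2 mra_closed)

lemma Gamma_scaled:
  assumes "\<mu> \<in> Gamma j"
  shows "2 powi j *\<^sub>R \<mu> \<in> int_vectors"
proof -
  obtain k where k: "k \<in> int_vectors" "\<mu> = 2 powi (- j) *\<^sub>R k" using assms by (auto simp: Gamma_def)
  have "(2::real) powi j * 2 powi (- j) = 1" by (simp add: power_int_minus)
  then show ?thesis using k by simp
qed

lemma scaling_lincomb_sobolev_bound:
  fixes \<phi> :: "real^'n \<Rightarrow> complex"
  assumes mra: "mra V \<phi>" and reg: "regular r \<phi>" and s: "0 \<le> s" "s \<le> real r"
  shows "\<exists>C\<ge>0. \<forall>j\<ge>0. \<forall>F\<subseteq>Gamma j. \<forall>c. finite F \<longrightarrow>
    (let X = \<lambda>x. \<Sum>\<mu>\<in>F. c \<mu> * scaling \<phi> j \<mu> x in integrable lborel X \<and>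
     weighted_fourier s X \<in> L2 \<and>
     l2_norm (weighted_fourier s X)
       \<le> C * 2 powr (of_int j * s) * sqrt (\<Sum>\<mu>\<in>F. (cmod (c \<mu>))\<^sup>2))"
proof -
  have \<phi>: "\<phi> \<in> L2" using mra mra_L2[OF mra, of 0] by (auto simp: mra_def)
  have orth: "orthonormal (\<lambda>k x. \<phi> (x - k)) int_vectors"
    using mra by (intro orthonormal_basis_orthonormal[OF _ mra_L2[OF mra, of 0]]) (simp add: mra_def)
  obtain C where C: "0 \<le> C" and CY: "\<forall>(F :: (real^'n) set) k c. finite F \<longrightarrow> inj_on k F \<longrightarrow> k ` F \<subseteq> int_vectors \<longrightarrow>
    (let Y = \<lambda>x. \<Sum>i\<in>F. c i * \<phi> (x - k i) in integrable lborel Y \<and>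
     weighted_fourier s Y \<in> L2 \<and>
     l2_norm (weighted_fourier s Y) \<le> C * sqrt (\<Sum>i\<in>F. (cmod (c i))\<^sup>2))"
    using translates_sobolev_bound[OF reg \<phi> s(2) orth] by blast
  have main: "integrable lborel X \<and>
     weighted_fourier s X \<in> L2 \<and>
     l2_norm (weighted_fourier s X)
       \<le> C * 2 powr (of_int j * s) * sqrt (\<Sum>\<mu>\<in>F. (cmod (c \<mu>))\<^sup>2)"
    if j: "j \<ge> 0" and F: "F \<subseteq> Gamma j" "finite F" and X: "X = (\<lambda>x. \<Sum>\<mu>\<in>F. c \<mu> * scaling \<phi> j \<mu> x)"
    for j F c X
  proof -
    define q where "q = (2::real) powi j"
    define a where "a = (2::real) powr (real CARD('n) * of_int j / 2)"
    define Y where "Y = (\<lambda>x. \<Sum>\<mu>\<in>F. c \<mu> * \<phi> (x - q *\<^sub>R \<mu>))"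
    have q: "q = 2 powr of_int j" by (simp add: q_def powr_real_of_int')
    have q1: "1 \<le> q" unfolding q using j by (intro ge_one_powr_ge_zero) auto
    have "inj_on (\<lambda>\<mu>. q *\<^sub>R \<mu>) F" using q1 by (intro inj_onI) simp
    moreover have "(\<lambda>\<mu>. q *\<^sub>R \<mu>) ` F \<subseteq> int_vectors" using F(1) Gamma_scaled by (auto simp: q_def)
    ultimately have Y: "integrable lborel Y" "weighted_fourier s Y \<in> L2"
      "l2_norm (weighted_fourier s Y) \<le> C * sqrt (\<Sum>\<mu>\<in>F. (cmod (c \<mu>))\<^sup>2)"
      using CY[rule_format, OF F(2), of "\<lambda>\<mu>. q *\<^sub>R \<mu>" c] unfolding Let_def Y_def by simp_all
    have "\<bar>a\<bar>\<^sup>2 = 2 powr (real CARD('n) * of_int j)"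
      unfolding a_def by (simp add: power2_eq_square flip: powr_add) (simp only: mult.commute)
    also have "\<dots> = q ^ CARD('n)"
      unfolding q by (simp add: powr_power)
    finally have a2: "\<bar>a\<bar>\<^sup>2 = q ^ CARD('n)" .
    have XY: "X = (\<lambda>x. of_real a * Y (q *\<^sub>R x))"
      unfolding X Y_def scaling_def a_def[symmetric] q_def[symmetric] sum_distrib_left by (simp only: mult_ac)
    have "integrable lborel X"
      unfolding XY using q1 by (intro integrable_mult_right integrable_lborel_scale Y) simp
    moreover note sobolev_norm_scale[OF q1 s(1) Y(1) a2 Y(2), folded XY]
    moreover have "q powr s * l2_norm (weighted_fourier s Y)
       \<le> C * 2 powr (of_int j * s) * sqrt (\<Sum>\<mu>\<in>F. (cmod (c \<mu>))\<^sup>2)"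
      using mult_left_mono[OF Y(3), of "q powr s"] by (simp add: q powr_powr mult_ac)
    ultimately show ?thesis by (intro conjI) (assumption, assumption, rule order_trans)
  qed
  show ?thesis
    unfolding Let_def
    by (intro exI[of _ C] conjI allI impI C main[OF _ _ _ refl, THEN conjunct1]
        main[OF _ _ _ refl, THEN conjunct2, THEN conjunct1] main[OF _ _ _ refl, THEN conjunct2, THEN conjunct2])
qed

text \<open>
  The expansion of \<open>g\<close> in translates of the dilated scaling function is approximated by its finite partial
  sums, whose norms do not exceed the norm of \<open>g\<close>.
\<close>

theorem Bernstein:
  fixes \<phi> :: "real^'n \<Rightarrow> complex"
  assumes mra: "mra V \<phi>" and reg: "regular r \<phi>" and s: "0 \<le> s" "s \<le> real r"
    and basis: "\<And>j. orthonormal_basis (scaling \<phi> j) (Gamma j) (V j)"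
  shows "\<exists>C\<ge>0. \<forall>j\<ge>0. \<forall>g\<in>V j. sobolev_bounded s (C * 2 powr (of_int j * s) * l2_norm g) g"
proof -
  obtain C where C: "0 \<le> C" and CX: "\<forall>j\<ge>0. \<forall>F\<subseteq>Gamma j. \<forall>c. finite F \<longrightarrow>
    (let X = \<lambda>x. \<Sum>\<mu>\<in>F. c \<mu> * scaling \<phi> j \<mu> x in integrable lborel X \<and>
     weighted_fourier s X \<in> L2 \<and>
     l2_norm (weighted_fourier s X)
       \<le> C * 2 powr (of_int j * s) * sqrt (\<Sum>\<mu>\<in>F. (cmod (c \<mu>))\<^sup>2))"
    using scaling_lincomb_sobolev_bound[OF mra reg s] by blast
  have "sobolev_bounded s (C * 2 powr (of_int j * s) * l2_norm g) g" if j: "j \<ge> 0" and g: "g \<in> V j" for j g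
    unfolding sobolev_bounded_def
  proof (intro conjI allI impI)
    show gL: "g \<in> L2" using g mra_L2[OF mra] by blast
    fix e :: real assume "e > 0"
    obtain F where F: "finite F" "F \<subseteq> Gamma j"
      "l2_norm (\<lambda>x. (\<Sum>\<mu>\<in>F. l2_inner g (scaling \<phi> j \<mu>) * scaling \<phi> j \<mu> x) - g x) < e"
      by (rule orthonormal_basis_approx[OF basis mra_L2[OF mra] g \<open>e > 0\<close>])
    have orth: "orthonormal (scaling \<phi> j) (Gamma j)"
      by (rule orthonormal_basis_orthonormal[OF basis mra_L2[OF mra]])
    let ?X = "\<lambda>x. \<Sum>\<mu>\<in>F. l2_inner g (scaling \<phi> j \<mu>) * scaling \<phi> j \<mu> x"
    let ?S = "\<Sum>\<mu>\<in>F. (cmod (l2_inner g (scaling \<phi> j \<mu>)))\<^sup>2"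
    have X: "integrable lborel ?X" "weighted_fourier s ?X \<in> L2"
      "l2_norm (weighted_fourier s ?X) \<le> C * 2 powr (of_int j * s) * sqrt ?S"
      using CX[rule_format, OF j F(2,1), of "\<lambda>\<mu>. l2_inner g (scaling \<phi> j \<mu>)"] unfolding Let_def by simp_all
    have "sqrt ?S \<le> l2_norm g"
      using Bessel_finite[OF orth F(1,2) gL] by (intro real_le_lsqrt) auto
    then have "C * 2 powr (of_int j * s) * sqrt ?S \<le> C * 2 powr (of_int j * s) * l2_norm g"
      using C by (intro mult_left_mono) auto
    then have "l2_norm (weighted_fourier s ?X) \<le> C * 2 powr (of_int j * s) * l2_norm g"
      using X(3) by (rule order_trans[rotated])
    moreover have "?X \<in> L2" by (rule L2_lincomb[OF orth F(2)])
    ultimately show "\<exists>X\<in>L2. integrable lborel X \<and> l2_dist X g < e \<and>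
     weighted_fourier s X \<in> L2 \<and>
     l2_norm (weighted_fourier s X) \<le> C * 2 powr (of_int j * s) * l2_norm g"
      using X(1,2) F(3) by (intro bexI[of _ ?X] conjI)
  qed
  then show ?thesis using C by blast
qed

section \<open>Wavelet bases\<close>

text \<open>
  The orthonormal wavelets corresponding to a multiresolution analysis, without regularity assumptions.
\<close>

locale wavelet_mra =
  fixes V :: "int \<Rightarrow> (real^'n \<Rightarrow> complex) set" and \<phi> :: "real^'n \<Rightarrow> complex"
    and \<psi> :: "real^'n \<Rightarrow> real^'n \<Rightarrow> complex"
  assumes mra: "mra V \<phi>" and corresponds: "corresponds \<psi> V \<phi>"
begin

text \<open>
  The orthogonal complement of \<open>V j\<close> in \<open>V (j + 1)\<close>.
\<close>

abbreviation W :: "int \<Rightarrow> (real^'n \<Rightarrow> complex) set" where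
  "W \<equiv> detail_space V"

lemma V_closed: "closed_subspace (V j)"
  using mra by (rule mra_closed)

lemma V_L2: "V j \<subseteq> L2"
  using mra by (rule mra_L2)

lemma V_mono:
  assumes "i \<le> j"
  shows "V i \<subseteq> V j"
  using assms
proof (induction j rule: int_ge_induct)
  case (step j)
  have "\<forall>j. V j \<subseteq> V (j + 1)" using mra unfolding mra_def by (elim conjE)
  with step show ?case by blast
qed simp

lemma W_V: "W j \<subseteq> V (j + 1)"
  by (auto simp: detail_space_def)

lemma W_L2: "W j \<subseteq> L2"
  using W_V V_L2 by blast

lemma W_orthogonal: "w \<in> W j \<Longrightarrow> v \<in> V j \<Longrightarrow> l2_inner w v = 0"
  by (simp add: detail_space_def)

lemma wavelet_basis: "orthonormal_basis (wavelet \<psi>) (Lambda j) (W j)"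
  using corresponds by (simp add: corresponds_def)

lemma scaling_basis: "orthonormal_basis (scaling \<phi> j) (Gamma j) (V j)"
  using corresponds by (simp add: corresponds_def)

lemma wavelet_W: "\<mu> \<in> Lambda j \<Longrightarrow> wavelet \<psi> \<mu> \<in> W j"
  using wavelet_basis by (simp add: orthonormal_basis_def)

lemma scaling_V: "\<mu> \<in> Gamma j \<Longrightarrow> scaling \<phi> j \<mu> \<in> V j"
  using scaling_basis by (simp add: orthonormal_basis_def)

lemma wavelet_V:
  assumes "\<mu> \<in> Lambda j" "j < k"
  shows "wavelet \<psi> \<mu> \<in> V k"
proof -
  have "V (j + 1) \<subseteq> V k" using assms(2) by (intro V_mono) simp
  then show ?thesis using wavelet_W[OF assms(1)] W_V[of j] by (blast intro: subsetD)
qed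

lemma wavelet_L2: "\<mu> \<in> Lambda j \<Longrightarrow> wavelet \<psi> \<mu> \<in> L2"
  using wavelet_W W_L2 by blast

lemma basis_orthogonal:
  assumes basis: "orthonormal_basis f I S" "S \<subseteq> L2" and u: "u \<in> L2" "\<And>i. i \<in> I \<Longrightarrow> l2_inner u (f i) = 0"
    and v: "v \<in> S"
  shows "l2_inner u v = 0"
proof -
  have f: "f i \<in> L2" if "i \<in> I" for i
    using basis that by (auto simp: orthonormal_basis_def)
  have "((\<lambda>i. l2_inner v (f i) * l2_inner (f i) u) has_sum l2_inner v u) I"
    by (rule l2_has_sum_inner[OF orthonormal_basis_expansion[OF basis v] f u(1)])
  moreover have "((\<lambda>i. l2_inner v (f i) * l2_inner (f i) u) has_sum 0) I"
    by (rule has_sum_0) (simp add: u(2) l2_inner_commute[of "f _" u])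
  ultimately have "l2_inner v u = 0" by (rule has_sum_unique)
  then show ?thesis by (subst l2_inner_commute) simp
qed

lemma projection_V:
  assumes u: "u \<in> L2"
  obtains p where "p \<in> V j" "\<And>v. v \<in> V j \<Longrightarrow> l2_inner (\<lambda>x. u x - p x) v = 0"
proof -
  have orth: "orthonormal (scaling \<phi> j) (Gamma j)"
    by (rule orthonormal_basis_orthonormal[OF scaling_basis V_L2])
  obtain p where p: "l2_has_sum (\<lambda>\<mu> x. l2_inner u (scaling \<phi> j \<mu>) * scaling \<phi> j \<mu> x) (Gamma j) p"
    using orthonormal_has_sum_exists[OF orth Bessel_summable[OF orth u]] by blast
  have pL: "p \<in> L2" using p by (rule l2_has_sum_L2)
  have "p \<in> V j"
    by (rule closed_subspace_has_sum[OF V_closed _ p]) (intro closed_subspace_mult V_closed scaling_V)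
  moreover have "l2_inner (\<lambda>x. u x - p x) v = 0" if "v \<in> V j" for v
  proof (rule basis_orthogonal[OF scaling_basis V_L2 L2_diff[OF u pL] _ that])
    fix \<mu> :: "real^'n" assume \<mu>: "\<mu> \<in> Gamma j"
    then show "l2_inner (\<lambda>x. u x - p x) (scaling \<phi> j \<mu>) = 0"
      using l2_has_sum_coeff[OF orth p order_refl \<mu>] u pL orthonormal_L2[OF orth \<mu>]
      by (simp add: l2_inner_diff_left)
  qed
  ultimately show thesis by (rule that)
qed

text \<open>
  This is \<open>V\<^bsub>j+1\<^esub> = V\<^sub>j \<oplus> W\<^sub>j\<close>.
\<close>

lemma V_decomposition:
  assumes v: "v \<in> V (j + 1)"
  obtains p where "p \<in> V j" "(\<lambda>x. v x - p x) \<in> W j"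
proof -
  have vL: "v \<in> L2" using v V_L2 by blast
  obtain p where p: "p \<in> V j" "\<And>w. w \<in> V j \<Longrightarrow> l2_inner (\<lambda>x. v x - p x) w = 0"
    using projection_V[OF vL] by blast
  have "p \<in> V (j + 1)" using p(1) V_mono[of j "j + 1"] by auto
  then have "(\<lambda>x. v x - p x) \<in> V (j + 1)" using v by (intro closed_subspace_diff V_closed)
  with p(2) have "(\<lambda>x. v x - p x) \<in> W j" by (simp add: detail_space_def)
  with p(1) show thesis by (rule that)
qed

lemma orthogonal_V_imp_zero:
  assumes u: "u \<in> L2" and 0: "\<And>n v. v \<in> V (int n) \<Longrightarrow> l2_inner u v = 0"
  shows "AE x in lborel. u x = 0"
proof -
  have "l2_norm u \<le> e" if e: "e > 0" for e
  proof -
    obtain j v where v: "v \<in> V j" "l2_dist u v < e"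
    proof -
      have "\<forall>u\<in>L2. \<forall>e>0. \<exists>v\<in>(\<Union>j. V j). l2_dist u v < e"
        using mra unfolding mra_def by (elim conjE)
      then show thesis using that u e by blast
    qed
    have vL: "v \<in> L2" using v V_L2 by blast
    have "v \<in> V (int (nat j))" using v(1) V_mono[of j "int (nat j)"] by auto
    then have "l2_inner u v = 0" by (rule 0)
    then have "l2_inner u u = l2_inner u (\<lambda>x. u x - v x)"
      using u vL by (simp add: l2_inner_diff_right)
    then have "(l2_norm u)\<^sup>2 = cmod (l2_inner u (\<lambda>x. u x - v x))"
      using arg_cong[OF l2_inner_self[of u], of cmod] unfolding norm_of_real by simp
    also have "\<dots> \<le> l2_norm u * l2_dist u v"
      by (rule l2_Cauchy_Schwarz[OF u L2_diff[OF u vL]])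
    also have "\<dots> \<le> l2_norm u * e" using v(2) by (intro mult_left_mono) auto
    finally have le: "l2_norm u * l2_norm u \<le> l2_norm u * e" by (simp add: power2_eq_square)
    show ?thesis
    proof (cases "l2_norm u = 0")
      case False
      then have "0 < l2_norm u" by (simp add: less_le)
      with le show ?thesis by (rule mult_left_le_imp_le)
    qed (use e in simp)
  qed
  then have "l2_norm u \<le> 0" using field_le_epsilon[of "l2_norm u" 0] by simp
  then have "l2_norm u = 0" by (intro antisym l2_norm_nonneg)
  then show ?thesis by (rule l2_norm_eq_0_iff[OF u, THEN iffD1])
qed

text \<open>
  Wavelets indexed by pairs \<open>(j, \<mu>)\<close> with \<open>\<mu> \<in> \<Lambda>\<^sub>j\<close>; the level is redundant in the definition of the wavelet.
\<close>

abbreviation wave :: "int \<times> (real^'n) \<Rightarrow> real^'n \<Rightarrow> complex" where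
  "wave p \<equiv> wavelet \<psi> (snd p)"

abbreviation all_index :: "(int \<times> (real^'n)) set" where
  "all_index \<equiv> (SIGMA j:UNIV. Lambda j)"

lemma wave_orthonormal: "orthonormal wave all_index"
  unfolding orthonormal_def
proof (intro conjI ballI)
  fix p assume p: "p \<in> all_index"
  then show "wave p \<in> L2" by (auto intro: wavelet_L2)
  fix q assume q: "q \<in> all_index"
  consider "fst p = fst q" | "fst p < fst q" | "fst q < fst p" by linarith
  then show "l2_inner (wave p) (wave q) = (if p = q then 1 else 0)"
  proof cases
    case 1
    then have "snd p \<in> Lambda (fst p)" "snd q \<in> Lambda (fst p)" using p q by auto
    then have "l2_inner (wave p) (wave q) = (if snd p = snd q then 1 else 0)"
      using wavelet_basis[of "fst p"] unfolding orthonormal_basis_def by blast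
    then show ?thesis using 1 by (simp add: prod_eq_iff)
  next
    case 2
    then have "l2_inner (wave q) (wave p) = 0"
      using p q by (intro W_orthogonal[of _ "fst q"] wavelet_W wavelet_V[of _ "fst p"]) auto
    then show ?thesis using 2 by (subst l2_inner_commute) auto
  next
    case 3
    then have "l2_inner (wave p) (wave q) = 0"
      using p q by (intro W_orthogonal[of _ "fst p"] wavelet_W wavelet_V[of _ "fst q"]) auto
    then show ?thesis using 3 by auto
  qed
qed

lemma scaling_wave_total:
  assumes u: "u \<in> L2" and sc: "\<And>\<mu>. \<mu> \<in> Gamma 0 \<Longrightarrow> l2_inner u (scaling \<phi> 0 \<mu>) = 0"
    and wv: "\<And>p. p \<in> fine_index \<Longrightarrow> l2_inner u (wave p) = 0"
  shows "AE x in lborel. u x = 0"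
proof (rule orthogonal_V_imp_zero[OF u])
  show "l2_inner u v = 0" if "v \<in> V (int n)" for n v
    using that
  proof (induction n arbitrary: v)
    case 0
    then show ?case using basis_orthogonal[OF scaling_basis V_L2 u sc] by simp
  next
    case (Suc n)
    then have v: "v \<in> V (int n + 1)" by (simp add: add.commute)
    obtain p where p: "p \<in> V (int n)" "(\<lambda>x. v x - p x) \<in> W (int n)"
      using V_decomposition[OF v] by blast
    have "l2_inner u (wavelet \<psi> \<mu>) = 0" if "\<mu> \<in> Lambda (int n)" for \<mu>
      using wv[of "(int n, \<mu>)"] that by (simp add: fine_index_def)
    then have "l2_inner u (\<lambda>x. v x - p x) = 0"
      by (rule basis_orthogonal[OF wavelet_basis W_L2 u _ p(2)])
    moreover have "l2_inner u p = 0" by (rule Suc.IH[OF p(1)])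
    moreover have "v \<in> L2" "p \<in> L2" using v p(1) V_L2 by blast+
    ultimately show ?case using u by (simp add: l2_inner_diff_right)
  qed
qed

text \<open>
  If \<open>u\<close> is orthogonal to all wavelets, its projection \<open>p\<close> to \<open>V\<^sub>0\<close> is orthogonal to all \<open>W\<^sub>j\<close> with \<open>j < 0\<close>, and therefore lies in all \<open>V\<^sub>j\<close>.
\<close>

lemma wave_total:
  assumes u: "u \<in> L2" and wv: "\<And>j \<mu>. \<mu> \<in> Lambda j \<Longrightarrow> l2_inner u (wavelet \<psi> \<mu>) = 0"
  shows "AE x in lborel. u x = 0"
proof -
  obtain p where p: "p \<in> V 0" and up: "\<And>v. v \<in> V 0 \<Longrightarrow> l2_inner (\<lambda>x. u x - p x) v = 0"
    using projection_V[OF u] by blast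
  have pL: "p \<in> L2" using p V_L2 by blast
  have inner: "l2_inner p v = l2_inner u v" if "v \<in> V 0" for v
    using up[OF that] u pL that V_L2 by (simp add: l2_inner_diff_left subset_iff)
  have pV: "p \<in> V (- int n)" for n
  proof (induction n)
    case (Suc n)
    define j where "j = - int n - 1"
    then have j: "- int n = j + 1" "j < 0" by auto
    obtain q where q: "q \<in> V j" "(\<lambda>x. p x - q x) \<in> W j"
      using V_decomposition[of p j] Suc unfolding j by blast
    have qL: "q \<in> L2" using q(1) V_L2 by blast
    let ?d = "\<lambda>x. p x - q x"
    have dL: "?d \<in> L2" using pL qL by (rule L2_diff)
    have "l2_inner ?d (wavelet \<psi> \<mu>) = 0" if \<mu>: "\<mu> \<in> Lambda j" for \<mu>
    proof -
      have "l2_inner p (wavelet \<psi> \<mu>) = 0"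
        using inner[OF wavelet_V[OF \<mu> j(2)]] wv[OF \<mu>] by simp
      moreover have "l2_inner q (wavelet \<psi> \<mu>) = 0"
        using W_orthogonal[OF wavelet_W[OF \<mu>] q(1)] by (subst l2_inner_commute) simp
      ultimately show ?thesis using pL qL wavelet_L2[OF \<mu>] by (simp add: l2_inner_diff_left)
    qed
    then have "l2_inner ?d ?d = 0"
      by (rule basis_orthogonal[OF wavelet_basis W_L2 dL _ q(2)])
    then have "l2_norm ?d = 0" by (simp add: l2_inner_self)
    then have "AE x in lborel. p x - q x = 0" using l2_norm_eq_0_iff[OF dL] by blast
    then have "AE x in lborel. q x = p x" by eventually_elim simp
    then have "p \<in> V j" by (rule closed_subspace_cong_AE[OF V_closed q(1) pL])
    moreover have "j = - int (Suc n)" by (simp add: j_def)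
    ultimately show ?case by simp
  qed (use p in simp)
  have "p \<in> V j" for j
  proof -
    have "- int (nat (- j)) \<le> j" by linarith
    with pV V_mono show ?thesis by blast
  qed
  then have "p \<in> (\<Inter>j. V j)" by blast
  moreover have "(\<Inter>j. V j) = {u \<in> L2. AE x in lborel. u x = 0}"
    using mra unfolding mra_def by (elim conjE)
  ultimately have "AE x in lborel. p x = 0" by blast
  then have "l2_norm p = 0" using l2_norm_eq_0_iff[OF pL] by blast
  then have "l2_inner p v = 0" if "v \<in> L2" for v
    using l2_Cauchy_Schwarz[OF pL that] by simp
  then have "l2_inner u (scaling \<phi> 0 \<mu>) = 0" if "\<mu> \<in> Gamma 0" for \<mu>
    using inner[OF scaling_V[OF that]] scaling_V[OF that] V_L2 by (metis subsetD)
  then show ?thesis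
    using wv by (intro scaling_wave_total[OF u]) (auto simp: fine_index_def)
qed

lemma coarse_fine_orthonormal: "orthonormal (case_sum wave wave) (coarse_index <+> fine_index)"
  unfolding orthonormal_def
proof (intro conjI ballI)
  have sub: "p \<in> coarse_index \<Longrightarrow> p \<in> all_index" "p \<in> fine_index \<Longrightarrow> p \<in> all_index" for p
    by (auto simp: coarse_index_def fine_index_def)
  have disj: "p \<in> coarse_index \<Longrightarrow> q \<in> fine_index \<Longrightarrow> p \<noteq> q"
    "p \<in> coarse_index \<Longrightarrow> q \<in> fine_index \<Longrightarrow> q \<noteq> p" for p q :: "int \<times> (real^'n)"
    by (auto simp: coarse_index_def fine_index_def)
  fix p :: "int \<times> (real^'n) + int \<times> (real^'n)" assume p: "p \<in> coarse_index <+> fine_index"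
  then show "case_sum wave wave p \<in> L2"
    by (elim PlusE) (simp_all add: orthonormal_L2[OF wave_orthonormal] sub)
  fix q :: "int \<times> (real^'n) + int \<times> (real^'n)" assume q: "q \<in> coarse_index <+> fine_index"
  show "l2_inner (case_sum wave wave p) (case_sum wave wave q) = (if p = q then 1 else 0)"
    using p q
    by (elim PlusE) (simp_all add: orthonormal_inner[OF wave_orthonormal] sub disj)
qed

lemma coarse_fine_total: "complete_family (case_sum wave wave) (coarse_index <+> fine_index)"
  unfolding complete_family_def
proof (intro ballI impI)
  fix u :: "real^'n \<Rightarrow> complex"
  assume u: "u \<in> L2" and 0: "\<forall>p\<in>coarse_index <+> fine_index. l2_inner u (case_sum wave wave p) = 0"
  show "AE x in lborel. u x = 0"
  proof (rule wave_total[OF u])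
    fix j and \<mu> :: "real^'n" assume \<mu>: "\<mu> \<in> Lambda j"
    show "l2_inner u (wavelet \<psi> \<mu>) = 0"
    proof (cases "j < 0")
      case True
      then have "Inl (j, \<mu>) \<in> coarse_index <+> fine_index" using \<mu> by (simp add: coarse_index_def InlI)
      from 0[rule_format, OF this] show ?thesis by simp
    next
      case False
      then have "Inr (j, \<mu>) \<in> coarse_index <+> fine_index" using \<mu> by (simp add: fine_index_def InrI)
      from 0[rule_format, OF this] show ?thesis by simp
    qed
  qed
qed

lemma scaling_fine_orthonormal: "orthonormal (case_sum (scaling \<phi> 0) wave) (Gamma 0 <+> fine_index)"
  unfolding orthonormal_def
proof (intro conjI ballI)
  have sub: "p \<in> fine_index \<Longrightarrow> p \<in> all_index" for p by (auto simp: fine_index_def)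
  note orth = orthonormal_basis_orthonormal[OF scaling_basis[of 0] V_L2]
  have cross: "l2_inner (wave q) (scaling \<phi> 0 \<mu>) = 0" if "\<mu> \<in> Gamma 0" "q \<in> fine_index" for \<mu> q
    using that V_mono[of 0 "fst q"] scaling_V[of \<mu> 0] wavelet_W[of "snd q" "fst q"]
    by (intro W_orthogonal[of _ "fst q"]) (auto simp: fine_index_def)
  then have cross': "l2_inner (scaling \<phi> 0 \<mu>) (wave q) = 0" if "\<mu> \<in> Gamma 0" "q \<in> fine_index" for \<mu> q
    using that by (subst l2_inner_commute) simp
  fix p :: "real^'n + int \<times> (real^'n)" assume p: "p \<in> Gamma 0 <+> fine_index"
  then show "case_sum (scaling \<phi> 0) wave p \<in> L2"
    by (elim PlusE) (simp_all add: orthonormal_L2[OF wave_orthonormal] orthonormal_L2[OF orth] sub)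
  fix q :: "real^'n + int \<times> (real^'n)" assume q: "q \<in> Gamma 0 <+> fine_index"
  show "l2_inner (case_sum (scaling \<phi> 0) wave p) (case_sum (scaling \<phi> 0) wave q) = (if p = q then 1 else 0)"
    using p q
    by (elim PlusE)
       (simp_all add: orthonormal_inner[OF wave_orthonormal] orthonormal_inner[OF orth] cross cross' sub)
qed

lemma scaling_fine_total: "complete_family (case_sum (scaling \<phi> 0) wave) (Gamma 0 <+> fine_index)"
  unfolding complete_family_def
proof (intro ballI impI)
  fix u :: "real^'n \<Rightarrow> complex"
  assume u: "u \<in> L2" and 0: "\<forall>p\<in>Gamma 0 <+> fine_index. l2_inner u (case_sum (scaling \<phi> 0) wave p) = 0"
  show "AE x in lborel. u x = 0"
    by (rule scaling_wave_total[OF u]) (use 0 in \<open>force simp: Plus_def\<close>)+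
qed

end

section \<open>Synthesis of Sobolev functions\<close>

context wavelet_mra begin

lemma coarse_sum_V: "l2_has_sum (\<lambda>p x. l2_inner u (wave p) * wave p x) coarse_index a \<Longrightarrow> a \<in> V 0"
  by (rule closed_subspace_has_sum[OF V_closed])
     (auto simp: coarse_index_def intro!: closed_subspace_mult V_closed wavelet_V)

lemma scaling_sum_V:
  "l2_has_sum (\<lambda>\<mu> x. l2_inner u (scaling \<phi> 0 \<mu>) * scaling \<phi> 0 \<mu> x) (Gamma 0) a \<Longrightarrow> a \<in> V 0"
  by (rule closed_subspace_has_sum[OF V_closed]) (auto intro!: closed_subspace_mult V_closed scaling_V)

lemma weighted_wave_norm_le:
  assumes u: "u \<in> L2" and F: "finite F" "F \<subseteq> all_index" and t: "0 \<le> t" "\<And>p. p \<in> F \<Longrightarrow> \<bar>\<eta> p\<bar> \<le> t"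
  shows "l2_norm (\<lambda>x. \<Sum>p\<in>F. of_real (\<eta> p) * l2_inner u (wave p) * wave p x) \<le> t * l2_norm u"
proof -
  let ?g = "\<lambda>x. \<Sum>p\<in>F. of_real (\<eta> p) * l2_inner u (wave p) * wave p x"
  have "(l2_norm ?g)\<^sup>2 = (\<Sum>p\<in>F. (cmod (of_real (\<eta> p) * l2_inner u (wave p)))\<^sup>2)"
    by (rule l2_norm_orthonormal_lincomb[OF wave_orthonormal F])
  also have "\<dots> \<le> (\<Sum>p\<in>F. t\<^sup>2 * (cmod (l2_inner u (wave p)))\<^sup>2)"
  proof (intro sum_mono)
    fix p assume "p \<in> F"
    then have "\<bar>\<eta> p\<bar> * cmod (l2_inner u (wave p)) \<le> t * cmod (l2_inner u (wave p))"
      by (intro mult_right_mono t) auto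
    then have "(\<bar>\<eta> p\<bar> * cmod (l2_inner u (wave p)))\<^sup>2 \<le> (t * cmod (l2_inner u (wave p)))\<^sup>2"
      by (rule power_mono) simp
    then show "(cmod (of_real (\<eta> p) * l2_inner u (wave p)))\<^sup>2 \<le> t\<^sup>2 * (cmod (l2_inner u (wave p)))\<^sup>2"
      unfolding norm_mult norm_of_real power_mult_distrib[of t] .
  qed
  also have "\<dots> \<le> t\<^sup>2 * (l2_norm u)\<^sup>2"
    unfolding sum_distrib_left[symmetric]
    by (intro mult_left_mono Bessel_finite[OF wave_orthonormal F u]) simp
  finally have "(l2_norm ?g)\<^sup>2 \<le> (t * l2_norm u)\<^sup>2" unfolding power_mult_distrib .
  then show ?thesis by (rule power2_le_imp_le) (use t(1) in simp)
qed

text \<open>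
  The finite partial sums have uniformly bounded Sobolev norm. For \<open>s > 0\<close> they are split into their
  components in the spaces \<open>W\<^sub>j\<close>. By Bernstein's inequality in \<open>V\<^bsub>j+1\<^esub>\<close>, the component of level \<open>j\<close> has norm at
  most \<open>C 2\<^bsup>(j+1)s\<^esup> 2\<^sup>-\<^sup>2\<^sup>j\<^sup>s \<parallel>u\<parallel>\<close>, and these bounds form a geometric series.
\<close>

lemma fine_sum_sobolev_bounded:
  assumes C: "0 \<le> C" and Bernstein: "\<forall>j\<ge>0. \<forall>g\<in>V j. sobolev_bounded s (C * 2 powr (of_int j * s) * l2_norm g) g"
    and s: "0 \<le> s" and u: "u \<in> L2"
    and b: "l2_has_sum (\<lambda>p x. of_real (2 powr (- 2 * of_int (fst p) * s)) * l2_inner u (wave p) * wave p x) fine_index b"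
  shows "\<exists>M. sobolev_bounded s M b"
proof -
  let ?\<eta> = "\<lambda>p::int \<times> (real^'n). (2::real) powr (- 2 * of_int (fst p) * s)"
  let ?g = "\<lambda>F x. \<Sum>p\<in>F. of_real (?\<eta> p) * l2_inner u (wave p) * wave p x"
  have all: "F \<subseteq> all_index" if "F \<subseteq> fine_index" for F
    using that by (auto simp: fine_index_def)
  have gV: "?g F \<in> V k" if "F \<subseteq> fine_index" "\<And>p. p \<in> F \<Longrightarrow> fst p < k" for F k
  proof (intro closed_subspace_sum closed_subspace_mult V_closed)
    fix p assume "p \<in> F"
    then show "wave p \<in> V k" using that by (intro wavelet_V[of _ "fst p"]) (auto simp: fine_index_def)
  qed
  have "\<exists>M. \<forall>F. finite F \<longrightarrow> F \<subseteq> fine_index \<longrightarrow> sobolev_bounded s M (?g F)"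
  proof (cases "s = 0")
    case True
    have "sobolev_bounded s (C * l2_norm u) (?g F)" if F: "finite F" "F \<subseteq> fine_index" for F
    proof -
      \<comment> \<open>All terms lie in \<open>V k\<close>, and the Sobolev norm of order zero is not affected by the level.\<close>
      define k where "k = Max (insert 0 (fst ` F)) + 1"
      have k: "fst p < k" if "p \<in> F" for p
      proof -
        have "fst p \<le> Max (insert 0 (fst ` F))" using F(1) that by (intro Max_ge) auto
        then show ?thesis by (simp add: k_def)
      qed
      have "0 \<le> Max (insert 0 (fst ` F))" using F(1) by (intro Max_ge) auto
      then have k0: "0 \<le> k" by (simp add: k_def)
      have "sobolev_bounded s (C * 2 powr (of_int k * s) * l2_norm (?g F)) (?g F)"
        using Bernstein k0 gV[OF F(2) k] by blast
      moreover have "l2_norm (?g F) \<le> 1 * l2_norm u"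
        using True by (intro weighted_wave_norm_le u F all) auto
      then have "C * 2 powr (of_int k * s) * l2_norm (?g F) \<le> C * l2_norm u"
        using True C by (simp add: mult_left_mono)
      ultimately show ?thesis by (rule sobolev_bounded_mono)
    qed
    then show ?thesis by blast
  next
    case False
    define d where "d = (2::real) powr (- s)"
    have d: "0 < d" "d < 1" using s False by (auto simp: d_def powr_less_one)
    let ?M = "C * 2 powr s * l2_norm u * (\<Sum>n. d ^ n)"
    have "sobolev_bounded s ?M (?g F)" if F: "finite F" "F \<subseteq> fine_index" for F
    proof -
      let ?J = "fst ` F" and ?F = "\<lambda>j. {p\<in>F. fst p = j}"
      have J0: "0 \<le> j" if "j \<in> ?J" for j using that F(2) by (auto simp: fine_index_def)
      have level: "sobolev_bounded s (C * 2 powr s * l2_norm u * d ^ nat j) (?g (?F j))" if j: "j \<in> ?J" for j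
      proof -
        have bounded: "sobolev_bounded s (C * 2 powr (of_int (j + 1) * s) * l2_norm (?g (?F j))) (?g (?F j))"
        proof (rule Bernstein[rule_format])
          show "0 \<le> j + 1" using J0[OF j] by simp
          show "?g (?F j) \<in> V (j + 1)" using F(2) by (intro gV) auto
        qed
        have "l2_norm (?g (?F j)) \<le> 2 powr (- 2 * of_int j * s) * l2_norm u"
          using F all by (intro weighted_wave_norm_le u) auto
        then have "C * 2 powr (of_int (j + 1) * s) * l2_norm (?g (?F j))
            \<le> C * 2 powr (of_int (j + 1) * s) * (2 powr (- 2 * of_int j * s) * l2_norm u)"
          using C by (intro mult_left_mono) auto
        also have "\<dots> = C * (2 powr (of_int (j + 1) * s) * 2 powr (- 2 * of_int j * s)) * l2_norm u"
          by (simp only: mult.assoc)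
        also have "2 powr (of_int (j + 1) * s) * 2 powr (- 2 * of_int j * s) = 2 powr s * (2::real) powr (- s * of_int j)"
          unfolding powr_add[symmetric] by (simp add: algebra_simps)
        also have "(2::real) powr (- s * of_int j) = d ^ nat j"
          using J0[OF j] d(1) unfolding powr_powr[symmetric] d_def[symmetric]
          by (simp flip: powr_realpow)
        also have "C * (2 powr s * d ^ nat j) * l2_norm u = C * 2 powr s * l2_norm u * d ^ nat j"
          by (simp only: mult_ac)
        finally have "C * 2 powr (of_int (j + 1) * s) * l2_norm (?g (?F j)) \<le> C * 2 powr s * l2_norm u * d ^ nat j" .
        with bounded show ?thesis by (rule sobolev_bounded_mono)
      qed
      have "?g F = (\<lambda>x. \<Sum>j\<in>?J. ?g (?F j) x)"
        using F(1) by (intro ext sum.group[symmetric]) auto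
      moreover have "sobolev_bounded s (\<Sum>j\<in>?J. C * 2 powr s * l2_norm u * d ^ nat j) (\<lambda>x. \<Sum>j\<in>?J. ?g (?F j) x)"
        using F(1) level by (intro sobolev_bounded_sum) auto
      moreover have "(\<Sum>j\<in>?J. C * 2 powr s * l2_norm u * d ^ nat j) \<le> ?M"
      proof -
        have "inj_on nat ?J" using J0 by (intro inj_onI) (simp only: eq_nat_nat_iff)
        then have "(\<Sum>j\<in>?J. d ^ nat j) = (\<Sum>n\<in>nat ` ?J. d ^ n)" by (simp add: sum.reindex)
        also have "\<dots> \<le> (\<Sum>n. d ^ n)"
          using F(1) d by (intro sum_le_suminf summable_geometric) auto
        finally show ?thesis
          unfolding sum_distrib_left[symmetric] using C by (intro mult_left_mono) auto
      qed
      ultimately show ?thesis by (simp only:) (rule sobolev_bounded_mono)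
    qed
    then show ?thesis by blast
  qed
  then obtain M where M: "\<forall>F. finite F \<longrightarrow> F \<subseteq> fine_index \<longrightarrow> sobolev_bounded s M (?g F)" ..
  have "sobolev_bounded s M b"
  proof (rule sobolev_bounded_closed)
    show "b \<in> L2" using b by (rule l2_has_sum_L2)
    fix e :: real assume "e > 0"
    have "((\<lambda>F. l2_dist (?g F) b) \<longlongrightarrow> 0) (finite_subsets_at_top fine_index)"
      using b by (simp add: l2_has_sum_def l2_tendsto_def)
    from tendstoD[OF this \<open>e > 0\<close>] obtain F where F: "finite F" "F \<subseteq> fine_index" "l2_dist (?g F) b < e"
      by (auto simp: eventually_finite_subsets_at_top)
    have "sobolev_bounded s M (?g F)" using M F(1,2) by blast
    with F(3) show "\<exists>v. sobolev_bounded s M v \<and> l2_dist v b < e"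
      by (intro exI[of _ "?g F"] conjI)
  qed
  then show ?thesis ..
qed

lemma wave_weights:
  assumes "0 \<le> s" "p \<in> fine_index"
  shows "2 powr (2 * of_int (fst p) * s) * 2 powr (- 2 * of_int (fst p) * s) = (1::real)"
    and "\<bar>2 powr (- 2 * of_int (fst p) * s)\<bar> \<le> (1::real)"
proof -
  show "2 powr (2 * of_int (fst p) * s) * 2 powr (- 2 * of_int (fst p) * s) = (1::real)"
    by (simp flip: powr_add)
  have "0 \<le> of_int (fst p) * s" using assms by (intro mult_nonneg_nonneg) (auto simp: fine_index_def)
  then have "- 2 * of_int (fst p) * s \<le> 0" unfolding mult.assoc by linarith
  then have "2 powr (- 2 * of_int (fst p) * s) \<le> (2::real) powr 0" by (rule powr_mono) simp
  then show "\<bar>2 powr (- 2 * of_int (fst p) * s)\<bar> \<le> (1::real)" by simp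
qed

end

section \<open>The adjoint of the Sobolev embedding\<close>

theorem proposition6p2:
  fixes s :: real and r :: nat
    and V :: "int \<Rightarrow> (real^'n \<Rightarrow> complex) set"
    and \<phi> :: "real^'n \<Rightarrow> complex"
    and \<psi> :: "real^'n \<Rightarrow> real^'n \<Rightarrow> complex"
  assumes "0 \<le> s" and "s < real r"
    and "\<forall>\<epsilon>\<in>wavelet_types. \<exists>m. basic_wavelet m (\<psi> \<epsilon>)"
    and "mra V \<phi>" and "regular r \<phi>" and "corresponds \<psi> V \<phi>"
  shows
    "(\<forall>u\<in>L2.
        (\<exists>w. is_embedding_adjoint s (wavelet_inner s \<psi>) u w) \<and>
        (\<forall>w. is_embedding_adjoint s (wavelet_inner s \<psi>) u w \<longrightarrow>
           (\<exists>a b.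
              l2_has_sum (\<lambda>(j, \<mu>) x. l2_inner u (wavelet \<psi> \<mu>) * wavelet \<psi> \<mu> x) coarse_index a \<and>
              l2_has_sum (\<lambda>(j, \<mu>) x. of_real (2 powr (- 2 * of_int j * s)) *
                 l2_inner u (wavelet \<psi> \<mu>) * wavelet \<psi> \<mu> x) fine_index b \<and>
              (AE x in lborel. w x = a x + b x)))) \<and>
     (\<forall>u\<in>L2.
        (\<exists>w. is_embedding_adjoint s (scaling_wavelet_inner s \<phi> \<psi>) u w) \<and>
        (\<forall>w. is_embedding_adjoint s (scaling_wavelet_inner s \<phi> \<psi>) u w \<longrightarrow>
           (\<exists>a b.
              l2_has_sum (\<lambda>\<mu> x. l2_inner u (scaling \<phi> 0 \<mu>) * scaling \<phi> 0 \<mu> x) (Gamma 0) a \<and>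
              l2_has_sum (\<lambda>(j, \<mu>) x. of_real (2 powr (- 2 * of_int j * s)) *
                 l2_inner u (wavelet \<psi> \<mu>) * wavelet \<psi> \<mu> x) fine_index b \<and>
              (AE x in lborel. w x = a x + b x))))"
proof -
  interpret wavelet_mra V \<phi> \<psi> by unfold_locales fact+
  obtain C where C: "0 \<le> C"
    and B: "\<forall>j\<ge>0. \<forall>g\<in>V j. sobolev_bounded s (C * 2 powr (of_int j * s) * l2_norm g) g"
    using Bernstein[OF assms(4,5,1) less_imp_le[OF assms(2)] scaling_basis] by blast
  have V_sobolev: "g \<in> sobolev s" if "0 \<le> j" "g \<in> V j" for g j
    using B that sobolev_bounded_imp_sobolev assms(1) by blast
  have fine_sobolev: "wave p \<in> sobolev s" if "p \<in> fine_index" for p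
    using that by (intro V_sobolev[of "fst p + 1"] wavelet_V[of _ "fst p"]) (auto simp: fine_index_def)
  have coarse_sobolev: "wave p \<in> sobolev s" if "p \<in> coarse_index" for p
    using that by (intro V_sobolev[of 0] wavelet_V[of _ "fst p"]) (auto simp: coarse_index_def)
  have synthesis: "(\<lambda>x. a x + b x) \<in> sobolev s"
    if a: "a \<in> V 0" and u: "u \<in> L2" and
      b: "l2_has_sum (\<lambda>p x. of_real (2 powr (- 2 * of_int (fst p) * s)) * l2_inner u (wave p) * wave p x) fine_index b"
    for a b u
  proof -
    have "sobolev_bounded s (C * 2 powr (of_int 0 * s) * l2_norm a) a" using B a by blast
    moreover obtain M where "sobolev_bounded s M b"
      using fine_sum_sobolev_bounded[OF C B assms(1) u b] ..
    ultimately show ?thesis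
      by (rule sobolev_bounded_imp_sobolev[OF sobolev_bounded_add assms(1)])
  qed
  show ?thesis
    unfolding wavelet_inner_def[abs_def] scaling_wavelet_inner_def[abs_def] case_prod_unfold
  proof (intro conjI[of "Ball _ _"] ballI, goal_cases)
    case (1 u)
    show ?case
      by (rule embedding_adjoint_expansion[OF coarse_fine_orthonormal coarse_fine_total
            wave_weights[OF assms(1)] coarse_sobolev fine_sobolev synthesis[OF coarse_sum_V 1] 1])
  next
    case (2 u)
    show ?case
      by (rule embedding_adjoint_expansion[OF scaling_fine_orthonormal scaling_fine_total
            wave_weights[OF assms(1)] V_sobolev[OF order_refl scaling_V] fine_sobolev
            synthesis[OF scaling_sum_V 2] 2])
  qed
qed

end
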